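(* Let $\mathcal{C}$ be any class of circuits, each circuit $G\in\mathcal{C}$ representing a relational specification $\varphi_G(\mathbf{X},\mathbf{I})$ over system inputs $\mathbf{I}$ and system outputs $\mathbf{X}$. Then: (1) Boolean Skolem function synthesis is solvable in polynomial time (in $|G|$) for the circuits in $\mathcal{C}$ if and only if every circuit $G\in\mathcal{C}$ can be compiled, in time polynomial in $|G|$, to a circuit $G^\star$ with $[\![\varphi_{G^\star}]\!]=[\![\varphi_G]\!]$ that is in SAUNF with respect to $\mathrm{set}(\mathbf{X})$ and some sequence $S$ (the compilation producing $G^\star$ together with $S$). (2) Every specification in $\mathcal{C}$ admits a Skolem function vector of size polynomial in $|G|$ if and only if every circuit $G\in\mathcal{C}$ has a semantically equivalent circuit of size polynomial in $|G|$ that is in SAUNF with respect to $\mathrm{set}(\mathbf{X})$ and some sequence $S$.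
   Context: Boolean values are $\bot$ (false) and $\top$ (true). $\mathbf{I}=(i_1,\dots,i_n)$ (system inputs) and $\mathbf{X}=(x_1,\dots,x_m)$ (system outputs) are disjoint sequences of Boolean variables; $\mathrm{set}(\mathbf{V})$ is the set of variables of a sequence $\mathbf{V}$. A literal is $v$ or $\neg v$ for a variable $v$. A circuit is an NNF circuit: a rooted DAG in which every node is a descendant of the root, each internal node is labeled $\wedge$ or $\vee$ and has exactly two children, and each leaf is labeled by a literal or a constant $\top,\bot$ (several leaves may have the same label). $|G|$ is the number of nodes. $\varphi_G$ is the formula represented by $G$ (leaf: its label; $\wedge$/$\vee$-node: conjunction/disjunction of its children's formulas); $[\![\varphi_G]\!]$ is the Boolean function it denotes. An $\ell$-leaf is a leaf labeled by literal $\ell$; a set of leaves is literal-consistent if all its leaves carry the same literal. For a literal-consistent set $L$ of leaves and a label $b$, $G|_{L:b}$ is $G$ with each leaf of $L$ relabeled by $b$; $G|_{\ell_1=b_1,\dots,\ell_r=b_r}$ is $G$ with every $\ell_j$-leaf relabeled by $b_j$ ($\ell$ and $\neg\ell$ count as distinct literals). For an assignment $\sigma$ to some variables, $[\![\varphi]\!]_\sigma$ is the function of the remaining variables obtained by substituting $\sigma$. $\wedge$-realizability: let $G$ have leaves labeled by literals over $\mathbf{I},\mathbf{X}$ (or constants), $\ell$ a literal labeling a leaf with underlying variable $v_\ell$, and $w,w'$ fresh variables. $\ell$ is $\wedge$-realizable in $G$ iff there is an assignment $\sigma:(\mathrm{set}(\mathbf{I})\cup\mathrm{set}(\mathbf{X}))\setminus\{v_\ell\}\to\{\bot,\top\}$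 with $[\![G|_{\ell=w,\neg\ell=w'}]\!]_\sigma=[\![w\wedge w']\!]$; otherwise $\ell$ is $\wedge$-unrealizable. For a literal-consistent set $S$ of leaves labeled $\ell$, with $S'$ the set of all $\ell$-leaves of $G$, $S$ is $\wedge$-realizable (resp. $\wedge$-unrealizable) in $G$ iff $\ell$ is $\wedge$-realizable (resp. $\wedge$-unrealizable) in $G|_{S'\setminus S:\bot}$. SAUNF: $G$ is in SAUNF w.r.t. $\mathrm{set}(\mathbf{X})$ and a non-empty sequence $S=(S_1,\dots,S_k)$ of sets of leaves of $G$ iff (1) the $S_j$ are pairwise disjoint; (2) each $S_j$ is literal-consistent, labeled by a literal over $\mathbf{X}$; (3) $S_1$ is $\wedge$-unrealizable in $G$; (4) for each $j\in\{2,\dots,k\}$, $S_j$ is $\wedge$-unrealizable in $G|_{S_1:\top,\dots,S_{j-1}:\top}$; (5) $[\![\varphi_{G|_{S_1:\top,\dots,S_k:\top}}]\!]$ does not depend on the values of $\mathbf{X}$. A Skolem function vector for $\mathbf{X}$ in $\varphi_G(\mathbf{X},\mathbf{I})$ is a sequence $\Psi(\mathbf{I})=(\psi_1(\mathbf{I}),\dots,\psi_m(\mathbf{I}))$ of circuits over $\mathbf{I}$ such that $\forall\mathbf{I}\,(\varphi_G(\Psi(\mathbf{I}),\mathbf{I})\Leftrightarrow\exists\mathbf{X}\,\varphi_G(\mathbf{X},\mathbf{I}))$; its size is the total size of these circuits. Boolean Skolem function synthesis is the problem: given $G$, output such a $\Psi$.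
   Formalization: Assumes X is non-empty and that the number of variables in I and X is bounded by a polynomial in |G| on the class; otherwise (2) fails, e.g. for G = ⊤ with m unbounded outputs, where Skolem vectors have size at least m but x_1 ∨ ¬x_1 is a constant-size SAUNF form. *)

theory Defs
  imports "HOL-Computational_Algebra.Polynomial"
begin

section \<open>Circuits\<close>

text \<open>
  A specification has system inputs \<open>Inp 0, \<dots>, Inp (n-1)\<close> and system outputs
  \<open>Out 0, \<dots>, Out (m-1)\<close>. The variables \<open>W\<close> and \<open>W'\<close> are the two fresh variables of the
  definition of \<open>\<and>\<close>-realizability; they never occur in the circuits of a specification.
\<close>

datatype var = Inp nat | Out nat | W | W'

datatype literal = Pos var | Neg var

datatype label = Lit literal | Const bool

datatype gate = Leaf label | And nat nat | Or nat nat

text \<open>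
  A circuit is given by the list of its nodes. Node \<open>v\<close> is the \<open>v\<close>-th entry, and the two numbers
  of an internal node are its children. Nodes are numbered topologically (children before
  parents), which is possible for every finite DAG, so the root is the last node. The size
  \<open>|G|\<close> is \<open>length G\<close>.
\<close>

type_synonym circuit = "gate list"

definition root :: "circuit \<Rightarrow> nat" where
  "root G = length G - 1"

fun children :: "gate \<Rightarrow> nat set" where
  "children (Leaf b) = {}"
| "children (And u v) = {u, v}"
| "children (Or u v) = {u, v}"

definition edges :: "circuit \<Rightarrow> (nat \<times> nat) set" where
  "edges G = {(u, v). u < length G \<and> v \<in> children (G ! u)}"

fun negate :: "literal \<Rightarrow> literal" where
  "negate (Pos x) = Neg x"
| "negate (Neg x) = Pos x"

fun lit_var :: "literal \<Rightarrow> var" where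
  "lit_var (Pos x) = x"
| "lit_var (Neg x) = x"

fun label_vars :: "label \<Rightarrow> var set" where
  "label_vars (Lit l) = {lit_var l}"
| "label_vars (Const b) = {}"

definition inputs :: "nat \<Rightarrow> var set" where
  "inputs n = Inp ` {..<n}"

definition outputs :: "nat \<Rightarrow> var set" where
  "outputs m = Out ` {..<m}"

fun gate_ok :: "var set \<Rightarrow> nat \<Rightarrow> gate \<Rightarrow> bool" where
  "gate_ok V w (Leaf b) \<longleftrightarrow> label_vars b \<subseteq> V"
| "gate_ok V w (And u v) \<longleftrightarrow> u < w \<and> v < w \<and> u \<noteq> v"
| "gate_ok V w (Or u v) \<longleftrightarrow> u < w \<and> v < w \<and> u \<noteq> v"

definition circuit_over :: "var set \<Rightarrow> circuit \<Rightarrow> bool" where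
  "circuit_over V G \<longleftrightarrow>
     G \<noteq> [] \<and>
     (\<forall>w < length G. gate_ok V w (G ! w)) \<and>
     (\<forall>w < length G. (root G, w) \<in> (edges G)\<^sup>*)"

section \<open>Semantics\<close>

datatype formula = Atom label | Conj formula formula | Disj formula formula

text \<open>
  The guards only serve termination; they hold at every node of a circuit satisfying
  \<^const>\<open>circuit_over\<close>, so that the default \<open>Const False\<close> is never used there.
\<close>

function formula_at :: "circuit \<Rightarrow> nat \<Rightarrow> formula" where
  "formula_at G w =
     (case G ! w of
        Leaf b \<Rightarrow> Atom b
      | And u v \<Rightarrow>
          (if u < w \<and> v < w then Conj (formula_at G u) (formula_at G v) else Atom (Const False))
      | Or u v \<Rightarrow>
          (if u < w \<and> v < w then Disj (formula_at G u) (formula_at G v) else Atom (Const False)))"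
  by pat_completeness auto
termination by (relation "measure snd") auto

declare formula_at.simps [simp del]

definition formula_of :: "circuit \<Rightarrow> formula" where
  "formula_of G = formula_at G (root G)"

type_synonym assignment = "var \<Rightarrow> bool"

fun label_sem :: "label \<Rightarrow> assignment \<Rightarrow> bool" where
  "label_sem (Lit (Pos x)) \<tau> = \<tau> x"
| "label_sem (Lit (Neg x)) \<tau> = (\<not> \<tau> x)"
| "label_sem (Const b) \<tau> = b"

primrec sem :: "formula \<Rightarrow> assignment \<Rightarrow> bool" where
  "sem (Atom b) \<tau> = label_sem b \<tau>"
| "sem (Conj \<phi> \<psi>) \<tau> = (sem \<phi> \<tau> \<and> sem \<psi> \<tau>)"
| "sem (Disj \<phi> \<psi>) \<tau> = (sem \<phi> \<tau> \<or> sem \<psi> \<tau>)"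

definition sem_under :: "formula \<Rightarrow> (var \<rightharpoonup> bool) \<Rightarrow> assignment \<Rightarrow> bool" where
  "sem_under \<phi> \<sigma> = (\<lambda>\<tau>. sem \<phi> (\<lambda>x. case \<sigma> x of Some b \<Rightarrow> b | None \<Rightarrow> \<tau> x))"

section \<open>SAUNF\<close>

definition lit_leaves :: "literal \<Rightarrow> circuit \<Rightarrow> nat set" where
  "lit_leaves l G = {v. v < length G \<and> G ! v = Leaf (Lit l)}"

definition relabel :: "nat set \<Rightarrow> label \<Rightarrow> circuit \<Rightarrow> circuit" where
  "relabel L b G = map (\<lambda>v. if v \<in> L then Leaf b else G ! v) [0..<length G]"

fun relabel_gate :: "(literal \<rightharpoonup> label) \<Rightarrow> gate \<Rightarrow> gate" where
  "relabel_gate f (Leaf (Lit l)) = (case f l of Some b \<Rightarrow> Leaf b | None \<Rightarrow> Leaf (Lit l))"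
| "relabel_gate f g = g"

definition relabel_lits :: "(literal \<rightharpoonup> label) \<Rightarrow> circuit \<Rightarrow> circuit" where
  "relabel_lits f G = map (relabel_gate f) G"

definition and_realizable :: "nat \<Rightarrow> nat \<Rightarrow> circuit \<Rightarrow> literal \<Rightarrow> bool" where
  "and_realizable n m G l \<longleftrightarrow>
     (\<exists>\<sigma>. dom \<sigma> = (inputs n \<union> outputs m) - {lit_var l} \<and>
        sem_under (formula_of (relabel_lits [l \<mapsto> Lit (Pos W), negate l \<mapsto> Lit (Pos W')] G)) \<sigma>
        = sem (Conj (Atom (Lit (Pos W))) (Atom (Lit (Pos W')))))"

text \<open>
  A set of leaves labeled \<open>l\<close> is non-empty: otherwise it does not determine \<open>l\<close>, and \<open>l\<close> labels
  no leaf after all \<open>l\<close>-leaves outside the set have been relabeled.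
\<close>

definition labeled_by :: "circuit \<Rightarrow> nat set \<Rightarrow> literal \<Rightarrow> bool" where
  "labeled_by G L l \<longleftrightarrow> L \<noteq> {} \<and> L \<subseteq> lit_leaves l G"

definition and_realizable_set :: "nat \<Rightarrow> nat \<Rightarrow> circuit \<Rightarrow> nat set \<Rightarrow> bool" where
  "and_realizable_set n m G L \<longleftrightarrow>
     (\<exists>l. labeled_by G L l \<and>
        and_realizable n m (relabel (lit_leaves l G - L) (Const False) G) l)"

abbreviation and_unrealizable_set :: "nat \<Rightarrow> nat \<Rightarrow> circuit \<Rightarrow> nat set \<Rightarrow> bool" where
  "and_unrealizable_set n m G L \<equiv> \<not> and_realizable_set n m G L"

definition relabel_true :: "nat set list \<Rightarrow> circuit \<Rightarrow> circuit" where
  "relabel_true S G = fold (\<lambda>L H. relabel L (Const True) H) S G"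

definition independent_of :: "var set \<Rightarrow> (assignment \<Rightarrow> bool) \<Rightarrow> bool" where
  "independent_of V f \<longleftrightarrow> (\<forall>\<sigma> \<tau>. (\<forall>x. x \<notin> V \<longrightarrow> \<sigma> x = \<tau> x) \<longrightarrow> f \<sigma> = f \<tau>)"

text \<open>
  With \<open>S\<close> indexed from \<open>0\<close>, the case \<open>j = 0\<close> of the fifth conjunct is the
  \<open>\<and>\<close>-unrealizability of the first set in \<open>G\<close> itself.
\<close>

definition SAUNF :: "nat \<Rightarrow> nat \<Rightarrow> circuit \<Rightarrow> nat set list \<Rightarrow> bool" where
  "SAUNF n m G S \<longleftrightarrow>
     circuit_over (inputs n \<union> outputs m) G \<and>
     S \<noteq> [] \<and>
     (\<forall>i < length S. \<forall>j < length S. i \<noteq> j \<longrightarrow> S ! i \<inter> S ! j = {}) \<and>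
     (\<forall>j < length S. \<exists>l. lit_var l \<in> outputs m \<and> labeled_by G (S ! j) l) \<and>
     (\<forall>j < length S. and_unrealizable_set n m (relabel_true (take j S) G) (S ! j)) \<and>
     independent_of (outputs m) (sem (formula_of (relabel_true S G)))"

section \<open>Specifications and Skolem functions\<close>

text \<open>A triple \<open>(n, m, G)\<close>: number of inputs, number of outputs, circuit.\<close>

type_synonym spec = "nat \<times> nat \<times> circuit"

fun wf_spec :: "spec \<Rightarrow> bool" where
  "wf_spec (n, m, G) \<longleftrightarrow> m \<ge> 1 \<and> circuit_over (inputs n \<union> outputs m) G"

text \<open>
  ``Polynomial in \<open>|G|\<close>'' presupposes that the sequences of inputs and outputs are not larger
  than polynomial in \<open>|G|\<close>: a Skolem function vector consists of \<open>m\<close> circuits. If every input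
  and output labels a leaf of \<open>G\<close>, then \<open>n + m \<le> |G|\<close>.
\<close>

definition vars_poly_bounded :: "spec set \<Rightarrow> bool" where
  "vars_poly_bounded C \<longleftrightarrow> (\<exists>p :: nat poly. \<forall>(n, m, G) \<in> C. n + m \<le> poly p (length G))"

definition equivalent :: "circuit \<Rightarrow> circuit \<Rightarrow> bool" where
  "equivalent G H \<longleftrightarrow> sem (formula_of G) = sem (formula_of H)"

definition plug_in :: "nat \<Rightarrow> circuit list \<Rightarrow> assignment \<Rightarrow> assignment" where
  "plug_in m \<Psi> \<sigma> =
     (\<lambda>x. case x of Out j \<Rightarrow> if j < m then sem (formula_of (\<Psi> ! j)) \<sigma> else \<sigma> x | _ \<Rightarrow> \<sigma> x)"

definition skolem_vector :: "nat \<Rightarrow> nat \<Rightarrow> circuit \<Rightarrow> circuit list \<Rightarrow> bool" where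
  "skolem_vector n m G \<Psi> \<longleftrightarrow>
     length \<Psi> = m \<and>
     (\<forall>\<psi> \<in> set \<Psi>. circuit_over (inputs n) \<psi>) \<and>
     (\<forall>\<sigma>. sem (formula_of G) (plug_in m \<Psi> \<sigma>) \<longleftrightarrow>
        (\<exists>\<tau>. (\<forall>x. x \<notin> outputs m \<longrightarrow> \<tau> x = \<sigma> x) \<and> sem (formula_of G) \<tau>))"

definition vector_size :: "circuit list \<Rightarrow> nat" where
  "vector_size \<Psi> = (\<Sum>\<psi> \<leftarrow> \<Psi>. length \<psi>)"

section \<open>Computations\<close>

text \<open>
  The machine model is Jones's WHILE language over binary trees. Every evaluated
  (sub)expression is charged the size of its value, i.e. values are counted as copied and never
  as shared. Hence all trees occurring in a run, the result included, have size bounded by the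
  size of the input plus the running time, and polynomial time in this model coincides with
  polynomial time on multitape Turing machines.
\<close>

datatype tree = Tip | Node (left: tree) (right: tree)
  where "left Tip = Tip" | "right Tip = Tip"

datatype expr = Var nat | Nil_Expr | Cons_Expr expr expr | Hd_Expr expr | Tl_Expr expr

datatype com = Assign nat expr | Seq com com | If expr com com | While expr com

type_synonym store = "nat \<Rightarrow> tree"

primrec val :: "expr \<Rightarrow> store \<Rightarrow> tree" where
  "val (Var x) s = s x"
| "val Nil_Expr s = Tip"
| "val (Cons_Expr a b) s = Node (val a s) (val b s)"
| "val (Hd_Expr a) s = left (val a s)"
| "val (Tl_Expr a) s = right (val a s)"

primrec tree_size :: "tree \<Rightarrow> nat" where
  "tree_size Tip = 1"
| "tree_size (Node a b) = tree_size a + tree_size b + 1"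

primrec cost :: "expr \<Rightarrow> store \<Rightarrow> nat" where
  "cost (Var x) s = tree_size (s x)"
| "cost Nil_Expr s = 1"
| "cost (Cons_Expr a b) s = cost a s + cost b s + tree_size (Node (val a s) (val b s))"
| "cost (Hd_Expr a) s = cost a s + tree_size (left (val a s))"
| "cost (Tl_Expr a) s = cost a s + tree_size (right (val a s))"

text \<open>
  \<open>exec c s t s'\<close>: started in store \<open>s\<close>, the program \<open>c\<close> halts in store \<open>s'\<close> after time \<open>t\<close>.
\<close>

inductive exec :: "com \<Rightarrow> store \<Rightarrow> nat \<Rightarrow> store \<Rightarrow> bool" where
  exec_assign: "exec (Assign x e) s (cost e s) (s(x := val e s))"
| exec_seq: "exec c s t s' \<Longrightarrow> exec d s' t' s'' \<Longrightarrow> exec (Seq c d) s (t + t') s''"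
| exec_if_true: "val e s \<noteq> Tip \<Longrightarrow> exec c s t s' \<Longrightarrow> exec (If e c d) s (cost e s + t) s'"
| exec_if_false: "val e s = Tip \<Longrightarrow> exec d s t s' \<Longrightarrow> exec (If e c d) s (cost e s + t) s'"
| exec_while_false: "val e s = Tip \<Longrightarrow> exec (While e c) s (cost e s) s"
| exec_while_true:
    "val e s \<noteq> Tip \<Longrightarrow> exec c s t s' \<Longrightarrow> exec (While e c) s' t' s''
     \<Longrightarrow> exec (While e c) s (cost e s + t + t') s''"

definition computes_within :: "com \<Rightarrow> tree \<Rightarrow> nat \<Rightarrow> tree \<Rightarrow> bool" where
  "computes_within c x b y \<longleftrightarrow> (\<exists>t s. t \<le> b \<and> exec c ((\<lambda>_. Tip)(0 := x)) t s \<and> s 0 = y)"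

text \<open>
  Numbers are encoded in unary. All numbers occurring in an instance are bounded by its number
  of nodes or variables, so this affects running times only polynomially.
\<close>

primrec enc_nat :: "nat \<Rightarrow> tree" where
  "enc_nat 0 = Tip"
| "enc_nat (Suc k) = Node Tip (enc_nat k)"

primrec enc_list :: "('a \<Rightarrow> tree) \<Rightarrow> 'a list \<Rightarrow> tree" where
  "enc_list f [] = Tip"
| "enc_list f (x # xs) = Node (f x) (enc_list f xs)"

primrec enc_var :: "var \<Rightarrow> tree" where
  "enc_var (Inp i) = Node (enc_nat 0) (enc_nat i)"
| "enc_var (Out j) = Node (enc_nat 1) (enc_nat j)"
| "enc_var W = Node (enc_nat 2) Tip"
| "enc_var W' = Node (enc_nat 3) Tip"

primrec enc_lit :: "literal \<Rightarrow> tree" where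
  "enc_lit (Pos x) = Node (enc_nat 0) (enc_var x)"
| "enc_lit (Neg x) = Node (enc_nat 1) (enc_var x)"

primrec enc_label :: "label \<Rightarrow> tree" where
  "enc_label (Lit l) = Node (enc_nat 0) (enc_lit l)"
| "enc_label (Const b) = Node (enc_nat 1) (enc_nat (if b then 1 else 0))"

primrec enc_gate :: "gate \<Rightarrow> tree" where
  "enc_gate (Leaf b) = Node (enc_nat 0) (enc_label b)"
| "enc_gate (And u v) = Node (enc_nat 1) (Node (enc_nat u) (enc_nat v))"
| "enc_gate (Or u v) = Node (enc_nat 2) (Node (enc_nat u) (enc_nat v))"

definition enc_circuit :: "circuit \<Rightarrow> tree" where
  "enc_circuit G = enc_list enc_gate G"

fun enc_spec :: "spec \<Rightarrow> tree" where
  "enc_spec (n, m, G) = Node (enc_nat n) (Node (enc_nat m) (enc_circuit G))"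

section \<open>Polynomial-time and polynomial-size properties of classes\<close>

definition poly_time_synthesis :: "spec set \<Rightarrow> bool" where
  "poly_time_synthesis C \<longleftrightarrow>
     (\<exists>c. \<exists>p :: nat poly. \<forall>(n, m, G) \<in> C. \<exists>\<Psi>.
        computes_within c (enc_spec (n, m, G)) (poly p (length G)) (enc_list enc_circuit \<Psi>) \<and>
        skolem_vector n m G \<Psi>)"

text \<open>The sets of leaves are output as lists of node numbers, in any order.\<close>

definition poly_time_SAUNF_compilation :: "spec set \<Rightarrow> bool" where
  "poly_time_SAUNF_compilation C \<longleftrightarrow>
     (\<exists>c. \<exists>p :: nat poly. \<forall>(n, m, G) \<in> C. \<exists>H S.
        computes_within c (enc_spec (n, m, G)) (poly p (length G))
          (Node (enc_circuit H) (enc_list (enc_list enc_nat) S)) \<and>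
        equivalent H G \<and> SAUNF n m H (map set S))"

definition poly_size_skolem :: "spec set \<Rightarrow> bool" where
  "poly_size_skolem C \<longleftrightarrow>
     (\<exists>p :: nat poly. \<forall>(n, m, G) \<in> C. \<exists>\<Psi>.
        skolem_vector n m G \<Psi> \<and> vector_size \<Psi> \<le> poly p (length G))"

definition poly_size_SAUNF :: "spec set \<Rightarrow> bool" where
  "poly_size_SAUNF C \<longleftrightarrow>
     (\<exists>p :: nat poly. \<forall>(n, m, G) \<in> C. \<exists>H S.
        equivalent H G \<and> length H \<le> poly p (length G) \<and> SAUNF n m H S)"

end

theory Submission
  imports Defs
begin

text \<open>
  From SAUNF to Skolem functions: let \<open>G\<^sub>j\<close> be \<open>G\<close> with \<open>S\<^sub>1, \<dots>, S\<^sub>j\<close> set to true. If \<open>G\<^sub>j\<close> is satisfied by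
  some values of the outputs, then by monotonicity and \<open>\<and>\<close>-unrealizability of \<open>S\<^sub>j\<close> the circuit
  \<open>G\<^sub>j\<^sub>-\<^sub>1\<close> is satisfied by the same values or by those with the literal of \<open>S\<^sub>j\<close> made true. Starting
  from arbitrary values for \<open>G\<^sub>k\<close>, which does not depend on the outputs, one descends to \<open>G\<^sub>0 = G\<close>; one
  step costs a copy of \<open>G\<close> and, as negations are needed, a copy of its dual.

  From Skolem functions \<open>\<Psi>\<close> to SAUNF:
  \<open>G(X, I) \<or> (G(\<Psi>(I), I) \<and> \<And>\<^sub>i ((x\<^sub>i \<and> \<psi>\<^sub>i) \<or> (\<not> x\<^sub>i \<and> \<not> \<psi>\<^sub>i)))\<close> is equivalent to \<open>G\<close>, and the singletons
  of the displayed leaves \<open>x\<^sub>i\<close>, \<open>\<not> x\<^sub>i\<close> form the sequence \<open>S\<close>: for fixed values of the other variables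
  only one of the two leaves matters, so \<open>w \<and> w'\<close> cannot arise.

  Both constructions place every gate at a position known in advance. They are therefore
  compositions of maps and concatenations over lists, which makes their running time polynomial.
\<close>

section \<open>Polynomial-time computability\<close>

text \<open>Negation occurs only in leaf labels, so a circuit is monotone once its leaves carry
  independent truth values. With the other variables fixed, the realization is a monotone function
  \<open>F(w, w')\<close>. If \<open>F(True, True)\<close> holds and \<open>F\<close> is not
  \<open>w \<and> w'\<close>, then \<open>F\<close> holds already with one argument false:
  \<open>w = False\<close> amounts to keeping the output values, \<open>w' = False\<close> to making
  the literal true. This is why one set can be undone at a time. Conversely, once all displayed
  leaves are true, the circuit has to be \<open>G(X, I) \<or> G(\<Psi>(I), I)\<close>, which the
  Skolem property identifies with \<open>\<exists>X. G\<close>. The leaves of the original copy of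
  \<open>G\<close> stay outside \<open>S\<close>; in a realization its \<open>l\<close>-leaves are
  false and only \<open>w'\<close> enters, so that no disjunct depends on both \<open>w\<close> and
  \<open>w'\<close>. Two obstacles shape the details. Gates need two distinct children, so a value
  is forwarded by conjunction with a true gate. And the given algorithm is an arbitrary program that
  may overwrite its input, although the conversion of its result needs that input.\<close>

lemma poly_nat_mono: "x \<le> y \<Longrightarrow> poly (p :: nat poly) x \<le> poly p y"
  by (induction p) (auto intro!: add_mono mult_mono)

section \<open>Time-bounded runs, sizes of values and the frame property\<close>

definition runs :: "com \<Rightarrow> store \<Rightarrow> nat \<Rightarrow> store \<Rightarrow> bool" where
  "runs c s b s' \<longleftrightarrow> (\<exists>t \<le> b. exec c s t s')"

lemma runs_mono: "runs c s b s' \<Longrightarrow> b \<le> b' \<Longrightarrow> runs c s b' s'"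
  unfolding runs_def by (meson order_trans)

lemma runs_assign: "runs (Assign x e) s (cost e s) (s(x := val e s))"
  unfolding runs_def by (blast intro: exec_assign)

lemma runs_seq: "runs c s b s' \<Longrightarrow> runs d s' b' s'' \<Longrightarrow> runs (Seq c d) s (b + b') s''"
  unfolding runs_def using exec_seq add_mono by fast

lemma runs_if:
  assumes "runs (if val e s = Tip then d else c) s b s'"
  shows "runs (If e c d) s (cost e s + b) s'"
proof -
  obtain t where t: "t \<le> b" "exec (if val e s = Tip then d else c) s t s'"
    using assms by (auto simp: runs_def)
  then have "exec (If e c d) s (cost e s + t) s'"
    by (cases "val e s = Tip") (auto intro: exec_if_true exec_if_false)
  with t(1) show ?thesis unfolding runs_def by (intro exI[of _ "cost e s + t"]) simp
qed

lemma runs_while_false: "val e s = Tip \<Longrightarrow> runs (While e c) s (cost e s) s"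
  unfolding runs_def by (blast intro: exec_while_false)

lemma runs_while_true:
  "val e s \<noteq> Tip \<Longrightarrow> runs c s b s' \<Longrightarrow> runs (While e c) s' b' s''
    \<Longrightarrow> runs (While e c) s (cost e s + b + b') s''"
proof -
  assume "val e s \<noteq> Tip" "runs c s b s'" "runs (While e c) s' b' s''"
  then obtain t t' where "t \<le> b" "t' \<le> b'" "exec (While e c) s (cost e s + t + t') s''"
    unfolding runs_def by (auto dest: exec_while_true)
  then show ?thesis unfolding runs_def by (intro exI[of _ "cost e s + t + t'"]) simp
qed

lemma tree_size_val: "tree_size (val e s) \<le> cost e s"
  by (cases e) auto

text \<open>Every assignment is charged the size of the value it stores, so a changed register
  cannot hold more than the time spent. This bounds output sizes through running times, even for
  unknown programs.\<close>

lemma exec_size: "exec c s t s' \<Longrightarrow> s' r = s r \<or> tree_size (s' r) \<le> t"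
proof (induction arbitrary: r rule: exec.induct)
  case (exec_assign x e s)
  then show ?case using tree_size_val by simp
next
  case (exec_seq c s t s' d t' s'')
  from exec_seq.IH(1)[of r] exec_seq.IH(2)[of r] show ?case by auto
next
  case (exec_while_true e s c t s' t' s'')
  from exec_while_true.IH(1)[of r] exec_while_true.IH(2)[of r] show ?case by auto
qed (auto intro: trans_le_add2)

primrec expr_bound :: "expr \<Rightarrow> nat" where
  "expr_bound (Var x) = Suc x"
| "expr_bound Nil_Expr = 0"
| "expr_bound (Cons_Expr a b) = max (expr_bound a) (expr_bound b)"
| "expr_bound (Hd_Expr a) = expr_bound a"
| "expr_bound (Tl_Expr a) = expr_bound a"

primrec com_bound :: "com \<Rightarrow> nat" where
  "com_bound (Assign x e) = max (Suc x) (expr_bound e)"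
| "com_bound (Seq c d) = max (com_bound c) (com_bound d)"
| "com_bound (If e c d) = max (expr_bound e) (max (com_bound c) (com_bound d))"
| "com_bound (While e c) = max (expr_bound e) (com_bound c)"

lemma expr_frame:
  "expr_bound e \<le> K \<Longrightarrow> (\<And>r. r < K \<Longrightarrow> s r = u r) \<Longrightarrow> val e s = val e u \<and> cost e s = cost e u"
  by (induction e) auto

text \<open>A program cannot see registers that it does not mention. An arbitrary given program can
  thus run unchanged while registers from \<open>K\<close> on hold other data, in particular a saved
  copy of the input.\<close>

lemma exec_frame:
  "exec c s t s' \<Longrightarrow> com_bound c \<le> K \<Longrightarrow> (\<forall>r<K. s r = u r) \<Longrightarrow>
    \<exists>u'. exec c u t u' \<and> (\<forall>r<K. s' r = u' r) \<and> (\<forall>r\<ge>K. u' r = u r)"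
proof (induction arbitrary: u rule: exec.induct)
  case (exec_assign x e s)
  let ?u = "u(x := val e u)"
  have v: "val e s = val e u" "cost e s = cost e u"
    using expr_frame[of e K s u] exec_assign.prems by auto
  have "exec (Assign x e) u (cost e s) ?u"
    unfolding v by (rule exec.exec_assign)
  moreover have "\<forall>r<K. (s(x := val e s)) r = ?u r"
    unfolding v using exec_assign(2) by simp
  moreover have "\<forall>r\<ge>K. ?u r = u r" using exec_assign(1) by auto
  ultimately show ?case by blast
next
  case (exec_seq c s t s' d t' s'')
  obtain u' where u': "exec c u t u'" "\<forall>r<K. s' r = u' r" "\<forall>r\<ge>K. u' r = u r"
    using exec_seq.IH(1)[OF _ exec_seq.prems(2)] exec_seq.prems(1) by auto
  from exec_seq.prems(1) exec_seq.IH(2)[OF _ u'(2)] obtain u'' where u'':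
    "exec d u' t' u''" "\<forall>r<K. s'' r = u'' r" "\<forall>r\<ge>K. u'' r = u' r" by auto
  show ?case using exec.exec_seq[OF u'(1) u''(1)] u'(3) u''(2,3) by (intro exI[of _ u'']) simp
next
  case (exec_if_true e s c t s' d)
  have v: "val e s = val e u" "cost e s = cost e u"
    using expr_frame[of e K s u] exec_if_true.prems by auto
  obtain u' where u': "exec c u t u'" "\<forall>r<K. s' r = u' r" "\<forall>r\<ge>K. u' r = u r"
    using exec_if_true.IH[OF _ exec_if_true.prems(2)] exec_if_true.prems(1) by auto
  show ?case using exec.exec_if_true[OF exec_if_true(1)[unfolded v] u'(1)] u'(2,3)
    by (intro exI[of _ u']) (simp add: v)
next
  case (exec_if_false e s d t s' c)
  have v: "val e s = val e u" "cost e s = cost e u"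
    using expr_frame[of e K s u] exec_if_false.prems by auto
  obtain u' where u': "exec d u t u'" "\<forall>r<K. s' r = u' r" "\<forall>r\<ge>K. u' r = u r"
    using exec_if_false.IH[OF _ exec_if_false.prems(2)] exec_if_false.prems(1) by auto
  show ?case using exec.exec_if_false[OF exec_if_false(1)[unfolded v] u'(1)] u'(2,3)
    by (intro exI[of _ u']) (simp add: v)
next
  case (exec_while_false e s c)
  have v: "val e s = val e u" "cost e s = cost e u"
    using expr_frame[of e K s u] exec_while_false.prems by auto
  show ?case using exec.exec_while_false[OF exec_while_false(1)[unfolded v]] exec_while_false.prems(2)
    by (intro exI[of _ u]) (simp add: v)
next
  case (exec_while_true e s c t s' t' s'')
  have v: "val e s = val e u" "cost e s = cost e u"
    using expr_frame[of e K s u] exec_while_true.prems by auto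
  obtain u' where u': "exec c u t u'" "\<forall>r<K. s' r = u' r" "\<forall>r\<ge>K. u' r = u r"
    using exec_while_true.IH(1)[OF _ exec_while_true.prems(2)] exec_while_true.prems(1) by auto
  from exec_while_true.IH(2)[OF exec_while_true.prems(1) u'(2)] obtain u'' where u'':
    "exec (While e c) u' t' u''" "\<forall>r<K. s'' r = u'' r" "\<forall>r\<ge>K. u'' r = u' r" by auto
  show ?case using exec.exec_while_true[OF exec_while_true(1)[unfolded v] u'(1) u''(1)] u'(3) u''(2,3)
    by (intro exI[of _ u'']) (simp add: v)
qed

text \<open>
  An input \<open>a\<close> is given as the tree \<open>e a\<close>. The program depends on the register \<open>i\<close> of the input, the
  register \<open>j\<close> of the output and a bound \<open>k\<close> below which no other register may change; registers from
  \<open>k\<close> on are scratch and may initially contain anything. Programs thus compose without renaming.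
\<close>

definition polytime :: "('a \<Rightarrow> tree) \<Rightarrow> ('a \<Rightarrow> tree) \<Rightarrow> bool" where
  "polytime e f \<longleftrightarrow> (\<exists>p c. \<forall>i j k a s. i < k \<longrightarrow> j < k \<longrightarrow> s i = e a \<longrightarrow>
     (\<exists>s'. runs (c i j k) s (poly p (tree_size (e a))) s' \<and> s' j = f a \<and>
           (\<forall>r<k. r \<noteq> j \<longrightarrow> s' r = s r)))"

lemma polytimeI:
  assumes "\<And>i j k a s. i < k \<Longrightarrow> j < k \<Longrightarrow> s i = e a \<Longrightarrow>
     \<exists>s'. runs (c i j k) s (poly p (tree_size (e a))) s' \<and> s' j = f a \<and>
           (\<forall>r<k. r \<noteq> j \<longrightarrow> s' r = s r)"
  shows "polytime e f"
  unfolding polytime_def using assms by blast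

lemma polytimeE:
  assumes "polytime e f"
  obtains p c where "\<And>i j k a s. i < k \<Longrightarrow> j < k \<Longrightarrow> s i = e a \<Longrightarrow>
     \<exists>s'. runs (c i j k) s (poly p (tree_size (e a))) s' \<and> s' j = f a \<and>
           (\<forall>r<k. r \<noteq> j \<longrightarrow> s' r = s r)"
  using assms unfolding polytime_def by blast

text \<open>Read off from a run with input register 0, output register 1 and scratch from 2. The
  added 1 covers an output register left at its initial \<open>Tip\<close>.\<close>

lemma polytime_size:
  assumes "polytime e f"
  obtains p where "\<And>a. tree_size (f a) \<le> poly p (tree_size (e a))"
proof -
  obtain p c where c: "\<And>i j k a s. i < k \<Longrightarrow> j < k \<Longrightarrow> s i = e a \<Longrightarrow>
     \<exists>s'. runs (c i j k) s (poly p (tree_size (e a))) s' \<and> s' j = f a \<and>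
           (\<forall>r<k. r \<noteq> j \<longrightarrow> s' r = s r)"
    using polytimeE[OF assms] by metis
  have "tree_size (f a) \<le> poly (p + [:1:]) (tree_size (e a))" for a
  proof -
    obtain s' t where "exec (c 0 1 2) ((\<lambda>_. Tip)(0 := e a)) t s'" "s' 1 = f a"
      "t \<le> poly p (tree_size (e a))"
      using c[of 0 2 1 "(\<lambda>_. Tip)(0 := e a)" a] by (auto simp: runs_def)
    with exec_size[OF this(1), of 1] show ?thesis by auto
  qed
  with that show thesis by blast
qed

section \<open>Combinators: composition, pairing, branching and folds\<close>

lemma polytime_id: "polytime e e"
proof (rule polytimeI[of _ "\<lambda>i j k. Assign j (Var i)" "[:0, 1:]"])
  fix i j k :: nat and a and s :: store
  assume "i < k" "j < k" "s i = e a"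
  then show "\<exists>s'. runs (Assign j (Var i)) s (poly [:0, 1:] (tree_size (e a))) s' \<and> s' j = e a \<and>
           (\<forall>r<k. r \<noteq> j \<longrightarrow> s' r = s r)"
    using runs_assign[of j "Var i" s] by (intro exI[of _ "s(j := e a)"]) auto
qed

lemma polytime_Tip: "polytime e (\<lambda>a. Tip)"
proof (rule polytimeI[of _ "\<lambda>i j k. Assign j Nil_Expr" "[:1:]"])
  fix i j k :: nat and a and s :: store
  show "\<exists>s'. runs (Assign j Nil_Expr) s (poly [:1:] (tree_size (e a))) s' \<and> s' j = Tip \<and>
           (\<forall>r<k. r \<noteq> j \<longrightarrow> s' r = s r)"
    using runs_assign[of j "Nil_Expr" s] by (intro exI[of _ "s(j := Tip)"]) auto
qed

text \<open>The intermediate value is kept in the scratch register \<open>k\<close>. Its size is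
  polynomial by \<open>polytime_size\<close>, so the second running time is bounded by a composition
  of polynomials.\<close>

lemma polytime_comp:
  assumes "polytime e' h" "polytime e (\<lambda>a. e' (g a))"
  shows "polytime e (\<lambda>a. h (g a))"
proof -
  obtain p c where c: "\<And>i j k a s. i < k \<Longrightarrow> j < k \<Longrightarrow> s i = e' a \<Longrightarrow>
     \<exists>s'. runs (c i j k) s (poly p (tree_size (e' a))) s' \<and> s' j = h a \<and>
           (\<forall>r<k. r \<noteq> j \<longrightarrow> s' r = s r)"
    using polytimeE[OF assms(1)] by metis
  obtain q d where d: "\<And>i j k a s. i < k \<Longrightarrow> j < k \<Longrightarrow> s i = e a \<Longrightarrow>
     \<exists>s'. runs (d i j k) s (poly q (tree_size (e a))) s' \<and> s' j = e' (g a) \<and>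
           (\<forall>r<k. r \<noteq> j \<longrightarrow> s' r = s r)"
    using polytimeE[OF assms(2)] by metis
  obtain r where r: "\<And>a. tree_size (e' (g a)) \<le> poly r (tree_size (e a))"
    using polytime_size[OF assms(2)] by metis
  show ?thesis
  proof (rule polytimeI[of _ "\<lambda>i j k. Seq (d i k (k+1)) (c k j (k+1))" "q + pcompose p r"])
    fix i j k :: nat and a and s :: store
    assume A: "i < k" "j < k" "s i = e a"
    obtain s1 where s1: "runs (d i k (k+1)) s (poly q (tree_size (e a))) s1" "s1 k = e' (g a)"
      "\<And>r. r < k \<Longrightarrow> s1 r = s r"
      using d[of i "k+1" k s a] A by auto
    obtain s2 where s2: "runs (c k j (k+1)) s1 (poly p (tree_size (e' (g a)))) s2" "s2 j = h (g a)"
      "\<And>r. r < k+1 \<Longrightarrow> r \<noteq> j \<Longrightarrow> s2 r = s1 r"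
      using c[of k "k+1" j s1 "g a"] A s1 by auto
    have "poly p (tree_size (e' (g a))) \<le> poly (pcompose p r) (tree_size (e a))"
      unfolding poly_pcompose by (rule poly_nat_mono[OF r])
    then have "runs (Seq (d i k (k+1)) (c k j (k+1))) s (poly (q + pcompose p r) (tree_size (e a))) s2"
      by (intro runs_mono[OF runs_seq[OF s1(1) s2(1)]]) simp
    with s1 s2 show "\<exists>s'. runs (Seq (d i k (k+1)) (c k j (k+1))) s
        (poly (q + pcompose p r) (tree_size (e a))) s' \<and> s' j = h (g a) \<and>
           (\<forall>r<k. r \<noteq> j \<longrightarrow> s' r = s r)"
      by (intro exI[of _ s2]) auto
  qed
qed

lemma polytime_Node:
  assumes "polytime e f" "polytime e g"
  shows "polytime e (\<lambda>a. Node (f a) (g a))"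
proof -
  obtain p c where c: "\<And>i j k a s. i < k \<Longrightarrow> j < k \<Longrightarrow> s i = e a \<Longrightarrow>
     \<exists>s'. runs (c i j k) s (poly p (tree_size (e a))) s' \<and> s' j = f a \<and>
           (\<forall>r<k. r \<noteq> j \<longrightarrow> s' r = s r)"
    using polytimeE[OF assms(1)] by metis
  obtain q d where d: "\<And>i j k a s. i < k \<Longrightarrow> j < k \<Longrightarrow> s i = e a \<Longrightarrow>
     \<exists>s'. runs (d i j k) s (poly q (tree_size (e a))) s' \<and> s' j = g a \<and>
           (\<forall>r<k. r \<noteq> j \<longrightarrow> s' r = s r)"
    using polytimeE[OF assms(2)] by metis
  obtain u where u: "\<And>a. tree_size (f a) \<le> poly u (tree_size (e a))"
    using polytime_size[OF assms(1)] by metis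
  obtain v where v: "\<And>a. tree_size (g a) \<le> poly v (tree_size (e a))"
    using polytime_size[OF assms(2)] by metis
  define C where "C i j k = Seq (c i k (k+1)) (Seq (d i (k+1) (k+2))
      (Assign j (Cons_Expr (Var k) (Var (k+1)))))" for i j k
  define P where "P = p + q + (u + u) + (v + v) + [:1:]"
  show ?thesis
  proof (rule polytimeI[of _ C P])
    fix i j k :: nat and a and s :: store
    assume A: "i < k" "j < k" "s i = e a"
    obtain s1 where s1: "runs (c i k (k+1)) s (poly p (tree_size (e a))) s1" "s1 k = f a"
      "\<And>r. r < k \<Longrightarrow> s1 r = s r"
      using c[of i "k+1" k s a] A by auto
    obtain s2 where s2: "runs (d i (k+1) (k+2)) s1 (poly q (tree_size (e a))) s2" "s2 (k+1) = g a"
      "\<And>r. r < k+1 \<Longrightarrow> s2 r = s1 r"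
      using d[of i "k+2" "k+1" s1 a] A s1 by auto
    let ?E = "Cons_Expr (Var k) (Var (k+1))"
    have s2': "s2 k = f a" using s1 s2 by simp
    have "poly p (tree_size (e a)) + (poly q (tree_size (e a)) + cost ?E s2) \<le> poly P (tree_size (e a))"
      using u[of a] v[of a] s2' s2(2) by (simp add: P_def)
    with runs_seq[OF s1(1) runs_seq[OF s2(1) runs_assign[of j ?E s2]]]
    have "runs (C i j k) s (poly P (tree_size (e a))) (s2(j := val ?E s2))"
      unfolding C_def by (rule runs_mono)
    then show "\<exists>s'. runs (C i j k) s (poly P (tree_size (e a))) s' \<and> s' j = Node (f a) (g a) \<and>
           (\<forall>r<k. r \<noteq> j \<longrightarrow> s' r = s r)"
      using s1 s2 s2' by (intro exI[of _ "s2(j := val ?E s2)"]) auto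
  qed
qed

lemma polytime_left_tree: "polytime e (\<lambda>a. left (e a))"
proof (rule polytimeI[of _ "\<lambda>i j k. Assign j (Hd_Expr (Var i))" "[:0, 2:]"])
  fix i j k :: nat and a and s :: store
  assume "i < k" "j < k" "s i = e a"
  moreover have "tree_size (left (e a)) \<le> tree_size (e a)" by (cases "e a") auto
  ultimately show "\<exists>s'. runs (Assign j (Hd_Expr (Var i))) s (poly [:0, 2:] (tree_size (e a))) s' \<and>
      s' j = left (e a) \<and> (\<forall>r<k. r \<noteq> j \<longrightarrow> s' r = s r)"
    using runs_assign[of j "Hd_Expr (Var i)" s]
    by (intro exI[of _ "s(j := left (e a))"]) (auto elim!: runs_mono)
qed

lemma polytime_right_tree: "polytime e (\<lambda>a. right (e a))"
proof (rule polytimeI[of _ "\<lambda>i j k. Assign j (Tl_Expr (Var i))" "[:0, 2:]"])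
  fix i j k :: nat and a and s :: store
  assume "i < k" "j < k" "s i = e a"
  moreover have "tree_size (right (e a)) \<le> tree_size (e a)" by (cases "e a") auto
  ultimately show "\<exists>s'. runs (Assign j (Tl_Expr (Var i))) s (poly [:0, 2:] (tree_size (e a))) s' \<and>
      s' j = right (e a) \<and> (\<forall>r<k. r \<noteq> j \<longrightarrow> s' r = s r)"
    using runs_assign[of j "Tl_Expr (Var i)" s]
    by (intro exI[of _ "s(j := right (e a))"]) (auto elim!: runs_mono)
qed

lemma polytime_left: "polytime e f \<Longrightarrow> polytime e (\<lambda>a. left (f a))"
  using polytime_comp[OF polytime_left_tree[of "\<lambda>x. x"]] by blast

lemma polytime_right: "polytime e f \<Longrightarrow> polytime e (\<lambda>a. right (f a))"
  using polytime_comp[OF polytime_right_tree[of "\<lambda>x. x"]] by blast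

lemma polytime_if_Tip:
  assumes "polytime e b" "polytime e f" "polytime e g"
  shows "polytime e (\<lambda>a. if b a = Tip then f a else g a)"
proof -
  obtain o' B where B: "\<And>i j k a s. i < k \<Longrightarrow> j < k \<Longrightarrow> s i = e a \<Longrightarrow>
     \<exists>s'. runs (B i j k) s (poly o' (tree_size (e a))) s' \<and> s' j = b a \<and>
           (\<forall>r<k. r \<noteq> j \<longrightarrow> s' r = s r)"
    using polytimeE[OF assms(1)] by metis
  obtain p c where c: "\<And>i j k a s. i < k \<Longrightarrow> j < k \<Longrightarrow> s i = e a \<Longrightarrow>
     \<exists>s'. runs (c i j k) s (poly p (tree_size (e a))) s' \<and> s' j = f a \<and>
           (\<forall>r<k. r \<noteq> j \<longrightarrow> s' r = s r)"
    using polytimeE[OF assms(2)] by metis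
  obtain q d where d: "\<And>i j k a s. i < k \<Longrightarrow> j < k \<Longrightarrow> s i = e a \<Longrightarrow>
     \<exists>s'. runs (d i j k) s (poly q (tree_size (e a))) s' \<and> s' j = g a \<and>
           (\<forall>r<k. r \<noteq> j \<longrightarrow> s' r = s r)"
    using polytimeE[OF assms(3)] by metis
  obtain u where u: "\<And>a. tree_size (b a) \<le> poly u (tree_size (e a))"
    using polytime_size[OF assms(1)] by metis
  define C where "C i j k = Seq (B i k (k+1)) (If (Var k) (d i j k) (c i j k))" for i j k
  define P where "P = o' + u + p + q"
  show ?thesis
  proof (rule polytimeI[of _ C P])
    fix i j k :: nat and a and s :: store
    assume A: "i < k" "j < k" "s i = e a"
    obtain s1 where s1: "runs (B i k (k+1)) s (poly o' (tree_size (e a))) s1" "s1 k = b a"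
      "\<And>r. r < k \<Longrightarrow> s1 r = s r"
      using B[of i "k+1" k s a] A by auto
    let ?n = "tree_size (e a)"
    have "\<exists>s'. runs (if val (Var k) s1 = Tip then c i j k else d i j k) s1 (poly p ?n + poly q ?n) s'
      \<and> s' j = (if b a = Tip then f a else g a) \<and> (\<forall>r<k. r \<noteq> j \<longrightarrow> s' r = s r)"
    proof (cases "b a = Tip")
      case True
      with c[of i k j s1 a] A s1 obtain s' where "runs (c i j k) s1 (poly p ?n) s'"
        "s' j = f a" "\<forall>r<k. r \<noteq> j \<longrightarrow> s' r = s r" by auto
      with True s1(2) show ?thesis by (intro exI[of _ s']) (auto elim: runs_mono)
    next
      case False
      with d[of i k j s1 a] A s1 obtain s' where "runs (d i j k) s1 (poly q ?n) s'"
        "s' j = g a" "\<forall>r<k. r \<noteq> j \<longrightarrow> s' r = s r" by auto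
      with False s1(2) show ?thesis by (intro exI[of _ s']) (auto elim: runs_mono)
    qed
    then obtain s' where s': "runs (if val (Var k) s1 = Tip then c i j k else d i j k) s1
        (poly p ?n + poly q ?n) s'"
      "s' j = (if b a = Tip then f a else g a)" "\<forall>r<k. r \<noteq> j \<longrightarrow> s' r = s r" by blast
    have "runs (C i j k) s (poly P ?n) s'"
      unfolding C_def using u[of a] s1(2)
      by (intro runs_mono[OF runs_seq[OF s1(1) runs_if[OF s'(1)]]]) (simp add: P_def)
    with s' show "\<exists>s'. runs (C i j k) s (poly P ?n) s' \<and> s' j = (if b a = Tip then f a else g a) \<and>
           (\<forall>r<k. r \<noteq> j \<longrightarrow> s' r = s r)" by blast
  qed
qed

lemma length_le_tree_size: "length xs \<le> tree_size (enc_list ex xs)"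
  by (induction xs) auto

text \<open>
  The size bound is only required for the reachable accumulators, as it may depend on an
  invariant of the loop.
\<close>

lemma polytime_foldl:
  fixes e :: "'a \<Rightarrow> tree" and es :: "'s \<Rightarrow> tree" and ex :: "'x \<Rightarrow> tree"
  assumes list: "polytime e (\<lambda>a. enc_list ex (l a))"
    and init: "polytime e (\<lambda>a. es (z a))"
    and body: "polytime (\<lambda>p. Node (e (fst p)) (Node (es (fst (snd p))) (ex (snd (snd p)))))
                  (\<lambda>p. es (B (fst p) (fst (snd p)) (snd (snd p))))"
    and bound: "\<And>a n. tree_size (es (foldl (B a) (z a) (take n (l a)))) \<le> poly q (tree_size (e a))"
  shows "polytime e (\<lambda>a. es (foldl (B a) (z a) (l a)))"
proof -
  obtain pl cl where cl: "\<And>i j k a s. i < k \<Longrightarrow> j < k \<Longrightarrow> s i = e a \<Longrightarrow>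
     \<exists>s'. runs (cl i j k) s (poly pl (tree_size (e a))) s' \<and> s' j = enc_list ex (l a) \<and>
           (\<forall>r<k. r \<noteq> j \<longrightarrow> s' r = s r)"
    using polytimeE[OF list] by metis
  obtain pz cz where cz: "\<And>i j k a s. i < k \<Longrightarrow> j < k \<Longrightarrow> s i = e a \<Longrightarrow>
     \<exists>s'. runs (cz i j k) s (poly pz (tree_size (e a))) s' \<and> s' j = es (z a) \<and>
           (\<forall>r<k. r \<noteq> j \<longrightarrow> s' r = s r)"
    using polytimeE[OF init] by metis
  obtain pb cb where "\<And>i j k p s. i < k \<Longrightarrow> j < k \<Longrightarrow>
     s i = Node (e (fst p)) (Node (es (fst (snd p))) (ex (snd (snd p)))) \<Longrightarrow>
     \<exists>s'. runs (cb i j k) s (poly pb (tree_size (Node (e (fst p)) (Node (es (fst (snd p))) (ex (snd (snd p))))))) s' \<and>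
       s' j = es (B (fst p) (fst (snd p)) (snd (snd p))) \<and>
           (\<forall>r<k. r \<noteq> j \<longrightarrow> s' r = s r)"
    using polytimeE[OF body] by metis
  from this[where p = "(_, _, _)", unfolded fst_conv snd_conv]
  have cb: "\<And>i j k a w x s. i < k \<Longrightarrow> j < k \<Longrightarrow>
     s i = Node (e a) (Node (es w) (ex x)) \<Longrightarrow>
     \<exists>s'. runs (cb i j k) s (poly pb (tree_size (Node (e a) (Node (es w) (ex x))))) s' \<and>
       s' j = es (B a w x) \<and> (\<forall>r<k. r \<noteq> j \<longrightarrow> s' r = s r)" .
  obtain u where u: "\<And>a. tree_size (enc_list ex (l a)) \<le> poly u (tree_size (e a))"
    using polytime_size[OF list] by metis
  \<comment> \<open>Register \<open>k\<close> holds the remaining list, \<open>k+1\<close> the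
    accumulator, and \<open>k+2\<close> the triple passed to the body: context, accumulator, head of
    the list.\<close>
  define iter where "iter i k = Seq (Assign (k+2) (Cons_Expr (Var i) (Cons_Expr (Var (k+1)) (Hd_Expr (Var k)))))
      (Seq (cb (k+2) (k+1) (k+3)) (Assign k (Tl_Expr (Var k))))" for i k
  define C where "C i j k = Seq (cl i k (k+1)) (Seq (cz i (k+1) (k+2))
      (Seq (While (Var k) (iter i k)) (Assign j (Var (k+1)))))" for i j k
  \<comment> \<open>\<open>R\<close> bounds one iteration: test, packing, body and tail. The packed
    argument has size at most 2 plus the sizes of context, accumulator and list, hence the composed
    polynomial. The term \<open>u * R\<close> in \<open>P\<close> pays for at most \<open>u\<close>
    iterations.\<close>
  define R where "R = [:2, 3:] + (q + q + q) + (u + u + u + u + u + u) + pcompose pb ([:2, 1:] + q + u)"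
  define P where "P = pl + pz + u * R + u + q"
  show ?thesis
  proof (rule polytimeI[of _ C P])
    fix i j k :: nat and a and s :: store
    assume A: "i < k" "j < k" "s i = e a"
    let ?n = "tree_size (e a)"
    obtain s1 where s1: "runs (cl i k (k+1)) s (poly pl ?n) s1" "s1 k = enc_list ex (l a)"
      "\<And>r. r < k \<Longrightarrow> s1 r = s r"
      using cl[of i "k+1" k s a] A by auto
    obtain s2 where s2: "runs (cz i (k+1) (k+2)) s1 (poly pz ?n) s2" "s2 (k+1) = es (z a)"
      "\<And>r. r < k+1 \<Longrightarrow> s2 r = s1 r"
      using cz[of i "k+2" "k+1" s1 a] A s1 by auto
    \<comment> \<open>\<open>xs\<close> is the processed prefix and \<open>ys\<close> the rest, so
      every accumulator is a fold over a prefix of \<open>l a\<close>, to which \<open>bound\<close>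
      applies. The summand \<open>poly u ?n\<close> pays for the last test.\<close>
    have loop: "xs @ ys = l a \<Longrightarrow> s' i = e a \<Longrightarrow> s' k = enc_list ex ys \<Longrightarrow>
        s' (k+1) = es (foldl (B a) (z a) xs) \<Longrightarrow>
        \<exists>s''. runs (While (Var k) (iter i k)) s' (length ys * poly R ?n + poly u ?n) s'' \<and>
          s'' (k+1) = es (foldl (B a) (z a) (l a)) \<and> (\<forall>r<k. s'' r = s' r)" for xs ys s'
    proof (induction ys arbitrary: xs s')
      case Nil
      have "1 \<le> poly u ?n" using u[of a] by (cases "enc_list ex (l a)") auto
      then have "runs (While (Var k) (iter i k)) s' (length ([] :: 'x list) * poly R ?n + poly u ?n) s'"
        using Nil by (intro runs_mono[OF runs_while_false]) auto
      then show ?case using Nil by auto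
    next
      case (Cons y ys)
      let ?w = "foldl (B a) (z a) xs"
      let ?L = "enc_list ex (y # ys)"
      have sy: "tree_size ?L \<le> tree_size (enc_list ex (xs @ y # ys))"
        by (induction xs) auto
      then have sL: "tree_size ?L \<le> poly u ?n" using u[of a] Cons.prems by simp
      have sw: "tree_size (es ?w) \<le> poly q ?n"
        using bound[of a "length xs"] Cons.prems(1)[symmetric] by simp
      let ?E = "Cons_Expr (Var i) (Cons_Expr (Var (k+1)) (Hd_Expr (Var k)))"
      define s3 where "s3 = s'(k+2 := val ?E s')"
      have v3: "val ?E s' = Node (e a) (Node (es ?w) (ex y))"
        using Cons.prems by simp
      have s3: "runs (Assign (k+2) ?E) s' (cost ?E s') s3" unfolding s3_def by (rule runs_assign)
      obtain s4 where s4: "runs (cb (k+2) (k+1) (k+3)) s3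
          (poly pb (tree_size (Node (e a) (Node (es ?w) (ex y))))) s4"
        "s4 (k+1) = es (B a ?w y)" "\<And>r. r < k+3 \<Longrightarrow> r \<noteq> k+1 \<Longrightarrow> s4 r = s3 r"
        using cb[of "k+2" "k+3" "k+1" s3 a ?w y] v3 by (auto simp: s3_def)
      define s5 where "s5 = s4(k := val (Tl_Expr (Var k)) s4)"
      have s5: "runs (Assign k (Tl_Expr (Var k))) s4 (cost (Tl_Expr (Var k)) s4) s5"
        unfolding s5_def by (rule runs_assign)
      have s4k: "s4 k = ?L" using s4(3)[of k] Cons.prems by (simp add: s3_def)
      have i5: "s5 i = e a" using A s4(3)[of i] Cons.prems by (simp add: s5_def s3_def)
      have s5k: "s5 k = enc_list ex ys" using s4k by (simp add: s5_def)
      have s5w: "s5 (k+1) = es (foldl (B a) (z a) (xs @ [y]))" using s4(2) by (simp add: s5_def)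
      obtain s6 where s6: "runs (While (Var k) (iter i k)) s5 (length ys * poly R ?n + poly u ?n) s6"
        "s6 (k+1) = es (foldl (B a) (z a) (l a))" "\<forall>r<k. s6 r = s5 r"
        using Cons.IH[of "xs @ [y]" s5] Cons.prems(1) i5 s5k s5w by auto
      have it: "runs (iter i k) s' (cost ?E s' + (poly pb (tree_size (Node (e a) (Node (es ?w) (ex y))))
          + cost (Tl_Expr (Var k)) s4)) s5"
        unfolding iter_def by (rule runs_seq[OF s3 runs_seq[OF s4(1) s5]])
      have pbb: "poly pb (tree_size (Node (e a) (Node (es ?w) (ex y)))) \<le> poly (pcompose pb ([:2, 1:] + q + u)) ?n"
        unfolding poly_pcompose by (rule poly_nat_mono) (use sw sL in simp)
      have "cost (Var k) s' + (cost ?E s' + (poly pb (tree_size (Node (e a) (Node (es ?w) (ex y))))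
          + cost (Tl_Expr (Var k)) s4)) \<le> poly R ?n"
        using pbb sw sL Cons.prems(2,3,4) s4k by (simp add: R_def)
      moreover have "val (Var k) s' \<noteq> Tip" using Cons.prems by simp
      from runs_while_true[OF this it s6(1)]
      have "runs (While (Var k) (iter i k)) s' (cost (Var k) s' + (cost ?E s' +
          (poly pb (tree_size (Node (e a) (Node (es ?w) (ex y)))) + cost (Tl_Expr (Var k)) s4)) +
          (length ys * poly R ?n + poly u ?n)) s6" .
      ultimately have "runs (While (Var k) (iter i k)) s' (length (y # ys) * poly R ?n + poly u ?n) s6"
        by (elim runs_mono) simp
      moreover have "\<forall>r<k. s6 r = s' r" using s6(3) s4(3) by (simp add: s5_def s3_def)
      ultimately show ?case using s6(2) by blast
    qed
    obtain s3 where s3: "runs (While (Var k) (iter i k)) s2 (length (l a) * poly R ?n + poly u ?n) s3"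
      "s3 (k+1) = es (foldl (B a) (z a) (l a))" "\<forall>r<k. s3 r = s2 r"
      using loop[of "[]" "l a" s2] s1 s2 A by auto
    let ?s = "s3(j := val (Var (k+1)) s3)"
    have "length (l a) \<le> poly u ?n" using length_le_tree_size u le_trans by blast
    then have "length (l a) * poly R ?n \<le> poly u ?n * poly R ?n" by (rule mult_le_mono1)
    moreover have "cost (Var (k+1)) s3 \<le> poly q ?n" using bound[of a "length (l a)"] s3(2) by simp
    ultimately have "poly pl ?n + (poly pz ?n + ((length (l a) * poly R ?n + poly u ?n)
        + cost (Var (k+1)) s3)) \<le> poly P ?n"
      unfolding P_def poly_add poly_mult by linarith
    then have "runs (C i j k) s (poly P ?n) ?s"
      unfolding C_def
      by (rule runs_mono[OF runs_seq[OF s1(1) runs_seq[OF s2(1) runs_seq[OF s3(1) runs_assign]]]])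
    then show "\<exists>s'. runs (C i j k) s (poly P ?n) s' \<and> s' j = es (foldl (B a) (z a) (l a)) \<and>
           (\<forall>r<k. r \<noteq> j \<longrightarrow> s' r = s r)"
      using s1 s2 s3 by (intro exI[of _ ?s]) auto
  qed
qed

lemma polytime_Node_fst: "polytime e (\<lambda>a. Node (f a) (g a)) \<Longrightarrow> polytime e f"
  using polytime_left[of e "\<lambda>a. Node (f a) (g a)"] by simp

lemma polytime_Node_snd: "polytime e (\<lambda>a. Node (f a) (g a)) \<Longrightarrow> polytime e g"
  using polytime_right[of e "\<lambda>a. Node (f a) (g a)"] by simp

text \<open>Inside a map or a fold the body sees its element paired with the context; whatever is
  computable from the context alone stays computable there.\<close>

lemma polytime_weaken: "polytime e f \<Longrightarrow> polytime (\<lambda>p. Node (e (fst p)) (g p)) (\<lambda>p. f (fst p))"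
  by (rule polytime_comp[of e f], assumption) (rule polytime_Node_fst[OF polytime_id])

lemma polytime_snd: "polytime (\<lambda>p. Node (f p) (g (snd p))) (\<lambda>p. g (snd p))"
  by (rule polytime_Node_snd[OF polytime_id])

lemma polytime_foldl_state: "polytime (\<lambda>p. Node (f p) (Node (es (fst (snd p))) (g p))) (\<lambda>p. es (fst (snd p)))"
  by (rule polytime_Node_fst[OF polytime_Node_snd[OF polytime_id]])

lemma polytime_foldl_elem: "polytime (\<lambda>p. Node (f p) (Node (g p) (ex (snd (snd p))))) (\<lambda>p. ex (snd (snd p)))"
  by (rule polytime_Node_snd[OF polytime_Node_snd[OF polytime_id]])

section \<open>List operations and unary arithmetic\<close>

lemma tree_size_enc_list: "tree_size (enc_list ex xs) = Suc (\<Sum>x\<leftarrow>xs. Suc (tree_size (ex x)))"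
  by (induction xs) auto

lemma tree_size_enc_list_append:
  "tree_size (enc_list ex (xs @ ys)) + 1 = tree_size (enc_list ex xs) + tree_size (enc_list ex ys)"
  by (simp add: tree_size_enc_list)

lemma tree_size_enc_list_rev: "tree_size (enc_list ex (rev xs)) = tree_size (enc_list ex xs)"
  by (simp add: tree_size_enc_list rev_map[symmetric])

lemma tree_size_enc_list_take: "tree_size (enc_list ex (take n xs)) \<le> tree_size (enc_list ex xs)"
  using tree_size_enc_list_append[of ex "take n xs" "drop n xs"]
  by (cases "enc_list ex (drop n xs)") auto

lemma tree_size_enc_list_drop: "tree_size (enc_list ex (drop n xs)) \<le> tree_size (enc_list ex xs)"
  using tree_size_enc_list_append[of ex "take n xs" "drop n xs"]
  by (cases "enc_list ex (take n xs)") auto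

lemma tree_size_enc_list_le:
  "(\<And>x. x \<in> set xs \<Longrightarrow> tree_size (ex x) \<le> b) \<Longrightarrow> tree_size (enc_list ex xs) \<le> length xs * (b + 1) + 1"
  by (induction xs) (force simp: algebra_simps)+

lemma tree_size_enc_list_mem: "x \<in> set xs \<Longrightarrow> tree_size (ex x) \<le> tree_size (enc_list ex xs)"
  by (induction xs) auto

lemma tree_size_enc_nat: "tree_size (enc_nat n) = 2 * n + 1"
  by (induction n) auto

text \<open>Consing onto the accumulator reverses the order, so the reversed map is the primitive
  operation; \<open>rev\<close> is the case of the identity, and \<open>map\<close> follows by
  reversing again.\<close>

lemma polytime_rev_map:
  assumes l: "polytime e (\<lambda>a. enc_list ex (l a))"
    and f: "polytime (\<lambda>p. Node (e (fst p)) (ex (snd p))) (\<lambda>p. ey (f (fst p) (snd p)))"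
  shows "polytime e (\<lambda>a. enc_list ey (rev (map (f a) (l a))))"
proof -
  have fold: "foldl (\<lambda>s x. f a x # s) [] xs = rev (map (f a) xs)" for a xs
    by (induction xs rule: rev_induct) auto
  obtain u where u: "\<And>a. tree_size (enc_list ex (l a)) \<le> poly u (tree_size (e a))"
    using polytime_size[OF l] by metis
  obtain w where "\<And>p. tree_size (ey (f (fst p) (snd p))) \<le> poly w (tree_size (Node (e (fst p)) (ex (snd p))))"
    using polytime_size[OF f] by metis
  from this[of "(_, _)"] have w: "tree_size (ey (f a x)) \<le> poly w (tree_size (e a) + tree_size (ex x) + 1)" for a x
    by simp
  have "polytime (\<lambda>p. Node (e (fst p)) (Node (enc_list ey (fst (snd p))) (ex (snd (snd p)))))
    (\<lambda>p. enc_list ey (f (fst p) (snd (snd p)) # fst (snd p)))"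
    unfolding enc_list.simps
  proof (intro polytime_Node polytime_foldl_state)
    show "polytime (\<lambda>p. Node (e (fst p)) (Node (enc_list ey (fst (snd p))) (ex (snd (snd p)))))
      (\<lambda>p. ey (f (fst p) (snd (snd p))))"
      by (rule polytime_comp[OF f, where g = "\<lambda>p. (fst p, snd (snd p))", unfolded fst_conv snd_conv])
        (intro polytime_Node polytime_foldl_elem polytime_weaken polytime_id)
  qed
  then have "polytime e (\<lambda>a. enc_list ey (foldl (\<lambda>s x. f a x # s) [] (l a)))"
  proof (rule polytime_foldl[OF l, where es = "enc_list ey" and B = "\<lambda>a s x. f a x # s", rotated])
    show "polytime e (\<lambda>a. enc_list ey [])" by (simp add: polytime_Tip)
    define q where "q = u * (pcompose w ([:1, 1:] + u) + 1) + 1"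
    show "tree_size (enc_list ey (foldl (\<lambda>s x. f a x # s) [] (take n (l a)))) \<le> poly q (tree_size (e a))" for a n
    proof -
      have "tree_size (enc_list ey (rev (map (f a) (take n (l a)))))
        \<le> length (rev (map (f a) (take n (l a)))) * (poly (pcompose w ([:1, 1:] + u)) (tree_size (e a)) + 1) + 1"
      proof (rule tree_size_enc_list_le)
        fix y assume "y \<in> set (rev (map (f a) (take n (l a))))"
        then obtain x where x: "x \<in> set (l a)" "y = f a x" by (auto dest: in_set_takeD)
        have "tree_size (ex x) \<le> poly u (tree_size (e a))"
          using tree_size_enc_list_mem[OF x(1)] u le_trans by blast
        then have "poly w (tree_size (e a) + tree_size (ex x) + 1) \<le> poly (pcompose w ([:1, 1:] + u)) (tree_size (e a))"
          unfolding poly_pcompose by (intro poly_nat_mono) simp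
        with w[of a x] x(2) show "tree_size (ey y) \<le> poly (pcompose w ([:1, 1:] + u)) (tree_size (e a))"
          by simp
      qed
      moreover have "length (rev (map (f a) (take n (l a)))) \<le> poly u (tree_size (e a))"
        using length_le_tree_size[of "l a" ex] u[of a] by simp
      ultimately show ?thesis
        unfolding fold q_def poly_add poly_mult poly_1 by (meson add_le_mono1 mult_le_mono1 order.trans)
    qed
  qed
  then show ?thesis by (simp add: fold)
qed

lemma polytime_rev:
  assumes "polytime e (\<lambda>a. enc_list ex (l a))"
  shows "polytime e (\<lambda>a. enc_list ex (rev (l a)))"
  using polytime_rev_map[OF assms, of ex "\<lambda>a x. x"] polytime_snd[of "\<lambda>p. e (fst p)" ex] by simp

lemma polytime_map:
  assumes l: "polytime e (\<lambda>a. enc_list ex (l a))"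
    and f: "polytime (\<lambda>p. Node (e (fst p)) (ex (snd p))) (\<lambda>p. ey (f (fst p) (snd p)))"
  shows "polytime e (\<lambda>a. enc_list ey (map (f a) (l a)))"
  using polytime_rev[OF polytime_rev_map[OF l, of ey f, OF f]] by simp

lemma polytime_append:
  assumes f: "polytime e (\<lambda>a. enc_list ex (f a))" and g: "polytime e (\<lambda>a. enc_list ex (g a))"
  shows "polytime e (\<lambda>a. enc_list ex (f a @ g a))"
proof -
  have fold: "foldl (\<lambda>s x. x # s) ys xs = rev xs @ ys" for xs ys :: "'b list"
    by (induction xs rule: rev_induct) auto
  obtain u where u: "\<And>a. tree_size (enc_list ex (f a)) \<le> poly u (tree_size (e a))"
    using polytime_size[OF f] by metis
  obtain v where v: "\<And>a. tree_size (enc_list ex (g a)) \<le> poly v (tree_size (e a))"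
    using polytime_size[OF g] by metis
  have "polytime e (\<lambda>a. enc_list ex (foldl (\<lambda>s x. x # s) (g a) (rev (f a))))"
  proof (rule polytime_foldl[OF polytime_rev[OF f], where es = "enc_list ex" and z = g, OF g])
    show "polytime (\<lambda>p. Node (e (fst p)) (Node (enc_list ex (fst (snd p))) (ex (snd (snd p)))))
      (\<lambda>p. enc_list ex (snd (snd p) # fst (snd p)))"
      unfolding enc_list.simps by (intro polytime_Node polytime_foldl_state polytime_foldl_elem)
    show "tree_size (enc_list ex (foldl (\<lambda>s x. x # s) (g a) (take n (rev (f a))))) \<le> poly (u + v) (tree_size (e a))" for a n
      using tree_size_enc_list_append[of ex "rev (take n (rev (f a)))" "g a"]
        tree_size_enc_list_take[of ex n "rev (f a)"] u[of a] v[of a]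
      by (simp add: fold tree_size_enc_list_rev)
  qed
  then show ?thesis by (simp add: fold)
qed

lemma tree_size_enc_concat: "tree_size (enc_list ex (concat xss)) \<le> tree_size (enc_list (enc_list ex) xss)"
proof (induction xss)
  case (Cons xs xss)
  then show ?case using tree_size_enc_list_append[of ex xs "concat xss"] by simp
qed simp

lemma polytime_concat:
  assumes l: "polytime e (\<lambda>a. enc_list (enc_list ex) (l a))"
  shows "polytime e (\<lambda>a. enc_list ex (concat (l a)))"
proof -
  have fold: "foldl (@) [] xss = concat xss" for xss :: "'b list list"
    by (induction xss rule: rev_induct) auto
  obtain u where u: "\<And>a. tree_size (enc_list (enc_list ex) (l a)) \<le> poly u (tree_size (e a))"
    using polytime_size[OF l] by metis
  have "polytime e (\<lambda>a. enc_list ex (foldl (@) [] (l a)))"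
  proof (rule polytime_foldl[OF l])
    show "polytime e (\<lambda>a. enc_list ex [])" by (simp add: polytime_Tip)
    show "polytime (\<lambda>p. Node (e (fst p)) (Node (enc_list ex (fst (snd p))) (enc_list ex (snd (snd p)))))
      (\<lambda>p. enc_list ex (fst (snd p) @ snd (snd p)))"
      by (intro polytime_append polytime_foldl_state polytime_foldl_elem)
    show "tree_size (enc_list ex (foldl (@) [] (take n (l a)))) \<le> poly u (tree_size (e a))" for a n
      using tree_size_enc_concat[of ex "take n (l a)"] tree_size_enc_list_take[of "enc_list ex" n "l a"] u[of a]
      by (simp add: fold)
  qed
  then show ?thesis by (simp add: fold)
qed

lemma polytime_Cons:
  "polytime e (\<lambda>a. ex (f a)) \<Longrightarrow> polytime e (\<lambda>a. enc_list ex (g a)) \<Longrightarrow> polytime e (\<lambda>a. enc_list ex (f a # g a))"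
  by (simp add: polytime_Node)

lemma polytime_Nil: "polytime e (\<lambda>a. enc_list ex [])"
  by (simp add: polytime_Tip)

text \<open>A unary number is an encoded list of trivial elements, so arithmetic is inherited from
  lists: addition is \<open>@\<close>, subtraction \<open>drop\<close>, multiplication a
  \<open>concat\<close>, and \<open>n\<close>-fold iteration a fold over \<open>n\<close>
  units.\<close>

lemma enc_nat_replicate: "enc_nat n = enc_list (\<lambda>_. Tip) (replicate n ())"
  by (induction n) auto

lemma polytime_replicate_unit: "polytime e (\<lambda>a. enc_nat (f a)) \<Longrightarrow> polytime e (\<lambda>a. enc_list (\<lambda>_. Tip) (replicate (f a) ()))"
  by (simp add: enc_nat_replicate)

lemma polytime_add:
  assumes "polytime e (\<lambda>a. enc_nat (f a))" "polytime e (\<lambda>a. enc_nat (g a))"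
  shows "polytime e (\<lambda>a. enc_nat (f a + g a))"
  using polytime_append[OF assms[unfolded enc_nat_replicate]] by (simp add: enc_nat_replicate replicate_add)

lemma polytime_length:
  assumes "polytime e (\<lambda>a. enc_list ex (l a))"
  shows "polytime e (\<lambda>a. enc_nat (length (l a)))"
  using polytime_map[OF assms, of "\<lambda>_. Tip" "\<lambda>_ _. ()"] by (simp add: enc_nat_replicate map_replicate_const polytime_Tip)

lemma polytime_replicate:
  assumes f: "polytime e (\<lambda>a. enc_nat (f a))" and g: "polytime e (\<lambda>a. ex (g a))"
  shows "polytime e (\<lambda>a. enc_list ex (replicate (f a) (g a)))"
  using polytime_map[OF polytime_replicate_unit[OF f], of ex "\<lambda>a _. g a"] polytime_weaken[OF g, of "\<lambda>_. Tip"] by simp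

lemma polytime_mult:
  assumes f: "polytime e (\<lambda>a. enc_nat (f a))" and g: "polytime e (\<lambda>a. enc_nat (g a))"
  shows "polytime e (\<lambda>a. enc_nat (f a * g a))"
proof -
  have "polytime e (\<lambda>a. enc_nat (length (concat (replicate (f a) (replicate (g a) ())))))"
    by (intro polytime_length[of _ "\<lambda>_. Tip"] polytime_concat polytime_replicate f g polytime_replicate_unit)
  then show ?thesis by (simp add: length_concat sum_list_replicate map_replicate)
qed

text \<open>The next number is always the length of the list accumulated so far, so the fold needs
  no separate counter.\<close>

lemma polytime_upt:
  assumes f: "polytime e (\<lambda>a. enc_nat (f a))"
  shows "polytime e (\<lambda>a. enc_list enc_nat [0..<f a])"
proof -
  have fold: "foldl (\<lambda>s _. s @ [length s]) [] xs = [0..<length xs]" for xs :: "unit list"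
    by (induction xs rule: rev_induct) auto
  obtain u where u: "\<And>a. tree_size (enc_nat (f a)) \<le> poly u (tree_size (e a))"
    using polytime_size[OF f] by metis
  have "polytime e (\<lambda>a. enc_list enc_nat (foldl (\<lambda>s _. s @ [length s]) [] (replicate (f a) ())))"
  proof (rule polytime_foldl[OF polytime_replicate_unit[OF f], where es = "enc_list enc_nat" and z = "\<lambda>_. []", OF polytime_Nil])
    show "polytime (\<lambda>p. Node (e (fst p)) (Node (enc_list enc_nat (fst (snd p))) Tip))
      (\<lambda>p. enc_list enc_nat (fst (snd p) @ [length (fst (snd p))]))"
      by (intro polytime_append polytime_foldl_state polytime_Cons polytime_Nil polytime_length[of _ enc_nat])
    show "tree_size (enc_list enc_nat (foldl (\<lambda>s _. s @ [length s]) [] (take n (replicate (f a) ()))))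
      \<le> poly (u * (u + 1) + 1) (tree_size (e a))" for a n
    proof -
      let ?k = "min n (f a)"
      have "tree_size (enc_list enc_nat [0..<?k]) \<le> length [0..<?k] * (poly u (tree_size (e a)) + 1) + 1"
        using u[of a] by (intro tree_size_enc_list_le) (auto simp: tree_size_enc_nat)
      moreover have "length [0..<?k] \<le> poly u (tree_size (e a))"
        using u[of a] by (simp add: tree_size_enc_nat)
      ultimately have "tree_size (enc_list enc_nat [0..<?k]) \<le> poly (u * (u + 1) + 1) (tree_size (e a))"
        unfolding poly_add poly_mult poly_1 by (meson add_le_mono1 mult_le_mono1 order.trans)
      then show ?thesis by (simp add: fold)
    qed
  qed
  then show ?thesis by (simp add: fold)
qed

lemma polytime_drop:
  assumes l: "polytime e (\<lambda>a. enc_list ex (l a))" and f: "polytime e (\<lambda>a. enc_nat (f a))"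
  shows "polytime e (\<lambda>a. enc_list ex (drop (f a) (l a)))"
proof -
  have fold: "foldl (\<lambda>s _. tl s) xs (replicate n ()) = drop n xs" for n and xs :: "'b list"
    by (induction n arbitrary: xs) (simp_all add: drop_Suc)
  have right: "right (enc_list ex xs) = enc_list ex (tl xs)" for xs by (cases xs) auto
  obtain u where u: "\<And>a. tree_size (enc_list ex (l a)) \<le> poly u (tree_size (e a))"
    using polytime_size[OF l] by metis
  have "polytime e (\<lambda>a. enc_list ex (foldl (\<lambda>s _. tl s) (l a) (replicate (f a) ())))"
  proof (rule polytime_foldl[OF polytime_replicate_unit[OF f], where es = "enc_list ex" and z = l, OF l])
    show "polytime (\<lambda>p. Node (e (fst p)) (Node (enc_list ex (fst (snd p))) Tip))
      (\<lambda>p. enc_list ex (tl (fst (snd p))))"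
      unfolding right[symmetric] by (intro polytime_right polytime_foldl_state)
    show "tree_size (enc_list ex (foldl (\<lambda>s _. tl s) (l a) (take n (replicate (f a) ()))))
      \<le> poly u (tree_size (e a))" for a n
      using tree_size_enc_list_drop u by (fastforce simp: fold intro: order.trans)
  qed
  then show ?thesis by (simp add: fold)
qed

lemma polytime_diff:
  assumes f: "polytime e (\<lambda>a. enc_nat (f a))" and g: "polytime e (\<lambda>a. enc_nat (g a))"
  shows "polytime e (\<lambda>a. enc_nat (f a - g a))"
  using polytime_drop[OF f[unfolded enc_nat_replicate] g] by (simp add: enc_nat_replicate)

section \<open>Decidable predicates and list lookup\<close>

definition polytime_pred :: "('a \<Rightarrow> tree) \<Rightarrow> ('a \<Rightarrow> bool) \<Rightarrow> bool" where
  "polytime_pred e P \<longleftrightarrow> polytime e (\<lambda>a. if P a then Tip else Node Tip Tip)"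

lemma polytime_predI: "polytime e f \<Longrightarrow> (\<And>a. f a = Tip \<longleftrightarrow> P a) \<Longrightarrow> polytime_pred e P"
  using polytime_if_Tip[of e f "\<lambda>_. Tip" "\<lambda>_. Node Tip Tip"] by (simp add: polytime_pred_def polytime_Tip polytime_Node)

lemma polytime_if:
  assumes "polytime_pred e P" "polytime e (\<lambda>a. ex (f a))" "polytime e (\<lambda>a. ex (g a))"
  shows "polytime e (\<lambda>a. ex (if P a then f a else g a))"
proof -
  have eq: "(\<lambda>a. ex (if P a then f a else g a)) =
    (\<lambda>a. if (if P a then Tip else Node Tip Tip) = Tip then ex (f a) else ex (g a))" by auto
  show ?thesis unfolding eq using assms by (intro polytime_if_Tip) (simp_all add: polytime_pred_def)
qed

lemma polytime_pred_not: "polytime_pred e P \<Longrightarrow> polytime_pred e (\<lambda>a. \<not> P a)"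
  unfolding polytime_pred_def[of e P] by (drule polytime_if_Tip[OF _ polytime_Node[OF polytime_Tip polytime_Tip] polytime_Tip]) (erule polytime_predI, auto)

lemma polytime_pred_conj:
  assumes "polytime_pred e P" "polytime_pred e Q" shows "polytime_pred e (\<lambda>a. P a \<and> Q a)"
  by (rule polytime_predI[OF polytime_if[OF assms(1), of "\<lambda>x. x" "\<lambda>a. if Q a then Tip else Node Tip Tip" "\<lambda>_. Node Tip Tip"]])
    (use assms(2) in \<open>auto simp: polytime_pred_def polytime_Tip intro!: polytime_Node\<close>)

lemma enc_nat_Tip: "enc_nat n = Tip \<longleftrightarrow> n = 0"
  by (cases n) auto

lemma enc_list_Tip: "enc_list ex xs = Tip \<longleftrightarrow> xs = []"
  by (cases xs) auto

text \<open>Equality means that both truncated differences vanish, that is, that their sum is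
  0.\<close>

lemma polytime_eq_nat:
  assumes "polytime e (\<lambda>a. enc_nat (f a))" "polytime e (\<lambda>a. enc_nat (g a))"
  shows "polytime_pred e (\<lambda>a. f a = g a)"
  by (rule polytime_predI[OF polytime_add[OF polytime_diff[OF assms] polytime_diff[OF assms(2,1)]]]) (auto simp: enc_nat_Tip)

text \<open>Keep the occurrences of \<open>f a\<close> and test the resulting list for
  emptiness.\<close>

lemma polytime_mem:
  assumes f: "polytime e (\<lambda>a. enc_nat (f a))" and l: "polytime e (\<lambda>a. enc_list enc_nat (l a))"
  shows "polytime_pred e (\<lambda>a. f a \<in> set (l a))"
proof -
  have "polytime e (\<lambda>a. enc_list enc_nat (concat (map (\<lambda>x. if x = f a then [x] else []) (l a))))"
    by (intro polytime_concat polytime_map[OF l] polytime_if[where ex = "enc_list enc_nat"] polytime_eq_nat polytime_Cons polytime_Nil polytime_snd polytime_weaken[OF f])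
  then have "polytime_pred e (\<lambda>a. \<not> f a \<in> set (l a))"
    by (rule polytime_predI) (auto simp: enc_list_Tip)
  from polytime_pred_not[OF this] show ?thesis by simp
qed

text \<open>\<open>xs ! i\<close> is unspecified beyond the end of the list, while a polytime
  function must yield a definite tree on every argument; hence lookups carry an explicit
  default.\<close>

lemma polytime_nth_default:
  assumes d: "polytime e (\<lambda>a. ex (d a))" and l: "polytime e (\<lambda>a. enc_list ex (l a))" and f: "polytime e (\<lambda>a. enc_nat (f a))"
  shows "polytime e (\<lambda>a. ex (nth_default (d a) (l a) (f a)))"
proof -
  have eq: "ex (nth_default (d a) (l a) (f a)) = (if enc_list ex (drop (f a) (l a)) = Tip then ex (d a)
      else left (enc_list ex (drop (f a) (l a))))" for a
    by (simp add: nth_default_def enc_list_Tip Cons_nth_drop_Suc[symmetric])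
  show ?thesis unfolding eq by (intro polytime_if_Tip polytime_drop d l f polytime_left)
qed

section \<open>Circuits under valuations of their leaves\<close>

text \<open>Leaf values are attached to positions instead of being computed from labels. Relabeling
  leaves then only changes the valuation, so \<open>G\<close>, its relabelings and its realizations
  can be compared on the same gates.\<close>

function ev :: "circuit \<Rightarrow> (nat \<Rightarrow> bool) \<Rightarrow> nat \<Rightarrow> bool" where
  "ev G f w =
     (case G ! w of
        Leaf b \<Rightarrow> f w
      | And u v \<Rightarrow> (if u < w \<and> v < w then ev G f u \<and> ev G f v else False)
      | Or u v \<Rightarrow> (if u < w \<and> v < w then ev G f u \<or> ev G f v else False))"
  by pat_completeness auto
termination by (relation "measure (\<lambda>(G, f, w). w)") auto

declare ev.simps [simp del]

definition leaf_sem :: "circuit \<Rightarrow> assignment \<Rightarrow> nat \<Rightarrow> bool" where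
  "leaf_sem G \<tau> v = (case G ! v of Leaf b \<Rightarrow> label_sem b \<tau> | _ \<Rightarrow> False)"

lemma sem_formula_at: "sem (formula_at G w) \<tau> = ev G (leaf_sem G \<tau>) w"
proof (induction w rule: less_induct)
  case (less w)
  then show ?case
    by (cases "G ! w")
      (simp_all add: leaf_sem_def[of G \<tau> w] ev.simps[of _ _ w] formula_at.simps[of _ w])
qed

lemma sem_formula_of: "sem (formula_of G) \<tau> = ev G (leaf_sem G \<tau>) (root G)"
  by (simp add: formula_of_def sem_formula_at)

definition same_gate :: "gate \<Rightarrow> gate \<Rightarrow> bool" where
  "same_gate g h \<longleftrightarrow> g = h \<or> (\<exists>b c. g = Leaf b \<and> h = Leaf c)"

lemma ev_cong:
  assumes "\<And>v. v \<le> w \<Longrightarrow> same_gate (G ! v) (H ! v)"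
    and "\<And>v b. v \<le> w \<Longrightarrow> G ! v = Leaf b \<Longrightarrow> f v = g v"
  shows "ev G f w = ev H g w"
  using assms
proof (induction w rule: less_induct)
  case (less w)
  have IH: "ev G f u = ev H g u" if "u < w" for u
    using that less.prems by (intro less.IH) auto
  show ?case
  proof (cases "G ! w")
    case (Leaf b)
    have "same_gate (G ! w) (H ! w)" by (rule less.prems(1)) simp
    then obtain c where "H ! w = Leaf c" using Leaf by (cases "H ! w") (auto simp: same_gate_def)
    then show ?thesis using Leaf less.prems(2)[of w] by (simp add: ev.simps)
  next
    case (And u v)
    then have "H ! w = And u v" using less.prems(1)[of w] by (auto simp: same_gate_def)
    then show ?thesis using And IH by (simp add: ev.simps[of _ _ w])
  next
    case (Or u v)
    then have "H ! w = Or u v" using less.prems(1)[of w] by (auto simp: same_gate_def)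
    then show ?thesis using Or IH by (simp add: ev.simps[of _ _ w])
  qed
qed

text \<open>Gates are only \<and> and \<or>; negation sits in the labels, which \<open>ev\<close>
  does not look at.\<close>

lemma ev_mono:
  assumes "ev G f w" and "\<And>v b. v \<le> w \<Longrightarrow> G ! v = Leaf b \<Longrightarrow> f v \<Longrightarrow> g v"
  shows "ev G g w"
  using assms
proof (induction w rule: less_induct)
  case (less w)
  have IH: "ev G g u" if "u < w" "ev G f u" for u
    using that less.prems(2) by (intro less.IH) auto
  show ?case using less.prems(1) less.prems(2)[of w]
    by (auto simp: ev.simps[of _ _ w] IH split: gate.splits if_splits)
qed

lemma root_less: "G \<noteq> [] \<Longrightarrow> root G < length G"
  by (simp add: root_def)

section \<open>Relabeled leaves, realizations and one descent step\<close>

lemma length_relabel [simp]: "length (relabel L b G) = length G"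
  by (simp add: relabel_def)

lemma root_relabel [simp]: "root (relabel L b G) = root G"
  by (simp add: root_def)

lemma nth_relabel: "v < length G \<Longrightarrow> relabel L b G ! v = (if v \<in> L then Leaf b else G ! v)"
  by (simp add: relabel_def)

lemma relabel_relabel: "relabel L b (relabel M b G) = relabel (L \<union> M) b G"
  by (rule nth_equalityI) (auto simp: nth_relabel)

lemma relabel_empty: "relabel {} b G = G"
  by (rule nth_equalityI) (auto simp: nth_relabel)

lemma relabel_true_Union: "relabel_true S G = relabel (\<Union>(set S)) (Const True) G"
proof (induction S rule: rev_induct)
  case Nil
  then show ?case by (simp add: relabel_true_def relabel_empty)
next
  case (snoc L S)
  then show ?case by (simp add: relabel_true_def relabel_relabel)
qed

lemma length_relabel_true [simp]: "length (relabel_true S G) = length G"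
  by (simp add: relabel_true_Union)

definition leaves :: "circuit \<Rightarrow> nat set" where
  "leaves G = {v. v < length G \<and> (\<exists>b. G ! v = Leaf b)}"

lemma lit_leaves_subset: "lit_leaves l G \<subseteq> leaves G"
  by (auto simp: lit_leaves_def leaves_def)

lemma sem_relabel:
  assumes "L \<subseteq> leaves G" "w < length G"
  shows "sem (formula_at (relabel L b G) w) \<tau> =
    ev G (\<lambda>v. if v \<in> L then label_sem b \<tau> else leaf_sem G \<tau> v) w"
  unfolding sem_formula_at
proof (rule ev_cong)
  fix v assume v: "v \<le> w"
  then show "same_gate (relabel L b G ! v) (G ! v)"
    using assms by (auto simp: nth_relabel same_gate_def leaves_def)
  show "leaf_sem (relabel L b G) \<tau> v = (if v \<in> L then label_sem b \<tau> else leaf_sem G \<tau> v)"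
    using v assms by (simp add: leaf_sem_def nth_relabel)
qed

text \<open>The circuit tested by \<and>-realizability of \<open>L\<close>: the
  \<open>l\<close>-leaves outside \<open>L\<close> become false first, so that \<open>W\<close>
  reaches only those in \<open>L\<close>, whereas \<open>W'\<close> replaces every leaf labeled
  \<open>negate l\<close>.\<close>

definition realization :: "circuit \<Rightarrow> nat set \<Rightarrow> literal \<Rightarrow> circuit" where
  "realization G L l = relabel_lits [l \<mapsto> Lit (Pos W), negate l \<mapsto> Lit (Pos W')]
     (relabel (lit_leaves l G - L) (Const False) G)"

definition realization_leaf :: "circuit \<Rightarrow> nat set \<Rightarrow> literal \<Rightarrow> assignment \<Rightarrow> nat \<Rightarrow> bool" where
  "realization_leaf G L l \<tau> v =
     (if G ! v = Leaf (Lit l) then v \<in> L \<and> \<tau> W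
      else if G ! v = Leaf (Lit (negate l)) then \<tau> W' else leaf_sem G \<tau> v)"

lemma negate_neq [simp]: "negate l \<noteq> l" "l \<noteq> negate l"
  by (cases l; simp)+

lemma relabel_gate_pair:
  "relabel_gate [l \<mapsto> a, negate l \<mapsto> b] g =
    (if g = Leaf (Lit l) then Leaf a else if g = Leaf (Lit (negate l)) then Leaf b else g)"
proof (cases g)
  case (Leaf c)
  then show ?thesis by (cases c) auto
qed auto

lemma sem_realization:
  assumes "G \<noteq> []"
  shows "sem (formula_of (realization G L l)) \<tau> = ev G (realization_leaf G L l \<tau>) (root G)"
proof -
  have nth: "realization G L l ! v =
      (if G ! v = Leaf (Lit l) then (if v \<in> L then Leaf (Lit (Pos W)) else Leaf (Const False))
       else if G ! v = Leaf (Lit (negate l)) then Leaf (Lit (Pos W')) else G ! v)"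
    if "v < length G" for v
    using that by (simp add: realization_def relabel_lits_def nth_relabel lit_leaves_def relabel_gate_pair)
  have len: "root (realization G L l) = root G"
    by (simp add: realization_def relabel_lits_def root_def)
  show ?thesis unfolding sem_formula_of len
  proof (rule ev_cong)
    fix v assume "v \<le> root G"
    then have v: "v < length G" using root_less[OF assms] by simp
    show "same_gate (realization G L l ! v) (G ! v)"
      using nth[OF v] by (auto simp: same_gate_def)
    show "leaf_sem (realization G L l) \<tau> v = realization_leaf G L l \<tau> v"
      unfolding leaf_sem_def realization_leaf_def nth[OF v] by auto
  qed
qed

text \<open>A nonempty set of leaves determines its literal, which removes the quantifier over
  \<open>l\<close>.\<close>

lemma and_realizable_set_iff:
  assumes "labeled_by G L l"
  shows "and_realizable_set n m G L \<longleftrightarrow>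
    (\<exists>\<sigma>. dom \<sigma> = (inputs n \<union> outputs m) - {lit_var l} \<and>
       (\<forall>\<tau>. sem_under (formula_of (realization G L l)) \<sigma> \<tau> \<longleftrightarrow> \<tau> W \<and> \<tau> W'))"
proof -
  have uniq: "l' = l" if "labeled_by G L l'" for l'
    using assms that by (force simp: labeled_by_def lit_leaves_def)
  have "and_realizable_set n m G L \<longleftrightarrow>
      and_realizable n m (relabel (lit_leaves l G - L) (Const False) G) l"
    unfolding and_realizable_set_def using assms uniq by blast
  then show ?thesis
    unfolding and_realizable_def realization_def by (auto simp: fun_eq_iff)
qed

definition set_lit :: "literal \<Rightarrow> assignment \<Rightarrow> assignment" where
  "set_lit l \<tau> = (case l of Pos x \<Rightarrow> \<tau>(x := True) | Neg x \<Rightarrow> \<tau>(x := False))"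

definition lit_sem :: "literal \<Rightarrow> assignment \<Rightarrow> bool" where
  "lit_sem l \<tau> = label_sem (Lit l) \<tau>"

lemma lit_sem_negate: "lit_sem (negate l) \<tau> = (\<not> lit_sem l \<tau>)"
  by (cases l) (auto simp: lit_sem_def)

lemma lit_sem_set_lit: "lit_sem l' (set_lit l \<tau>) =
  (if l' = l then True else if l' = negate l then False else lit_sem l' \<tau>)"
  by (cases l; cases l') (auto simp: lit_sem_def set_lit_def)

text \<open>If \<open>l\<close> is true under \<open>\<tau>\<close>, the leaves in \<open>L\<close>
  are true anyway. Otherwise fix all variables except that of \<open>l\<close> as in
  \<open>\<tau>\<close>. At \<open>w = w' = True\<close> the realization dominates the satisfied
  circuit; as it is not \<open>w \<and> w'\<close>, it is true at some other pair. With
  \<open>w\<close> false it is dominated by \<open>G\<close> under \<open>\<tau>\<close>, with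
  \<open>w\<close> true and \<open>w'\<close> false by \<open>G\<close> under
  \<open>set_lit l \<tau>\<close>.\<close>

lemma unrealizable_step:
  assumes G: "circuit_over (inputs n \<union> outputs m) G"
    and L: "labeled_by G L l"
    and unreal: "and_unrealizable_set n m G L"
    and sat: "sem (formula_of (relabel L (Const True) G)) \<tau>"
  shows "sem (formula_of G) \<tau> \<or> sem (formula_of G) (set_lit l \<tau>)"
proof (cases "lit_sem l \<tau>")
  case True
  have ne: "G \<noteq> []" using G by (simp add: circuit_over_def)
  have LL: "L \<subseteq> leaves G" using L lit_leaves_subset by (auto simp: labeled_by_def)
  have "sem (formula_of G) \<tau>"
    unfolding sem_formula_of
  proof (rule ev_mono)
    show "ev G (\<lambda>v. if v \<in> L then label_sem (Const True) \<tau> else leaf_sem G \<tau> v) (root G)"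
      using sat LL root_less[OF ne] by (simp add: formula_of_def sem_relabel)
    show "leaf_sem G \<tau> v" if "if v \<in> L then label_sem (Const True) \<tau> else leaf_sem G \<tau> v" for v
      using that True L by (auto simp: leaf_sem_def labeled_by_def lit_leaves_def lit_sem_def split: if_splits)
  qed
  then show ?thesis ..
next
  case False
  have ne: "G \<noteq> []" using G by (simp add: circuit_over_def)
  have LL: "L \<subseteq> leaves G" using L lit_leaves_subset by (auto simp: labeled_by_def)
  define V where "V = (inputs n \<union> outputs m) - {lit_var l}"
  \<comment> \<open>Realizability prescribes the domain exactly: every variable but that of
    \<open>l\<close>, here with the values of \<open>\<tau>\<close>.\<close>
  define \<sigma> where "\<sigma> x = (if x \<in> V then Some (\<tau> x) else None)" for x
  have "dom \<sigma> = V" by (auto simp: \<sigma>_def dom_def)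
  then have "\<not> (\<forall>\<tau>'. sem_under (formula_of (realization G L l)) \<sigma> \<tau>' \<longleftrightarrow> \<tau>' W \<and> \<tau>' W')"
    using unreal unfolding and_realizable_set_iff[OF L] V_def by simp
  then obtain \<tau>' where
    "sem_under (formula_of (realization G L l)) \<sigma> \<tau>' \<noteq> (\<tau>' W \<and> \<tau>' W')"
    by auto
  moreover define \<rho> where "\<rho> = (\<lambda>x. case \<sigma> x of Some b \<Rightarrow> b | None \<Rightarrow> \<tau>' x)"
  moreover have "\<sigma> W = None" "\<sigma> W' = None"
    by (auto simp: V_def \<sigma>_def inputs_def outputs_def)
  ultimately have F: "ev G (realization_leaf G L l \<rho>) (root G) \<noteq> (\<rho> W \<and> \<rho> W')"
    using ne by (simp add: sem_under_def sem_realization)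
  have leaf: "leaf_sem G \<rho> v = leaf_sem G \<tau> v \<and> leaf_sem G (set_lit l \<tau>) v = leaf_sem G \<tau> v"
    if v: "v \<le> root G" and "G ! v \<noteq> Leaf (Lit l)" "G ! v \<noteq> Leaf (Lit (negate l))" for v
  proof (cases "G ! v")
    case (Leaf b)
    show ?thesis
    proof (cases b)
      case (Lit l')
      with Leaf that have l': "l' \<noteq> l" "l' \<noteq> negate l" by auto
      then have "lit_var l' \<noteq> lit_var l" by (cases l; cases l') auto
      moreover have "gate_ok (inputs n \<union> outputs m) v (G ! v)"
        using G v root_less[OF ne] by (simp add: circuit_over_def)
      ultimately have "lit_var l' \<in> V" using Leaf Lit by (simp add: V_def)
      then have "label_sem b \<rho> = label_sem b \<tau>"
        unfolding Lit by (cases l') (auto simp: \<rho>_def \<sigma>_def)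
      moreover have "label_sem b (set_lit l \<tau>) = label_sem b \<tau>"
        using l' lit_sem_set_lit[of l' l \<tau>] by (simp add: Lit lit_sem_def)
      ultimately show ?thesis by (simp add: leaf_sem_def Leaf)
    qed (simp add: leaf_sem_def Leaf)
  qed (simp_all add: leaf_sem_def)
  have leaf_l: "leaf_sem G \<tau> v = False" "leaf_sem G (set_lit l \<tau>) v"
    if "G ! v = Leaf (Lit l)" for v
    using that False lit_sem_set_lit[of l l \<tau>] by (simp_all add: leaf_sem_def lit_sem_def)
  have leaf_n: "leaf_sem G \<tau> v" "leaf_sem G (set_lit l \<tau>) v = False"
    if "G ! v = Leaf (Lit (negate l))" for v
    using that False lit_sem_set_lit[of "negate l" l \<tau>] lit_sem_negate[of l \<tau>]
    by (simp_all add: leaf_sem_def lit_sem_def)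
  \<comment> \<open>There is no disagreement when \<open>W\<close> and \<open>W'\<close> are both
    true. So at \<open>\<rho>\<close> the realization is true while \<open>W \<and> W'\<close> is
    false.\<close>
  have "ev G (realization_leaf G L l \<rho>) (root G)" if W: "\<rho> W" "\<rho> W'"
  proof (rule ev_mono)
    show "ev G (\<lambda>v. if v \<in> L then label_sem (Const True) \<tau> else leaf_sem G \<tau> v) (root G)"
      using sat LL root_less[OF ne] by (simp add: formula_of_def sem_relabel)
    show "realization_leaf G L l \<rho> v"
      if "v \<le> root G" "if v \<in> L then label_sem (Const True) \<tau> else leaf_sem G \<tau> v" for v
      using that W L leaf[of v] leaf_l[of v]
      by (auto simp: realization_leaf_def labeled_by_def lit_leaves_def split: if_splits)
  qed
  with F have F1: "ev G (realization_leaf G L l \<rho>) (root G)" "\<not> (\<rho> W \<and> \<rho> W')" by auto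
  show ?thesis
  proof (cases "\<rho> W")
    case False
    have "sem (formula_of G) \<tau>"
      unfolding sem_formula_of
      by (rule ev_mono[OF F1(1)])
        (use False leaf leaf_n in \<open>auto simp: realization_leaf_def split: if_splits\<close>)
    then show ?thesis ..
  next
    case True
    with F1 have "\<not> \<rho> W'" by simp
    then have "sem (formula_of G) (set_lit l \<tau>)"
      unfolding sem_formula_of
      by (intro ev_mono[OF F1(1)])
        (use leaf leaf_l in \<open>auto simp: realization_leaf_def split: if_splits\<close>)
    then show ?thesis ..
  qed
qed

section \<open>Building circuits\<close>

lemma ev_Leaf: "G ! w = Leaf b \<Longrightarrow> ev G f w = f w"
  by (simp add: ev.simps)

lemma ev_And: "G ! w = And u v \<Longrightarrow> u < w \<Longrightarrow> v < w \<Longrightarrow> ev G f w = (ev G f u \<and> ev G f v)"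
  by (simp add: ev.simps[of _ _ w])

lemma ev_Or: "G ! w = Or u v \<Longrightarrow> u < w \<Longrightarrow> v < w \<Longrightarrow> ev G f w = (ev G f u \<or> ev G f v)"
  by (simp add: ev.simps[of _ _ w])

lemma ev_append: "w < length G \<Longrightarrow> ev (G @ H) f w = ev G f w"
  by (rule ev_cong) (auto simp: same_gate_def nth_append)

text \<open>Blocks name their gates by absolute positions and are meaningful only at a fixed offset;
  \<open>segment\<close> and \<open>gates_ok\<close> state facts about a block in place.\<close>

definition segment :: "circuit \<Rightarrow> nat \<Rightarrow> circuit \<Rightarrow> bool" where
  "segment A k B \<longleftrightarrow> (\<forall>i < length B. A ! (k + i) = B ! i)"

lemma segment_refl: "segment A 0 A"
  by (simp add: segment_def)

lemma segment_append: "segment A k (B @ B') \<longleftrightarrow> segment A k B \<and> segment A (k + length B) B'"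
proof
  assume *: "segment A k (B @ B')"
  have "A ! (k + i) = B ! i" if "i < length B" for i
    using *[unfolded segment_def, rule_format, of i] that by (simp add: nth_append)
  moreover have "A ! (k + length B + i) = B' ! i" if "i < length B'" for i
    using *[unfolded segment_def, rule_format, of "length B + i"] that by (simp add: nth_append add.assoc)
  ultimately show "segment A k B \<and> segment A (k + length B) B'"
    by (simp add: segment_def)
next
  assume *: "segment A k B \<and> segment A (k + length B) B'"
  show "segment A k (B @ B')"
    unfolding segment_def
  proof (intro allI impI)
    fix i assume "i < length (B @ B')"
    then show "A ! (k + i) = (B @ B') ! i"
      using *[unfolded segment_def] by (cases "i < length B") (auto simp: nth_append dest: spec[of _ "i - length B"])
  qed
qed

lemma segment_nth: "segment A k B \<Longrightarrow> i < length B \<Longrightarrow> A ! (k + i) = B ! i"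
  by (simp add: segment_def)

lemma upt_split: "t < k \<Longrightarrow> [0..<k] = [0..<t] @ t # [Suc t..<k]"
  by (metis le0 less_imp_le_nat upt_add_eq_append upt_conv_Cons le_add_diff_inverse)

lemma segment_concat:
  assumes "segment A o' (concat (map f [0..<k]))" "t < k"
  shows "segment A (o' + length (concat (map f [0..<t]))) (f t)"
  using assms by (simp add: upt_split[OF assms(2)] segment_append)

definition gates_ok :: "var set \<Rightarrow> nat \<Rightarrow> circuit \<Rightarrow> bool" where
  "gates_ok V k B \<longleftrightarrow> (\<forall>i < length B. gate_ok V (k + i) (B ! i))"

lemma gates_ok_append: "gates_ok V k (B @ B') \<longleftrightarrow> gates_ok V k B \<and> gates_ok V (k + length B) B'"
proof
  assume *: "gates_ok V k (B @ B')"
  have "gate_ok V (k + i) (B ! i)" if "i < length B" for i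
    using *[unfolded gates_ok_def, rule_format, of i] that by (simp add: nth_append)
  moreover have "gate_ok V (k + length B + i) (B' ! i)" if "i < length B'" for i
    using *[unfolded gates_ok_def, rule_format, of "length B + i"] that by (simp add: nth_append add.assoc)
  ultimately show "gates_ok V k B \<and> gates_ok V (k + length B) B'"
    by (simp add: gates_ok_def)
next
  assume *: "gates_ok V k B \<and> gates_ok V (k + length B) B'"
  show "gates_ok V k (B @ B')"
    unfolding gates_ok_def
  proof (intro allI impI)
    fix i assume "i < length (B @ B')"
    then show "gate_ok V (k + i) ((B @ B') ! i)"
      using *[unfolded gates_ok_def] by (cases "i < length B") (auto simp: nth_append dest: spec[of _ "i - length B"])
  qed
qed

lemma gates_ok_concat:
  "(\<And>t. t < k \<Longrightarrow> gates_ok V (o' + length (concat (map f [0..<t]))) (f t)) \<Longrightarrow>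
    gates_ok V o' (concat (map f [0..<k]))"
  by (induction k) (auto simp: gates_ok_append gates_ok_def[of _ _ "[]"])

lemma circuit_over_gates_ok: "circuit_over V G \<Longrightarrow> gates_ok V 0 G"
  by (simp add: circuit_over_def gates_ok_def)

text \<open>
  The gates of a construction need not all be reachable from the intended root \<open>t\<close>. The chain of
  conjunctions appended here starts with a constant false leaf, hence is false, and reaches all of them.
\<close>

definition wrap :: "nat \<Rightarrow> circuit \<Rightarrow> circuit" where
  "wrap t A = A @ Leaf (Const False) #
     map (\<lambda>w. And w (length A + w)) [0..<length A] @ [Or t (2 * length A)]"

lemma length_wrap: "length (wrap t A) = 2 * length A + 2"
  by (simp add: wrap_def)

lemma root_wrap: "root (wrap t A) = 2 * length A + 1"
  by (simp add: root_def length_wrap)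

lemma nth_wrap:
  "w < length A \<Longrightarrow> wrap t A ! w = A ! w"
  "wrap t A ! length A = Leaf (Const False)"
  "w < length A \<Longrightarrow> wrap t A ! (length A + Suc w) = And w (length A + w)"
  "wrap t A ! (2 * length A + 1) = Or t (2 * length A)"
  by (simp_all add: wrap_def nth_append)

lemma circuit_over_wrap:
  assumes "gates_ok V 0 A" "t < length A"
  shows "circuit_over V (wrap t A)"
proof -
  let ?B = "wrap t A" and ?N = "length A"
  have "gate_ok V i (?B ! i)" if "i < length ?B" for i
  proof -
    have "i = ?N + Suc (i - ?N - 1) \<and> i - ?N - 1 < ?N" if "?N < i" "i \<noteq> 2 * ?N + 1"
      using that \<open>i < length ?B\<close> by (simp add: length_wrap)
    then consider "i < ?N" | "i = ?N" | w where "i = ?N + Suc w" "w < ?N" | "i = 2 * ?N + 1"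
      by (meson linorder_neqE_nat)
    then show ?thesis
      by cases (use assms in \<open>auto simp: gates_ok_def nth_wrap[simplified]\<close>)
  qed
  \<comment> \<open>Walk down the chain from its top \<open>2 * ?N\<close> to the false leaf at
    \<open>?N\<close>; each chain gate passed has one gate of \<open>A\<close> as its other
    child.\<close>
  moreover have chain: "(root ?B, 2 * ?N - i) \<in> (edges ?B)\<^sup>*" if "i \<le> ?N" for i
    using that
  proof (induction i)
    case 0
    have "(root ?B, 2 * ?N) \<in> edges ?B"
      using nth_wrap(4)[of t A] by (simp add: root_wrap edges_def length_wrap)
    then show ?case by auto
  next
    case (Suc i)
    define w where "w = ?N - Suc i"
    have w: "w < ?N" "2 * ?N - i = ?N + Suc w" "2 * ?N - Suc i = ?N + w"
      using Suc.prems by (auto simp: w_def)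
    have "(?N + Suc w, ?N + w) \<in> edges ?B"
      using nth_wrap(3)[OF w(1), of t] w(1) by (simp add: edges_def length_wrap)
    with Suc w show ?case by (metis Suc_leD rtrancl.rtrancl_into_rtrancl)
  qed
  have chain': "(root ?B, ?N + w) \<in> (edges ?B)\<^sup>*" if "w \<le> ?N" for w
    using chain[of "?N - w"] that by (simp add: mult_2)
  have "(root ?B, w) \<in> (edges ?B)\<^sup>*" if "w < length ?B" for w
  proof -
    consider "w < ?N" | "?N \<le> w" "w \<le> 2 * ?N" | "w = root ?B"
      using \<open>w < length ?B\<close> unfolding length_wrap root_wrap by linarith
    then show ?thesis
    proof cases
      case 1
      have "(?N + Suc w, w) \<in> edges ?B"
        using nth_wrap(3)[OF 1, of t] 1 by (simp add: edges_def length_wrap)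
      moreover have "(root ?B, ?N + Suc w) \<in> (edges ?B)\<^sup>*" using chain'[of "Suc w"] 1 by simp
      ultimately show ?thesis by simp
    next
      case 2
      then show ?thesis using chain'[of "w - ?N"] by simp
    qed simp
  qed
  ultimately show ?thesis by (auto simp: circuit_over_def length_wrap wrap_def)
qed

lemma ev_wrap:
  assumes "t < length A" "\<not> f (length A)"
  shows "ev (wrap t A) f (root (wrap t A)) = ev A f t"
proof -
  let ?B = "wrap t A" and ?N = "length A"
  have "\<not> ev ?B f (?N + w)" if "w \<le> ?N" for w
    using that
  proof (induction w)
    case 0
    then show ?case using ev_Leaf[OF nth_wrap(2)] assms(2) by simp
  next
    case (Suc w)
    then show ?case using ev_And[OF nth_wrap(3)[of w A t]] by simp
  qed
  from this[of ?N] have "\<not> ev ?B f (2 * ?N)" by (simp add: mult_2)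
  moreover have "ev ?B f t = ev A f t"
    unfolding wrap_def by (rule ev_append[OF assms(1)])
  ultimately show ?thesis
    unfolding root_wrap using assms(1) by (subst ev_Or[OF nth_wrap(4)]) auto
qed

section \<open>De Morgan duals and copies with substituted outputs\<close>

fun dual_gate :: "gate \<Rightarrow> gate" where
  "dual_gate (And u v) = Or u v"
| "dual_gate (Or u v) = And u v"
| "dual_gate (Leaf (Lit l)) = Leaf (Lit (negate l))"
| "dual_gate (Leaf (Const b)) = Leaf (Const (\<not> b))"

lemma lit_var_negate [simp]: "lit_var (negate l) = lit_var l"
  by (cases l) auto

lemma gate_ok_dual: "gate_ok V w (dual_gate g) = gate_ok V w g"
  by (cases g rule: dual_gate.cases) auto

lemma gates_ok_dual: "gates_ok V k (map dual_gate G) = gates_ok V k G"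
  by (simp add: gates_ok_def gate_ok_dual)

text \<open>De Morgan, by induction on positions. \<open>gates_ok\<close> ensures the guards of
  \<open>formula_at\<close>; a failed guard would yield false in both circuits.\<close>

lemma sem_dual:
  assumes "gates_ok V 0 G" "w < length G"
  shows "sem (formula_at (map dual_gate G) w) \<tau> = (\<not> sem (formula_at G w) \<tau>)"
  using assms(2)
proof (induction w rule: less_induct)
  case (less w)
  have ok: "gate_ok V w (G ! w)" using assms(1) less.prems by (simp add: gates_ok_def)
  show ?case
  proof (cases "G ! w")
    case (Leaf b)
    have "label_sem (Lit (negate l)) \<tau> = (\<not> label_sem (Lit l) \<tau>)" for l by (cases l) auto
    then show ?thesis
      using less.prems Leaf by (cases b) (simp_all add: formula_at.simps[of _ w])
  next
    case (And u v)
    then show ?thesis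
      using less.prems less.IH[of u] less.IH[of v] ok by (simp add: formula_at.simps[of _ w])
  next
    case (Or u v)
    then show ?thesis
      using less.prems less.IH[of u] less.IH[of v] ok by (simp add: formula_at.simps[of _ w])
  qed
qed

text \<open>\<open>P + x\<close> and \<open>Q + x\<close> hold the values of output \<open>x\<close>
  and of its negation, and \<open>c\<close> is a gate with value true. No gate merely passes on a
  value, so an output leaf becomes the conjunction of the wanted value with
  \<open>c\<close>.\<close>

fun subst_gate :: "nat \<Rightarrow> nat \<Rightarrow> nat \<Rightarrow> nat \<Rightarrow> gate \<Rightarrow> gate" where
  "subst_gate b c P Q (And u v) = And (b + u) (b + v)"
| "subst_gate b c P Q (Or u v) = Or (b + u) (b + v)"
| "subst_gate b c P Q (Leaf (Lit (Pos (Out x)))) = And (P + x) c"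
| "subst_gate b c P Q (Leaf (Lit (Neg (Out x)))) = And (Q + x) c"
| "subst_gate b c P Q (Leaf l) = Leaf l"

lemma gates_ok_subst:
  assumes "gates_ok V 0 G" "V \<subseteq> inputs n \<union> outputs m"
    and "\<And>x. Out x \<in> V \<Longrightarrow> P + x < b \<and> Q + x < b \<and> P + x \<noteq> c \<and> Q + x \<noteq> c" "c < b"
  shows "gates_ok (inputs n) b (map (subst_gate b c P Q) G)"
  unfolding gates_ok_def
proof (intro allI impI)
  fix i assume "i < length (map (subst_gate b c P Q) G)"
  then have "gate_ok V i (G ! i)" "i < length G" using assms(1) by (auto simp: gates_ok_def)
  then show "gate_ok (inputs n) (b + i) (map (subst_gate b c P Q) G ! i)"
    using assms(2-4) by (cases "(b, c, P, Q, G ! i)" rule: subst_gate.cases)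
      (auto simp: outputs_def inputs_def intro: trans_less_add1)
qed

text \<open>A substitution lemma: \<open>\<tau>\<close> combines the computed values found at
  \<open>P\<close> and \<open>Q\<close> with the values of the remaining leaves, and the copy at
  \<open>b\<close> computes \<open>G\<close> under \<open>\<tau>\<close> gate by gate.\<close>

lemma ev_subst:
  assumes seg: "segment A b (map (subst_gate b c P Q) G)"
    and ok: "gates_ok V 0 G"
    and x: "\<And>x. Out x \<in> V \<Longrightarrow> P + x < b \<and> Q + x < b \<and>
      ev A f (P + x) = \<tau> (Out x) \<and> ev A f (Q + x) = (\<not> \<tau> (Out x))"
    and c: "c < b" "ev A f c"
    and leaf: "\<And>w l. w < length G \<Longrightarrow> A ! (b + w) = Leaf l \<Longrightarrow> f (b + w) = label_sem l \<tau>"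
    and w: "w < length G"
  shows "ev A f (b + w) = sem (formula_at G w) \<tau>"
  using w
proof (induction w rule: less_induct)
  case (less w)
  have ok: "gate_ok V w (G ! w)" using ok less.prems by (simp add: gates_ok_def)
  have A: "A ! (b + w) = subst_gate b c P Q (G ! w)"
    using segment_nth[OF seg] less.prems by simp
  show ?case
  proof (cases "G ! w")
    case (And u v)
    with less ok A show ?thesis by (simp add: formula_at.simps[of _ w] ev_And)
  next
    case (Or u v)
    with less ok A show ?thesis by (simp add: formula_at.simps[of _ w] ev_Or)
  next
    case (Leaf l)
    have sem: "sem (formula_at G w) \<tau> = label_sem l \<tau>" by (simp add: formula_at.simps Leaf)
    show ?thesis
    proof (cases "\<exists>x. l = Lit (Pos (Out x)) \<or> l = Lit (Neg (Out x))")
      case True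
      then obtain y where y: "l = Lit (Pos (Out y)) \<or> l = Lit (Neg (Out y))" ..
      with ok Leaf have "Out y \<in> V" by auto
      from x[OF this] y c A Leaf sem show ?thesis
        by (auto simp: ev_And)
    next
      case False
      then have "subst_gate b c P Q (Leaf l) = Leaf l"
        by (cases "(b, c, P, Q, Leaf l)" rule: subst_gate.cases) auto
      then show ?thesis using A Leaf leaf[OF less.prems] sem by (simp add: ev_Leaf)
    qed
  qed
qed

definition dual_copies :: "nat \<Rightarrow> nat \<Rightarrow> nat \<Rightarrow> nat \<Rightarrow> circuit \<Rightarrow> circuit" where
  "dual_copies b c P Q G = map (subst_gate b c P Q) G @
     map (subst_gate (b + length G) c P Q) (map dual_gate G)"

lemma length_dual_copies [simp]: "length (dual_copies b c P Q G) = 2 * length G"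
  by (simp add: dual_copies_def)

lemma gates_ok_dual_copies:
  assumes "gates_ok V 0 G" "V \<subseteq> inputs n \<union> outputs m"
    and "\<And>x. Out x \<in> V \<Longrightarrow> P + x < b \<and> Q + x < b \<and> P + x \<noteq> c \<and> Q + x \<noteq> c" "c < b"
  shows "gates_ok (inputs n) b (dual_copies b c P Q G)"
  unfolding dual_copies_def gates_ok_append length_map
  using assms(4) by (intro conjI gates_ok_subst[OF _ assms(2)] gates_ok_dual[THEN iffD2] assms(1))
    (auto dest: assms(3) intro: trans_less_add1)

lemma ev_dual_copies:
  assumes seg: "segment A b (dual_copies b c P Q G)"
    and ok: "gates_ok V 0 G"
    and x: "\<And>x. Out x \<in> V \<Longrightarrow> P + x < b \<and> Q + x < b \<and>
      ev A f (P + x) = \<tau> (Out x) \<and> ev A f (Q + x) = (\<not> \<tau> (Out x))"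
    and c: "c < b" "ev A f c"
    and leaf: "\<And>w l. w < 2 * length G \<Longrightarrow> A ! (b + w) = Leaf l \<Longrightarrow> f (b + w) = label_sem l \<tau>"
    and ne: "G \<noteq> []"
  shows "ev A f (b + length G - 1) = sem (formula_of G) \<tau>"
    and "ev A f (b + 2 * length G - 1) = (\<not> sem (formula_of G) \<tau>)"
proof -
  have r: "root G < length G" by (rule root_less[OF ne])
  have "ev A f (b + root G) = sem (formula_at G (root G)) \<tau>"
    using seg x c leaf r by (intro ev_subst[OF _ ok]) (auto simp: dual_copies_def segment_append)
  then show "ev A f (b + length G - 1) = sem (formula_of G) \<tau>"
    using r by (simp add: formula_of_def root_def)
  have "ev A f ((b + length G) + root G) = sem (formula_at (map dual_gate G) (root G)) \<tau>"
  proof (rule ev_subst[where V = V])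
    show "segment A (b + length G) (map (subst_gate (b + length G) c P Q) (map dual_gate G))"
      using seg by (simp add: dual_copies_def segment_append)
    show "f (b + length G + w) = label_sem l \<tau>"
      if "w < length (map dual_gate G)" "A ! (b + length G + w) = Leaf l" for w l
      using leaf[of "length G + w" l] that by (simp add: add.assoc)
  qed (use x c r in \<open>auto simp: gates_ok_dual ok intro: trans_less_add1\<close>)
  moreover have "b + length G + root G = b + 2 * length G - 1"
    using r by (simp add: root_def)
  ultimately show "ev A f (b + 2 * length G - 1) = (\<not> sem (formula_of G) \<tau>)"
    using sem_dual[OF ok r] by (simp add: formula_of_def)
qed

section \<open>Skolem functions from SAUNF\<close>

lemma gates_ok_map_upt: "gates_ok V k (map f [0..<j]) \<longleftrightarrow> (\<forall>i<j. gate_ok V (k + i) (f i))"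
  by (simp add: gates_ok_def)

lemma gates_ok_replicate: "gate_ok V 0 (Leaf b) \<Longrightarrow> gates_ok V k (replicate j (Leaf b))"
  by (simp add: gates_ok_def)

text \<open>With the value of a circuit at \<open>r\<close> and its negation at \<open>r'\<close>,
  the old value survives if the circuit holds; otherwise the disjunction with \<open>r'\<close>
  forces true and the conjunction with \<open>r\<close> forces false. Gate 0, which will be true,
  forwards unaffected values. Negated values are updated in the same way with the dual
  literal.\<close>

definition update_gate :: "gate \<Rightarrow> nat \<Rightarrow> nat \<Rightarrow> nat \<Rightarrow> nat \<Rightarrow> gate" where
  "update_gate g r r' P x =
     (if g = Leaf (Lit (Pos (Out x))) then Or (P + x) r'
      else if g = Leaf (Lit (Neg (Out x))) then And (P + x) r
      else And (P + x) 0)"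

text \<open>
  The current output values are at \<open>P + x\<close> and their negations at \<open>P + m + x\<close>; the last \<open>2 * m\<close>
  gates of the block hold the updated values in the same format. The last gates of the copy of \<open>H\<close> and
  of its dual are \<open>r\<close> and \<open>r'\<close>.
\<close>

definition step_block :: "nat \<Rightarrow> nat \<Rightarrow> circuit \<Rightarrow> gate \<Rightarrow> circuit" where
  "step_block m P H g =
     (let r = P + 2 * m + length H - 1; r' = P + 2 * m + 2 * length H - 1 in
      dual_copies (P + 2 * m) 0 P (P + m) H @
      map (update_gate g r r' P) [0..<m] @ map (update_gate (dual_gate g) r r' (P + m)) [0..<m])"

lemma length_step_block [simp]: "length (step_block m P H g) = 2 * length H + 2 * m"
  by (simp add: step_block_def Let_def)

lemma gates_ok_step_block:
  assumes H: "circuit_over (inputs n \<union> outputs m) H" and P: "P \<ge> 1"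
  shows "gates_ok (inputs n) (P + 2 * m) (step_block m P H g)"
proof -
  have H': "length H > 0" "gates_ok (inputs n \<union> outputs m) 0 H"
    using H circuit_over_gates_ok by (auto simp: circuit_over_def)
  have "gates_ok (inputs n) (P + 2 * m) (dual_copies (P + 2 * m) 0 P (P + m) H)"
    using P by (intro gates_ok_dual_copies[OF H'(2) order.refl]) (auto simp: outputs_def inputs_def)
  moreover obtain h where "length H = Suc h" using H'(1) by (cases H) auto
  ultimately show ?thesis
    using P by (auto simp: step_block_def Let_def gates_ok_append gates_ok_map_upt update_gate_def)
qed

lemma ev_update_gate:
  assumes A: "A ! w = update_gate g r r' P x" and less: "P + x < w" "r < w" "r' < w" "0 < w"
    and "ev A f 0" "ev A f r = b" "ev A f r' = (\<not> b)"
  shows "ev A f w =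
    (if b then ev A f (P + x)
     else if g = Leaf (Lit (Pos (Out x))) then True
     else if g = Leaf (Lit (Neg (Out x))) then False
     else ev A f (P + x))"
  using assms by (auto simp: update_gate_def ev_And ev_Or split: if_splits)

text \<open>Gate 0 is true, and all outputs start as false. Block \<open>t\<close> starts
  \<open>2 * m\<close> gates after the values it reads, which therefore begin at
  \<open>1 + t * (2 * N + 2 * m)\<close>; its own last \<open>2 * m\<close> gates are what block
  \<open>t + 1\<close> reads.\<close>

definition skolem_array :: "nat \<Rightarrow> nat \<Rightarrow> nat \<Rightarrow> (nat \<Rightarrow> circuit) \<Rightarrow> (nat \<Rightarrow> gate) \<Rightarrow> circuit" where
  "skolem_array m N k H g =
     Leaf (Const True) # replicate m (Leaf (Const False)) @ replicate m (Leaf (Const True)) @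
     concat (map (\<lambda>t. step_block m (1 + t * (2 * N + 2 * m)) (H t) (g t)) [0..<k])"

text \<open>The assignment reached after \<open>t\<close> descent steps: keep the values if they
  satisfy the next circuit, else make the literal true, the other alternative of
  \<open>unrealizable_step\<close>.\<close>

primrec skolem_run :: "nat \<Rightarrow> (nat \<Rightarrow> circuit) \<Rightarrow> (nat \<Rightarrow> literal) \<Rightarrow> assignment \<Rightarrow> nat \<Rightarrow> assignment" where
  "skolem_run m H l \<sigma> 0 = (\<lambda>x. if x \<in> outputs m then False else \<sigma> x)"
| "skolem_run m H l \<sigma> (Suc t) =
     (if sem (formula_of (H t)) (skolem_run m H l \<sigma> t) then skolem_run m H l \<sigma> t
      else set_lit (l t) (skolem_run m H l \<sigma> t))"

lemma set_lit_other: "x \<noteq> lit_var l \<Longrightarrow> set_lit l \<tau> x = \<tau> x"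
  by (cases l) (auto simp: set_lit_def)

lemma skolem_run_other:
  assumes "\<And>t. t < k \<Longrightarrow> lit_var (l t) \<in> outputs m" "x \<notin> outputs m" "t \<le> k"
  shows "skolem_run m H l \<sigma> t x = \<sigma> x"
  using assms(3)
proof (induction t)
  case (Suc t)
  then have "x \<noteq> lit_var (l t)" using assms(1)[of t] assms(2) by auto
  with Suc show ?case by (simp add: set_lit_other)
qed (use assms(2) in simp)

lemma length_concat_const:
  "(\<And>t. t < k \<Longrightarrow> length (f t) = c) \<Longrightarrow> length (concat (map f [0..<k])) = k * c"
  by (induction k) auto

text \<open>Relabeling preserves lengths, so all circuits of the descent share the length
  \<open>N\<close>, which makes positions predictable. \<open>g t\<close> is the leaf from which the
  construction reads the literal \<open>l t\<close>.\<close>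

locale skolem_steps =
  fixes n m N k :: nat and H :: "nat \<Rightarrow> circuit" and l :: "nat \<Rightarrow> literal" and g :: "nat \<Rightarrow> gate"
  assumes H: "t < k \<Longrightarrow> circuit_over (inputs n \<union> outputs m) (H t)"
    and N: "t < k \<Longrightarrow> length (H t) = N"
    and l: "t < k \<Longrightarrow> lit_var (l t) \<in> outputs m"
    and g: "t < k \<Longrightarrow> g t = Leaf (Lit (l t))"
begin

abbreviation "A \<equiv> skolem_array m N k H g"
abbreviation "B \<equiv> 2 * N + 2 * m"
abbreviation "blk t \<equiv> step_block m (1 + t * B) (H t) (g t)"

lemma length_blks: "t \<le> k \<Longrightarrow> length (concat (map blk [0..<t])) = t * B"
  using N by (intro length_concat_const) simp

lemma length_array: "length A = 1 + 2 * m + k * B"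
  using length_blks[of k] by (simp add: skolem_array_def)

lemma block_end: "t < k \<Longrightarrow> 1 + 2 * m + t * B + B \<le> length A"
  using mult_le_mono1[of "Suc t" k B] by (simp add: length_array)

lemma gates_ok_array: "gates_ok (inputs n) 0 A"
proof -
  have "gates_ok (inputs n) (1 + 2 * m) (concat (map blk [0..<k]))"
  proof (rule gates_ok_concat)
    fix t assume t: "t < k"
    then have "length (concat (map blk [0..<t])) = t * B" by (intro length_blks) simp
    then show "gates_ok (inputs n) (1 + 2 * m + length (concat (map blk [0..<t]))) (blk t)"
      using gates_ok_step_block[OF H[OF t], of "1 + t * B" "g t"] by (simp add: ac_simps)
  qed
  moreover have "gates_ok (inputs n) 0
    ([Leaf (Const True)] @ replicate m (Leaf (Const False)) @ replicate m (Leaf (Const True)))"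
    unfolding gates_ok_append by (simp add: gates_ok_replicate) (simp add: gates_ok_def)
  ultimately show ?thesis
    using gates_ok_append[of "inputs n" 0 "[Leaf (Const True)] @ replicate m (Leaf (Const False)) @ replicate m (Leaf (Const True))"
        "concat (map blk [0..<k])"]
    by (simp add: skolem_array_def mult_2)
qed

lemma ev_array:
  assumes "t \<le> k" "x < m"
  shows "ev A (leaf_sem A \<sigma>) (1 + t * B + x) = skolem_run m H l \<sigma> t (Out x) \<and>
         ev A (leaf_sem A \<sigma>) (1 + t * B + m + x) = (\<not> skolem_run m H l \<sigma> t (Out x))"
  using assms
proof (induction t arbitrary: x)
  case 0
  have "A ! (1 + x) = Leaf (Const False)" "A ! (1 + m + x) = Leaf (Const True)"
    using 0(2) by (simp_all add: skolem_array_def nth_append)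
  then show ?case using 0(2) by (simp add: ev_Leaf leaf_sem_def outputs_def)
next
  case (Suc t)
  let ?f = "leaf_sem A \<sigma>" and ?P = "1 + t * B" and ?H = "H t" and ?\<tau> = "skolem_run m H l \<sigma> t"
  let ?b = "?P + 2 * m"
  define r where "r = ?b + N - 1"
  define r' where "r' = ?b + 2 * N - 1"
  have t: "t < k" using Suc.prems by simp
  have ne: "?H \<noteq> []" using H[OF t] by (simp add: circuit_over_def)
  have N0: "0 < N" using ne N[OF t] by auto
  have IH: "ev A ?f (?P + x) = ?\<tau> (Out x)" "ev A ?f (?P + m + x) = (\<not> ?\<tau> (Out x))" if "x < m" for x
    using Suc.IH[OF _ that] t by auto
  have true: "ev A ?f 0" by (simp add: ev_Leaf leaf_sem_def skolem_array_def)
  have "segment A 0 (([Leaf (Const True)] @ replicate m (Leaf (Const False)) @ replicate m (Leaf (Const True))) @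
     concat (map blk [0..<k]))"
    using segment_refl[of A] by (simp add: skolem_array_def)
  then have "segment A (1 + 2 * m) (concat (map blk [0..<k]))"
    unfolding segment_append[of _ _ _ "concat _"] by (simp add: mult_2)
  from segment_concat[OF this t] have seg: "segment A ?b (blk t)"
    using length_blks[of t] t by (simp add: ac_simps)
  have seg1: "segment A ?b (dual_copies ?b 0 ?P (?P + m) ?H)"
    and seg2: "segment A (?b + 2 * N) (map (update_gate (g t) r r' ?P) [0..<m])"
    and seg3: "segment A (?b + 2 * N + m) (map (update_gate (dual_gate (g t)) r r' (?P + m)) [0..<m])"
    using seg N[OF t] unfolding step_block_def Let_def segment_append r_def r'_def by simp_all
  \<comment> \<open>All output leaves have been replaced in the array, so the remaining labels
    concern only inputs, on which the run agrees with \<open>\<sigma>\<close>.\<close>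
  have leaf: "?f (?b + w) = label_sem b ?\<tau>" if "w < 2 * length ?H" "A ! (?b + w) = Leaf b" for w b
  proof -
    have "?b + w < length A" using block_end[OF t] that(1) N[OF t] by simp
    with that(2) gates_ok_array have b: "label_vars b \<subseteq> inputs n"
      unfolding gates_ok_def by (metis add_0 gate_ok.simps(1))
    have "?\<tau> x = \<sigma> x" if "x \<in> inputs n" for x
      using that skolem_run_other[of k l m x t H \<sigma>] l t by (auto simp: inputs_def outputs_def)
    with b have "label_sem b ?\<tau> = label_sem b \<sigma>" by (cases "(b, \<sigma>)" rule: label_sem.cases) auto
    then show ?thesis using that(2) by (simp add: leaf_sem_def)
  qed
  have copies: "ev A ?f r = sem (formula_of ?H) ?\<tau>" "ev A ?f r' = (\<not> sem (formula_of ?H) ?\<tau>)"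
  proof -
    have x: "?P + x < ?b \<and> ?P + m + x < ?b \<and>
        ev A ?f (?P + x) = ?\<tau> (Out x) \<and> ev A ?f (?P + m + x) = (\<not> ?\<tau> (Out x))"
      if "Out x \<in> inputs n \<union> outputs m" for x
    proof -
      have "x < m" using that by (auto simp: inputs_def outputs_def)
      then show ?thesis using IH by simp
    qed
    show "ev A ?f r = sem (formula_of ?H) ?\<tau>"
      using ev_dual_copies(1)[OF seg1 circuit_over_gates_ok[OF H[OF t]] x _ true leaf ne]
      by (simp add: r_def N[OF t])
    show "ev A ?f r' = (\<not> sem (formula_of ?H) ?\<tau>)"
      using ev_dual_copies(2)[OF seg1 circuit_over_gates_ok[OF H[OF t]] x _ true leaf ne]
      by (simp add: r'_def N[OF t])
  qed
  have x: "x < m" by fact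
  have "A ! (?b + 2 * N + x) = update_gate (g t) r r' ?P x"
    using segment_nth[OF seg2, of x] x by simp
  from ev_update_gate[OF this _ _ _ _ true copies] N0 x IH(1)[OF x]
  have pos: "ev A ?f (?b + 2 * N + x) =
    (if sem (formula_of ?H) ?\<tau> then ?\<tau> (Out x)
     else if g t = Leaf (Lit (Pos (Out x))) then True
     else if g t = Leaf (Lit (Neg (Out x))) then False else ?\<tau> (Out x))"
    by (simp add: r_def r'_def)
  have "A ! (?b + 2 * N + m + x) = update_gate (dual_gate (g t)) r r' (?P + m) x"
    using segment_nth[OF seg3, of x] x by simp
  from ev_update_gate[OF this _ _ _ _ true copies] N0 x IH(2)[OF x]
  have neg: "ev A ?f (?b + 2 * N + m + x) =
    (if sem (formula_of ?H) ?\<tau> then \<not> ?\<tau> (Out x)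
     else if dual_gate (g t) = Leaf (Lit (Pos (Out x))) then True
     else if dual_gate (g t) = Leaf (Lit (Neg (Out x))) then False else \<not> ?\<tau> (Out x))"
    by (simp add: r_def r'_def)
  have run: "skolem_run m H l \<sigma> (Suc t) (Out x) =
    (if sem (formula_of ?H) ?\<tau> then ?\<tau> (Out x)
     else if l t = Pos (Out x) then True
     else if l t = Neg (Out x) then False else ?\<tau> (Out x))"
    by (cases "l t") (auto simp: set_lit_def)
  \<comment> \<open>The updated values of block \<open>t\<close> lie exactly where the claim for
    \<open>Suc t\<close> expects them.\<close>
  have idx: "1 + Suc t * B + x = ?b + 2 * N + x" "1 + Suc t * B + m + x = ?b + 2 * N + m + x"
    by simp_all
  have l1: "negate (l t) = Pos (Out x) \<longleftrightarrow> l t = Neg (Out x)"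
    "negate (l t) = Neg (Out x) \<longleftrightarrow> l t = Pos (Out x)" by (cases "l t"; simp)+
  show ?case unfolding idx pos neg run g[OF t] by (simp add: l1)
qed

end

text \<open>Leaves have no children, so relabeling them changes no edge and hence no
  reachability.\<close>

lemma circuit_over_relabel:
  assumes "circuit_over V G" "L \<subseteq> leaves G"
  shows "circuit_over V (relabel L (Const b) G)"
proof -
  have "edges (relabel L (Const b) G) = edges G"
  proof (intro set_eqI)
    fix p :: "nat \<times> nat"
    obtain u v where "p = (u, v)" by (cases p)
    moreover have "u \<in> L \<Longrightarrow> u < length G \<and> children (G ! u) = {}"
      using assms(2) by (auto simp: leaves_def)
    ultimately show "p \<in> edges (relabel L (Const b) G) \<longleftrightarrow> p \<in> edges G"
      by (cases "u \<in> L") (auto simp: edges_def nth_relabel)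
  qed
  moreover have "gate_ok V w (relabel L (Const b) G ! w)" if "w < length G" for w
    using assms(1) that by (simp add: circuit_over_def nth_relabel)
  moreover have "relabel L (Const b) G \<noteq> []"
    using assms(1) by (simp add: circuit_over_def relabel_def)
  ultimately show ?thesis
    using assms(1) by (simp add: circuit_over_def)
qed

lemma labeled_by_leaves: "labeled_by G L l \<Longrightarrow> L \<subseteq> leaves G"
  using lit_leaves_subset by (auto simp: labeled_by_def)

text \<open>Step \<open>t\<close> passes from the first \<open>k - t\<close> sets being relabeled to
  one set fewer; its circuit and literal therefore have index \<open>k - 1 - t\<close>. After
  \<open>k\<close> steps \<open>G\<close> itself is satisfied.\<close>

lemma SAUNF_skolem_run:
  assumes S: "SAUNF n m G S"
    and k: "k = length S"
    and l: "\<And>j. j < k \<Longrightarrow> labeled_by G (S ! j) (l j)"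
    and sat: "sem (formula_of G) \<tau>" "\<And>x. x \<notin> outputs m \<Longrightarrow> \<tau> x = \<sigma> x"
    and t: "t \<le> k"
  shows "sem (formula_of (relabel_true (take (k - t) S) G))
    (skolem_run m (\<lambda>t. relabel_true (take (k - 1 - t) S) G) (\<lambda>t. l (k - 1 - t)) \<sigma> t)"
  using t
proof (induction t)
  case 0
  have G: "circuit_over (inputs n \<union> outputs m) G" using S by (simp add: SAUNF_def)
  have ne: "G \<noteq> []" using G by (simp add: circuit_over_def)
  have "\<Union>(set S) \<subseteq> leaves G"
    using l k by (force simp: in_set_conv_nth dest: labeled_by_leaves)
  \<comment> \<open>Raising leaves to true preserves satisfaction; independence then allows the
    outputs of \<open>\<tau>\<close> to be replaced by the initial values of the run.\<close>
  moreover have "ev G (\<lambda>v. if v \<in> \<Union>(set S) then label_sem (Const True) \<tau> else leaf_sem G \<tau> v) (root G)"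
    using sat(1) unfolding sem_formula_of by (rule ev_mono) simp
  ultimately have "sem (formula_of (relabel_true S G)) \<tau>"
    using root_less[OF ne] by (simp add: formula_of_def relabel_true_Union sem_relabel)
  moreover have "independent_of (outputs m) (sem (formula_of (relabel_true S G)))"
    using S by (simp add: SAUNF_def)
  ultimately show ?case
    using sat(2) k unfolding independent_of_def
    by simp (metis (mono_tags, lifting))
next
  case (Suc t)
  let ?j = "k - 1 - t"
  let ?G = "relabel_true (take ?j S) G"
  let ?\<tau> = "skolem_run m (\<lambda>t. relabel_true (take (k - 1 - t) S) G) (\<lambda>t. l (k - 1 - t)) \<sigma> t"
  have j: "?j < length S" "k - t = Suc ?j" "k - Suc t = ?j" using Suc.prems k by auto
  have disj: "S ! i \<inter> S ! ?j = {}" if "i < ?j" for i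
    using S that j(1) by (auto simp: SAUNF_def)
  have "\<Union>(set S) \<subseteq> leaves G"
    using l k by (force simp: in_set_conv_nth dest: labeled_by_leaves)
  then have sub: "\<Union>(set (take ?j S)) \<subseteq> leaves G"
    using set_take_subset[of ?j S] by blast
  have "circuit_over (inputs n \<union> outputs m) G" using S by (simp add: SAUNF_def)
  then have G: "circuit_over (inputs n \<union> outputs m) ?G"
    unfolding relabel_true_Union by (rule circuit_over_relabel[OF _ sub])
  have "labeled_by G (S ! ?j) (l ?j)" using l j k by simp
  moreover have "S ! ?j \<inter> \<Union>(set (take ?j S)) = {}"
    using disj by (fastforce simp: in_set_conv_nth)
  moreover from this have "?G ! v = G ! v" if "v \<in> S ! ?j" "v < length G" for v
    unfolding relabel_true_Union nth_relabel[OF that(2)] using that(1) by (simp add: disjoint_iff)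
  \<comment> \<open>Disjointness from the earlier sets keeps the labels of the current set intact in
    the relabeled circuit.\<close>
  ultimately have lab: "labeled_by ?G (S ! ?j) (l ?j)"
    unfolding labeled_by_def lit_leaves_def by (simp add: subset_iff)
  have unreal: "and_unrealizable_set n m ?G (S ! ?j)"
    using S j(1) by (simp add: SAUNF_def)
  have "relabel_true (take (k - t) S) G = relabel (S ! ?j) (Const True) ?G"
    unfolding j(2) take_Suc_conv_app_nth[OF j(1)] relabel_true_def by simp
  then have "sem (formula_of (relabel (S ! ?j) (Const True) ?G)) ?\<tau>"
    using Suc by simp
  from unrealizable_step[OF G lab unreal this] show ?case
    unfolding j(3) by auto
qed

text \<open>All \<open>m\<close> circuits share one array and differ only in the selected gate, the
  final value of output \<open>x\<close>. The literal of a set is read off its first listed leaf.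
  Defaults make the map total on ill-formed lists.\<close>

definition skolem_of_SAUNF :: "nat \<Rightarrow> circuit \<Rightarrow> nat list list \<Rightarrow> circuit list" where
  "skolem_of_SAUNF m G S =
     map (\<lambda>x. wrap (1 + length S * (2 * length G + 2 * m) + x)
       (skolem_array m (length G) (length S)
         (\<lambda>t. relabel (set (concat (map (nth_default [] S) [0..<length S - 1 - t]))) (Const True) G)
         (\<lambda>t. nth_default (Leaf (Const False)) G (nth_default 0 (nth_default [] S (length S - 1 - t)) 0))))
       [0..<m]"

lemma relabel_true_take:
  assumes "j \<le> length S"
  shows "relabel_true (take j (map set S)) G =
    relabel (set (concat (map (nth_default [] S) [0..<j]))) (Const True) G"
proof -
  have "map (nth_default [] S) [0..<j] = take j S"
    using assms by (intro nth_equalityI) (auto simp: nth_default_def)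
  then show ?thesis by (simp add: relabel_true_Union take_map)
qed

lemma skolem_vector_of_SAUNF:
  assumes S: "SAUNF n m H (map set S)" and eq: "equivalent H G"
  shows "skolem_vector n m G (skolem_of_SAUNF m H S)"
    and "vector_size (skolem_of_SAUNF m H S) =
      m * (2 * (1 + 2 * m + length S * (2 * length H + 2 * m)) + 2)"
proof -
  let ?k = "length S" and ?N = "length H"
  define K where "K t = relabel_true (take (?k - 1 - t) (map set S)) H" for t
  define g where "g t = nth_default (Leaf (Const False)) H (nth_default 0 (nth_default [] S (?k - 1 - t)) 0)" for t
  have "\<forall>j<?k. \<exists>l. lit_var l \<in> outputs m \<and> labeled_by H (set (S ! j)) l"
    using S by (simp add: SAUNF_def)
  then obtain l where lits: "\<And>j. j < ?k \<Longrightarrow> lit_var (l j) \<in> outputs m"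
    "\<And>j. j < ?k \<Longrightarrow> labeled_by H (set (S ! j)) (l j)" by metis
  have H: "circuit_over (inputs n \<union> outputs m) H" using S by (simp add: SAUNF_def)
  have "\<Union>(set (map set S)) \<subseteq> leaves H"
    using lits(2) by (force simp: in_set_conv_nth dest: labeled_by_leaves)
  then have sub: "\<Union>(set (take j (map set S))) \<subseteq> leaves H" for j
    using set_take_subset[of j "map set S"] by blast
  have KH: "circuit_over (inputs n \<union> outputs m) (K t)" for t
    unfolding K_def relabel_true_Union
    by (rule circuit_over_relabel[OF H sub])
  \<comment> \<open>The sets are nonempty and literal-consistent, so the first listed leaf exists
    and carries the right literal.\<close>
  have gl: "g t = Leaf (Lit (l (?k - 1 - t)))" if "t < ?k" for t
  proof -
    let ?L = "S ! (?k - 1 - t)"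
    have "set ?L \<noteq> {}" "set ?L \<subseteq> lit_leaves (l (?k - 1 - t)) H"
      using lits(2)[of "?k - 1 - t"] that by (auto simp: labeled_by_def)
    then have "?L \<noteq> []" "?L ! 0 \<in> lit_leaves (l (?k - 1 - t)) H" by (auto simp: subset_iff)
    moreover have "?k - Suc t < ?k" using that by simp
    ultimately show ?thesis by (simp add: g_def nth_default_def lit_leaves_def)
  qed
  interpret skolem_steps n m ?N ?k K "\<lambda>t. l (?k - 1 - t)" g
    by unfold_locales (use KH gl lits(1) in \<open>auto simp: K_def\<close>)
  have "skolem_array m ?N ?k
      (\<lambda>t. relabel (set (concat (map (nth_default [] S) [0..<?k - 1 - t]))) (Const True) H) g = A"
    unfolding K_def using relabel_true_take[of "?k - 1 - _" S H] by simp
  then have \<Psi>: "skolem_of_SAUNF m H S = map (\<lambda>x. wrap (1 + ?k * B + x) A) [0..<m]"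
    by (simp add: skolem_of_SAUNF_def g_def[abs_def])
  show "vector_size (skolem_of_SAUNF m H S) = m * (2 * (1 + 2 * m + ?k * B) + 2)"
    by (simp add: \<Psi> vector_size_def length_wrap length_array comp_def sum_list_triv)
  have sem: "sem (formula_of (wrap (1 + ?k * B + x) A)) \<sigma> =
      skolem_run m K (\<lambda>t. l (?k - 1 - t)) \<sigma> ?k (Out x)" if "x < m" for x \<sigma>
  proof -
    let ?W = "wrap (1 + ?k * B + x) A"
    have x: "1 + ?k * B + x < length A" using that by (simp add: length_array)
    have "ev ?W (leaf_sem ?W \<sigma>) (root ?W) = ev A (leaf_sem ?W \<sigma>) (1 + ?k * B + x)"
      by (rule ev_wrap[OF x]) (simp add: leaf_sem_def nth_wrap)
    also have "\<dots> = ev A (leaf_sem A \<sigma>) (1 + ?k * B + x)"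
      by (rule ev_cong) (use x in \<open>auto simp: same_gate_def leaf_sem_def nth_wrap\<close>)
    finally show ?thesis using ev_array[of ?k x \<sigma>] that by (simp add: sem_formula_of)
  qed
  show "skolem_vector n m G (skolem_of_SAUNF m H S)"
    unfolding skolem_vector_def
  proof (intro conjI allI ballI)
    show "length (skolem_of_SAUNF m H S) = m" by (simp add: \<Psi>)
    show "circuit_over (inputs n) \<psi>" if "\<psi> \<in> set (skolem_of_SAUNF m H S)" for \<psi>
      using that gates_ok_array by (auto simp: \<Psi> length_array intro!: circuit_over_wrap)
    fix \<sigma>
    let ?\<tau> = "skolem_run m K (\<lambda>t. l (?k - 1 - t)) \<sigma> ?k"
    have other: "?\<tau> x = \<sigma> x" if "x \<notin> outputs m" for x
      using that lits(1) by (intro skolem_run_other[where k = ?k]) auto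
    have "plug_in m (skolem_of_SAUNF m H S) \<sigma> x = ?\<tau> x" for x
      using other[of x] by (cases x) (auto simp: plug_in_def \<Psi> sem[simplified] outputs_def)
    then have plug: "plug_in m (skolem_of_SAUNF m H S) \<sigma> = ?\<tau>" by auto
    \<comment> \<open>All \<open>k\<close> steps together lead to \<open>relabel_true [] H\<close>,
      which is \<open>H\<close>.\<close>
    have "sem (formula_of H) ?\<tau>"
      if "\<forall>x. x \<notin> outputs m \<longrightarrow> \<tau> x = \<sigma> x" "sem (formula_of H) \<tau>" for \<tau>
      using SAUNF_skolem_run[OF S, of ?k l \<tau> \<sigma> ?k] that lits(2)
      by (simp add: K_def[abs_def] relabel_true_def)
    then show "sem (formula_of G) (plug_in m (skolem_of_SAUNF m H S) \<sigma>) \<longleftrightarrow>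
      (\<exists>\<tau>. (\<forall>x. x \<notin> outputs m \<longrightarrow> \<tau> x = \<sigma> x) \<and> sem (formula_of G) \<tau>)"
      unfolding plug using other eq unfolding equivalent_def by auto
  qed
qed

section \<open>SAUNF from Skolem functions\<close>

lemma segment_map_upt: "segment A k (map f [0..<j]) \<Longrightarrow> i < j \<Longrightarrow> A ! (k + i) = f i"
  by (simp add: segment_def)

lemma gates_ok_mono: "gates_ok V k B \<Longrightarrow> V \<subseteq> V' \<Longrightarrow> gates_ok V' k B"
proof -
  have "gate_ok V w g \<Longrightarrow> V \<subseteq> V' \<Longrightarrow> gate_ok V' w g" for w g by (cases g) auto
  then show "gates_ok V k B \<Longrightarrow> V \<subseteq> V' \<Longrightarrow> gates_ok V' k B" by (simp add: gates_ok_def)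
qed

text \<open>\<open>G\<close> occupies the positions below \<open>N\<close>, and \<open>N\<close>
  itself is the true leaf; each earlier \<open>\<psi>\<close> takes two copies, itself and its dual.
  At \<open>i = m\<close> this is the end of all copies.\<close>

definition copies_base :: "nat \<Rightarrow> (nat \<Rightarrow> circuit) \<Rightarrow> nat \<Rightarrow> nat" where
  "copies_base N \<psi> i = N + 1 + 2 * length (concat (map \<psi> [0..<i]))"

text \<open>
  Position \<open>p\<close> starts the values of \<open>\<psi>\<close> and \<open>\<not> \<psi>\<close>, \<open>p + 2 * m\<close> the leaves \<open>x\<^sub>i\<close> and \<open>\<not> x\<^sub>i\<close>, \<open>p + 4 * m\<close> and
  \<open>p + 6 * m\<close> the equivalences \<open>x\<^sub>i \<longleftrightarrow> \<psi>\<^sub>i\<close>, and \<open>p + 7 * m\<close> a copy of \<open>G(\<Psi>(I), I)\<close> with root \<open>K\<close>.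
\<close>

definition SAUNF_array :: "nat \<Rightarrow> circuit \<Rightarrow> (nat \<Rightarrow> circuit) \<Rightarrow> circuit" where
  "SAUNF_array m G \<psi> =
     (let N = length G; p = copies_base N \<psi> m; K = p + 7 * m + N - 1 in
      G @ [Leaf (Const True)] @
      concat (map (\<lambda>i. dual_copies (copies_base N \<psi> i) N 0 0 (\<psi> i)) [0..<m]) @
      map (\<lambda>i. And (copies_base N \<psi> i + length (\<psi> i) - 1) N) [0..<m] @
      map (\<lambda>i. And (copies_base N \<psi> i + 2 * length (\<psi> i) - 1) N) [0..<m] @
      map (\<lambda>i. Leaf (Lit (Pos (Out i)))) [0..<m] @
      map (\<lambda>i. Leaf (Lit (Neg (Out i)))) [0..<m] @
      map (\<lambda>i. And (p + 2 * m + i) (p + i)) [0..<2 * m] @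
      map (\<lambda>i. Or (p + 4 * m + i) (p + 5 * m + i)) [0..<m] @
      map (subst_gate (p + 7 * m) N p (p + m)) G @
      map (\<lambda>i. And (p + 6 * m + i) (K + i)) [0..<m] @
      [Or (K + m) (N - 1)])"

text \<open>\<open>\<psi>\<close> is tied to the list only below \<open>m\<close>: it is later
  instantiated by \<open>nth_default\<close>, since the construction has to be total.\<close>

locale SAUNF_construction =
  fixes n m :: nat and G :: circuit and \<Psi> :: "circuit list" and \<psi> :: "nat \<Rightarrow> circuit"
  assumes G: "circuit_over (inputs n \<union> outputs m) G"
    and skolem: "skolem_vector n m G \<Psi>"
    and \<psi>: "i < m \<Longrightarrow> \<psi> i = \<Psi> ! i"
    and m: "m \<ge> 1"
begin

abbreviation "N \<equiv> length G"
abbreviation "p \<equiv> copies_base N \<psi> m"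
abbreviation "K \<equiv> p + 7 * m + N - 1"
abbreviation "A \<equiv> SAUNF_array m G \<psi>"
abbreviation "L \<equiv> p + 2 * m"

lemma N: "N > 0" using G by (simp add: circuit_over_def)

lemma \<psi>_over: "i < m \<Longrightarrow> circuit_over (inputs n) (\<psi> i)"
  using skolem \<psi> by (auto simp: skolem_vector_def)

lemma \<psi>_nonempty: "i < m \<Longrightarrow> \<psi> i \<noteq> []"
  using \<psi>_over by (auto simp: circuit_over_def)

lemma length_copies:
  "length (concat (map (\<lambda>i. dual_copies (copies_base N \<psi> i) N 0 0 (\<psi> i)) [0..<j])) =
    2 * length (concat (map \<psi> [0..<j]))"
  by (induction j) auto

lemma copies_offset:
  "N + 1 + length (concat (map (\<lambda>i. dual_copies (copies_base N \<psi> i) N 0 0 (\<psi> i)) [0..<j])) =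
    copies_base N \<psi> j"
  unfolding length_copies by (simp add: copies_base_def)

lemma copies_base_mono: "i < m \<Longrightarrow> copies_base N \<psi> i + 2 * length (\<psi> i) \<le> p"
  by (simp add: copies_base_def upt_split[of i m])

lemma N_less_base: "N < copies_base N \<psi> i"
  by (simp add: copies_base_def)

lemma length_array: "length A = K + m + 2"
proof -
  have "length A = N + (1 + (2 * length (concat (map \<psi> [0..<m])) + (7 * m + N + m + 1)))"
    by (simp add: SAUNF_array_def Let_def length_copies)
  also have "\<dots> = p + 7 * m + N + m + 1" unfolding copies_base_def by linarith
  finally show ?thesis using N by linarith
qed

lemma segments:
  "segment A N [Leaf (Const True)]"
  "segment A (N + 1) (concat (map (\<lambda>i. dual_copies (copies_base N \<psi> i) N 0 0 (\<psi> i)) [0..<m]))"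
  "segment A p (map (\<lambda>i. And (copies_base N \<psi> i + length (\<psi> i) - 1) N) [0..<m])"
  "segment A (p + m) (map (\<lambda>i. And (copies_base N \<psi> i + 2 * length (\<psi> i) - 1) N) [0..<m])"
  "segment A L (map (\<lambda>i. Leaf (Lit (Pos (Out i)))) [0..<m])"
  "segment A (L + m) (map (\<lambda>i. Leaf (Lit (Neg (Out i)))) [0..<m])"
  "segment A (p + 4 * m) (map (\<lambda>i. And (p + 2 * m + i) (p + i)) [0..<2 * m])"
  "segment A (p + 6 * m) (map (\<lambda>i. Or (p + 4 * m + i) (p + 5 * m + i)) [0..<m])"
  "segment A (p + 7 * m) (map (subst_gate (p + 7 * m) N p (p + m)) G)"
  "segment A (p + 7 * m + N) (map (\<lambda>i. And (p + 6 * m + i) (K + i)) [0..<m])"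
  "segment A (p + 7 * m + N + m) [Or (K + m) (N - 1)]"
proof -
  have eqs: "N + 1 + 2 * length (concat (map \<psi> [0..<m])) = p" "0 + N = N" "N + length [x] = N + 1"
    "p + m + m = L" "L + m + m = p + 4 * m" "p + 4 * m + 2 * m = p + 6 * m"
    "p + 6 * m + m = p + 7 * m" for x :: gate
    using N by (simp_all add: copies_base_def)
  have *: "segment A 0 X" if "A = X" for X
    using that segment_refl[of A] by simp
  show "segment A N [Leaf (Const True)]"
  "segment A (N + 1) (concat (map (\<lambda>i. dual_copies (copies_base N \<psi> i) N 0 0 (\<psi> i)) [0..<m]))"
  "segment A p (map (\<lambda>i. And (copies_base N \<psi> i + length (\<psi> i) - 1) N) [0..<m])"
  "segment A (p + m) (map (\<lambda>i. And (copies_base N \<psi> i + 2 * length (\<psi> i) - 1) N) [0..<m])"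
  "segment A L (map (\<lambda>i. Leaf (Lit (Pos (Out i)))) [0..<m])"
  "segment A (L + m) (map (\<lambda>i. Leaf (Lit (Neg (Out i)))) [0..<m])"
  "segment A (p + 4 * m) (map (\<lambda>i. And (p + 2 * m + i) (p + i)) [0..<2 * m])"
  "segment A (p + 6 * m) (map (\<lambda>i. Or (p + 4 * m + i) (p + 5 * m + i)) [0..<m])"
  "segment A (p + 7 * m) (map (subst_gate (p + 7 * m) N p (p + m)) G)"
  "segment A (p + 7 * m + N) (map (\<lambda>i. And (p + 6 * m + i) (K + i)) [0..<m])"
  "segment A (p + 7 * m + N + m) [Or (K + m) (N - 1)]"
    by (insert *[OF SAUNF_array_def, unfolded Let_def segment_append length_map length_upt diff_zero
          length_copies eqs], (elim conjE, assumption)+)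
qed

text \<open>\<open>K\<close> is the last gate of the substituted copy. As \<open>N > 0\<close>,
  truncated subtraction does no harm and \<open>K + 1 = p + 7 * m + N\<close>.\<close>

lemma segments_K:
  "segment A (K + 1) (map (\<lambda>i. And (p + 6 * m + i) (K + i)) [0..<m])"
  "segment A (K + 1 + m) [Or (K + m) (N - 1)]"
  by (rule back_subst[of "\<lambda>k. segment A k _", OF segments(10)], use N in linarith)
    (rule back_subst[of "\<lambda>k. segment A k _", OF segments(11)], use N in linarith)

lemma gates_ok_copies:
  "gates_ok (inputs n) (N + 1) (concat (map (\<lambda>i. dual_copies (copies_base N \<psi> i) N 0 0 (\<psi> i)) [0..<m]))"
proof (rule gates_ok_concat)
  fix i assume "i < m"
  then have "gates_ok (inputs n) (copies_base N \<psi> i) (dual_copies (copies_base N \<psi> i) N 0 0 (\<psi> i))"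
    using N_less_base by (intro gates_ok_dual_copies[OF circuit_over_gates_ok[OF \<psi>_over]])
      (auto simp: inputs_def)
  then show "gates_ok (inputs n) (N + 1 + length (concat (map
    (\<lambda>i. dual_copies (copies_base N \<psi> i) N 0 0 (\<psi> i)) [0..<i]))) (dual_copies (copies_base N \<psi> i) N 0 0 (\<psi> i))"
    unfolding copies_offset .
qed

lemma gates_ok_subst_copy:
  "gates_ok (inputs n) (p + 7 * m) (map (subst_gate (p + 7 * m) N p (p + m)) G)"
  using N_less_base[of m] by (intro gates_ok_subst[OF circuit_over_gates_ok[OF G] order.refl])
    (auto simp: inputs_def outputs_def)

lemma gates_ok_array: "gates_ok (inputs n \<union> outputs m) 0 A"
proof -
  have 1: "gates_ok (inputs n \<union> outputs m) (N + 1)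
      (concat (map (\<lambda>i. dual_copies (copies_base N \<psi> i) N 0 0 (\<psi> i)) [0..<m]))"
    by (rule gates_ok_mono[OF gates_ok_copies]) simp
  have pN: "N < p" by (rule N_less_base)
  have 2: "gates_ok (inputs n \<union> outputs m) (p + 7 * m) (map (subst_gate (p + 7 * m) N p (p + m)) G)"
    by (rule gates_ok_mono[OF gates_ok_subst_copy]) simp
  have 3: "gates_ok (inputs n \<union> outputs m) p (map (\<lambda>i. And (copies_base N \<psi> i + length (\<psi> i) - 1) N) [0..<m])"
    "gates_ok (inputs n \<union> outputs m) (p + m) (map (\<lambda>i. And (copies_base N \<psi> i + 2 * length (\<psi> i) - 1) N) [0..<m])"
    unfolding gates_ok_map_upt
  proof safe
    fix i assume i: "i < m"
    have "0 < length (\<psi> i)" using \<psi>_nonempty[OF i] by simp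
    then show "gate_ok (inputs n \<union> outputs m) (p + i) (And (copies_base N \<psi> i + length (\<psi> i) - 1) N)"
      "gate_ok (inputs n \<union> outputs m) (p + m + i) (And (copies_base N \<psi> i + 2 * length (\<psi> i) - 1) N)"
      using copies_base_mono[OF i] N_less_base[of i] pN unfolding gate_ok.simps by linarith+
  qed
  have 4: "gates_ok (inputs n \<union> outputs m) L (map (\<lambda>i. Leaf (Lit (Pos (Out i)))) [0..<m])"
    "gates_ok (inputs n \<union> outputs m) (L + m) (map (\<lambda>i. Leaf (Lit (Neg (Out i)))) [0..<m])"
    "gates_ok (inputs n \<union> outputs m) (p + 4 * m) (map (\<lambda>i. And (p + 2 * m + i) (p + i)) [0..<2 * m])"
    "gates_ok (inputs n \<union> outputs m) (p + 6 * m) (map (\<lambda>i. Or (p + 4 * m + i) (p + 5 * m + i)) [0..<m])"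
    "gates_ok (inputs n \<union> outputs m) (p + 7 * m + N + m) [Or (K + m) (N - 1)]"
    using N pN m by (auto simp: gates_ok_map_upt gates_ok_def outputs_def)
  have 6:
    "gates_ok (inputs n \<union> outputs m) (p + 7 * m + N) (map (\<lambda>i. And (p + 6 * m + i) (K + i)) [0..<m])"
    unfolding gates_ok_map_upt gate_ok.simps using N by (intro allI impI conjI) linarith+
  have 5: "gates_ok (inputs n \<union> outputs m) 0 G" "gates_ok (inputs n \<union> outputs m) N [Leaf (Const True)]"
    using circuit_over_gates_ok[OF G] by (simp_all add: gates_ok_def)
  have eqs: "N + 1 + 2 * length (concat (map \<psi> [0..<m])) = p" "0 + N = N" "N + length [x] = N + 1"
    "p + m + m = L" "L + m + m = p + 4 * m" "p + 4 * m + 2 * m = p + 6 * m"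
    "p + 6 * m + m = p + 7 * m" for x :: gate
    using N by (simp_all add: copies_base_def)
  show ?thesis
    unfolding SAUNF_array_def Let_def gates_ok_append length_map length_upt diff_zero length_copies eqs
    using 1 2 3 4 5 6 by blast
qed

text \<open>The covered positions are the true leaf, the copies of \<open>\<psi>\<close> and the
  substituted copy of \<open>G\<close>. No output literal survives there, so realizing an output
  literal does not affect them.\<close>

lemma leaf_over_inputs:
  assumes "A ! w = Leaf b" "N \<le> w \<and> w < p \<or> p + 7 * m \<le> w \<and> w < p + 7 * m + N"
  shows "label_vars b \<subseteq> inputs n"
proof -
  have *: "label_vars b \<subseteq> V" if "segment A k B" "gates_ok V k B" "k \<le> w" "w < k + length B" for V k B
  proof -
    have "A ! w = B ! (w - k)" using segment_nth[OF that(1), of "w - k"] that(3,4) by simp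
    moreover have "gate_ok V w (B ! (w - k))"
      using that(2-4) unfolding gates_ok_def by (auto dest: spec[of _ "w - k"])
    ultimately show ?thesis using assms(1) by (metis gate_ok.simps(1))
  qed
  consider "w = N" | "N + 1 \<le> w" "w < p" | "p + 7 * m \<le> w" "w < p + 7 * m + N"
    using assms(2) by linarith
  then show ?thesis
  proof cases
    case 1
    then show ?thesis using segment_nth[OF segments(1), of 0] assms(1) by auto
  next
    case 2
    then show ?thesis
      by (intro *[OF segments(2) gates_ok_copies, unfolded copies_offset])
  next
    case 3
    then show ?thesis by (intro *[OF segments(9) gates_ok_subst_copy]) simp_all
  qed
qed

text \<open>Once the value of \<open>\<psi> i\<close> is known, each displayed equivalence just
  selects one of its two leaves. The valuation \<open>f\<close> stays free on the original copy of
  \<open>G\<close> and on these leaves, so the same formula serves satisfaction, relabeling and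
  realization.\<close>

lemma ev_array:
  assumes f: "\<And>w b. A ! w = Leaf b \<Longrightarrow> N \<le> w \<and> w < p \<or> p + 7 * m \<le> w \<and> w < p + 7 * m + N \<Longrightarrow> f w = label_sem b \<tau>"
  shows "ev A f (K + m + 1) \<longleftrightarrow> ev G f (root G) \<or>
    sem (formula_of G) (plug_in m \<Psi> \<tau>) \<and>
    (\<forall>i<m. if sem (formula_of (\<Psi> ! i)) \<tau> then f (L + i) else f (L + m + i))"
proof -
  let ?Y = "\<lambda>i. sem (formula_of (\<psi> i)) \<tau>"
  have pN: "N < p" by (rule N_less_base)
  have true: "ev A f N"
    using segment_nth[OF segments(1), of 0] f[of N "Const True"] pN by (simp add: ev_Leaf)
  have Y: "ev A f (p + i) = ?Y i \<and> ev A f (p + m + i) = (\<not> ?Y i)" if i: "i < m" for i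
  proof -
    let ?b = "copies_base N \<psi> i"
    have "segment A ?b (dual_copies ?b N 0 0 (\<psi> i))"
      using segment_concat[OF segments(2) i] unfolding copies_offset .
    moreover have "f (?b + w) = label_sem b \<tau>" if "w < 2 * length (\<psi> i)" "A ! (?b + w) = Leaf b" for w b
      using f[OF that(2)] that(1) copies_base_mono[OF i] N_less_base[of i] by simp
    ultimately have c: "ev A f (?b + length (\<psi> i) - 1) = ?Y i" "ev A f (?b + 2 * length (\<psi> i) - 1) = (\<not> ?Y i)"
      using ev_dual_copies[OF _ circuit_over_gates_ok[OF \<psi>_over[OF i]] _ N_less_base true _ \<psi>_nonempty[OF i],
          of i 0 0 \<tau>] by (auto simp: inputs_def)
    have len: "0 < length (\<psi> i)" using \<psi>_nonempty[OF i] by simp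
    have "ev A f (p + i) = (ev A f (?b + length (\<psi> i) - 1) \<and> ev A f N)"
      by (rule ev_And[OF segment_map_upt[OF segments(3) i]])
        (use len copies_base_mono[OF i] pN in linarith)+
    moreover have "ev A f (p + m + i) = (ev A f (?b + 2 * length (\<psi> i) - 1) \<and> ev A f N)"
      by (rule ev_And[OF segment_map_upt[OF segments(4) i]])
        (use len copies_base_mono[OF i] pN in linarith)+
    ultimately show ?thesis using c true by simp
  qed
  have plug: "plug_in m \<Psi> \<tau> (Out i) = ?Y i" if "i < m" for i
    using that \<psi> by (simp add: plug_in_def)
  have R: "ev A f K = sem (formula_of G) (plug_in m \<Psi> \<tau>)"
  proof -
    have "ev A f (p + 7 * m + root G) = sem (formula_at G (root G)) (plug_in m \<Psi> \<tau>)"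
    proof (rule ev_subst[OF segments(9) circuit_over_gates_ok[OF G]])
      fix x assume "Out x \<in> inputs n \<union> outputs m"
      then have "x < m" by (auto simp: inputs_def outputs_def)
      then show "p + x < p + 7 * m \<and> p + m + x < p + 7 * m \<and>
        ev A f (p + x) = plug_in m \<Psi> \<tau> (Out x) \<and> ev A f (p + m + x) = (\<not> plug_in m \<Psi> \<tau> (Out x))"
        using Y plug by simp
    next
      fix w b assume w: "w < N" "A ! (p + 7 * m + w) = Leaf b"
      then have "label_vars b \<subseteq> inputs n" by (intro leaf_over_inputs[OF w(2)]) simp
      then have "label_sem b (plug_in m \<Psi> \<tau>) = label_sem b \<tau>"
        by (cases "(b, \<tau>)" rule: label_sem.cases) (auto simp: plug_in_def inputs_def)
      then show "f (p + 7 * m + w) = label_sem b (plug_in m \<Psi> \<tau>)"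
        using f[OF w(2)] w(1) by simp
    qed (use pN true N in \<open>auto simp: root_def\<close>)
    then show ?thesis using N by (simp add: root_def formula_of_def)
  qed
  have E: "ev A f (p + 4 * m + i) = (f (L + i) \<and> ?Y i) \<and>
      ev A f (p + 5 * m + i) = (f (L + m + i) \<and> \<not> ?Y i)" if i: "i < m" for i
  proof -
    have "ev A f (p + 4 * m + i) = (ev A f (L + i) \<and> ev A f (p + i))"
      using i by (intro ev_And[OF segment_map_upt[OF segments(7)]]) auto
    moreover have "ev A f (L + i) = f (L + i)"
      by (rule ev_Leaf[OF segment_map_upt[OF segments(5) i]])
    moreover have "ev A f (p + 4 * m + (m + i)) = (ev A f (L + (m + i)) \<and> ev A f (p + (m + i)))"
      using i by (intro ev_And[OF segment_map_upt[OF segments(7)]]) auto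
    moreover have "ev A f (L + m + i) = f (L + m + i)"
      by (rule ev_Leaf[OF segment_map_upt[OF segments(6) i]])
    moreover have "p + 4 * m + (m + i) = p + 5 * m + i" by simp
    ultimately show ?thesis using Y[OF i] by (simp add: add.assoc)
  qed
  have O: "ev A f (p + 6 * m + i) = (if ?Y i then f (L + i) else f (L + m + i))" if i: "i < m" for i
  proof -
    have "ev A f (p + 6 * m + i) = (ev A f (p + 4 * m + i) \<or> ev A f (p + 5 * m + i))"
      using i by (intro ev_Or[OF segment_map_upt[OF segments(8)]]) auto
    then show ?thesis using E[OF i] by auto
  qed
  \<comment> \<open>Gate \<open>K + i\<close> conjoins the substituted copy with the first
    \<open>i\<close> equivalences.\<close>
  have chain: "ev A f (K + i) \<longleftrightarrow> ev A f K \<and> (\<forall>j<i. if ?Y j then f (L + j) else f (L + m + j))"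
    if "i \<le> m" for i
    using that
  proof (induction i)
    case (Suc i)
    then have i: "i < m" by simp
    have "ev A f (K + 1 + i) = (ev A f (p + 6 * m + i) \<and> ev A f (K + i))"
      using i N by (intro ev_And[OF segment_map_upt[OF segments_K(1)]]) auto
    then show ?case using Suc O[OF i] by (auto simp: less_Suc_eq)
  qed simp
  have "ev A f (K + 1 + m) = (ev A f (K + m) \<or> ev A f (N - 1))"
  proof (rule ev_Or)
    show "A ! (K + 1 + m) = Or (K + m) (N - 1)"
      using segment_nth[OF segments_K(2), of 0] by simp
  qed (use N in linarith)+
  moreover have "ev A f (N - 1) = ev G f (root G)"
    using N by (simp add: SAUNF_array_def Let_def ev_append root_def)
  ultimately show ?thesis
    using chain[of m] R \<psi> by (auto simp: ac_simps)
qed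

end

text \<open>No disjunct depends on both \<open>a\<close> and \<open>b\<close>. One that is true at
  \<open>(True, True)\<close> remains true when a variable it does not depend on becomes false,
  whereas \<open>a \<and> b\<close> does not.\<close>

lemma and_not_separable:
  assumes "\<And>a b. a \<and> b \<longleftrightarrow> P b \<or> Q \<and> (if y then (if c then a else True) else (if c then b else a))"
  shows False
  using assms[of False False] assms[of False True] assms[of True False] assms[of True True]
  by (cases y; cases c) auto

section \<open>Unrealizability of the leaf singletons, and equivalence with \<open>G\<close>\<close>

context SAUNF_construction
begin

abbreviation "H \<equiv> wrap (K + m + 1) A"
abbreviation "H_upto j \<equiv> relabel {L..<L + j} (Const True) H"

lemma L_less: "N \<le> L" "L + 2 * m < length A" "p \<le> L" "L + 2 * m \<le> p + 7 * m"
  using N_less_base[of m] N by (simp_all add: length_array)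

lemma H_G: "v < N \<Longrightarrow> wrap t A ! v = G ! v"
  using L_less by (simp add: nth_wrap(1)) (simp add: SAUNF_array_def Let_def nth_append)

lemma H_leaves: "i < m \<Longrightarrow> wrap t A ! (L + i) = Leaf (Lit (Pos (Out i)))"
  "i < m \<Longrightarrow> wrap t A ! (L + m + i) = Leaf (Lit (Neg (Out i)))"
  using L_less segment_map_upt[OF segments(5), of i] segment_map_upt[OF segments(6), of i]
  by (simp_all add: nth_wrap(1))

lemma leaves_H:
  assumes "j \<le> 2 * m"
  shows "{L..<L + j} \<subseteq> leaves H"
proof
  fix v assume v: "v \<in> {L..<L + j}"
  have "\<exists>b. H ! v = Leaf b"
  proof (cases "v < L + m")
    case True
    then show ?thesis using v H_leaves(1)[of "v - L"] by auto
  next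
    case False
    then show ?thesis using v assms H_leaves(2)[of "v - (L + m)"] by auto
  qed
  then show "v \<in> leaves H" using v L_less assms by (simp add: leaves_def length_wrap)
qed

lemma ev_H_upto:
  assumes j: "j \<le> 2 * m" and F: "\<not> f (length A)"
    and f: "\<And>w b. A ! w = Leaf b \<Longrightarrow> N \<le> w \<and> w < p \<or> p + 7 * m \<le> w \<and> w < p + 7 * m + N \<Longrightarrow> f w = label_sem b \<tau>"
  shows "ev (H_upto j) f (root (H_upto j)) \<longleftrightarrow> ev G f (root G) \<or>
    sem (formula_of G) (plug_in m \<Psi> \<tau>) \<and>
    (\<forall>i<m. if sem (formula_of (\<Psi> ! i)) \<tau> then f (L + i) else f (L + m + i))"
proof -
  have "root H < length H" by (simp add: root_wrap length_wrap)
  then have "ev (H_upto j) f (root H) = ev H f (root H)"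
    using leaves_H[OF j] by (intro ev_cong) (auto simp: nth_relabel same_gate_def leaves_def)
  also have "\<dots> = ev A f (K + m + 1)"
    using F by (intro ev_wrap) (simp_all add: length_array)
  finally show ?thesis using ev_array[OF f] by simp
qed

text \<open>In the realization only \<open>w'\<close> enters the original copy of \<open>G\<close>,
  the values of \<open>\<Psi>\<close> depend on fixed inputs, and the equivalence for output
  \<open>i0\<close> selects a single leaf. This is the form excluded by
  \<open>and_not_separable\<close>.\<close>

lemma unrealizable:
  assumes j: "j < 2 * m"
  shows "and_unrealizable_set n m (H_upto j) {L + j}"
proof
  let ?V = "inputs n \<union> outputs m" and ?H = "H_upto j"
  \<comment> \<open>Indices below \<open>m\<close> are the positive leaves, those from
    \<open>m\<close> on the negative ones; \<open>i0\<close> is the output concerned.\<close>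
  define i0 where "i0 = (if j < m then j else j - m)"
  define l where "l = (if j < m then Pos (Out i0) else Neg (Out i0))"
  have i0: "i0 < m" using j by (auto simp: i0_def)
  have nth: "?H ! w = A ! w" if "w < length A" "w \<notin> {L..<L + j}" for w
    using that by (auto simp: nth_relabel length_wrap nth_wrap(1))
  have nthG: "?H ! v = G ! v" if "v < N" for v
    using that L_less by (simp add: nth_relabel length_wrap H_G)
  have pos: "?H ! (L + i) = (if i < j then Leaf (Const True) else Leaf (Lit (Pos (Out i))))" if "i < m" for i
    using that L_less H_leaves(1)[OF that] by (simp add: nth_relabel length_wrap)
  have neg: "?H ! (L + m + i) = (if m + i < j then Leaf (Const True) else Leaf (Lit (Neg (Out i))))" if "i < m" for i
    using that L_less H_leaves(2)[OF that] by (simp add: nth_relabel length_wrap)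
  have lv: "lit_var l = Out i0" by (simp add: l_def)
  have "?H ! (L + j) = Leaf (Lit l)"
  proof (cases "j < m")
    case True
    then show ?thesis using pos[of j] by (simp add: l_def i0_def)
  next
    case False
    then have "L + m + (j - m) = L + j" "j - m < m" "m + (j - m) = j" using j by simp_all
    then show ?thesis using neg[of "j - m"] False by (metis i0_def l_def less_irrefl)
  qed
  then have lab: "labeled_by ?H {L + j} l"
    using L_less j by (simp add: labeled_by_def lit_leaves_def length_wrap)
  assume "and_realizable_set n m ?H {L + j}"
  then obtain \<sigma> where dom: "dom \<sigma> = ?V - {Out i0}"
    and \<sigma>: "\<And>\<tau>. sem_under (formula_of (realization ?H {L + j} l)) \<sigma> \<tau> \<longleftrightarrow> \<tau> W \<and> \<tau> W'"
    unfolding and_realizable_set_iff[OF lab] lv by blast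
  define \<rho> where "\<rho> a b = (\<lambda>x. case \<sigma> x of Some c \<Rightarrow> c | None \<Rightarrow> ((\<lambda>_. False)(W := a, W' := b)) x)" for a b
  define f where "f a b = realization_leaf ?H {L + j} l (\<rho> a b)" for a b
  have ne: "?H \<noteq> []" by (simp add: relabel_def length_wrap flip: length_greater_0_conv)
  have F: "ev ?H (f a b) (root ?H) \<longleftrightarrow> a \<and> b" for a b
    using \<sigma>[of "(\<lambda>_. False)(W := a, W' := b)"] unfolding sem_under_def sem_realization[OF ne] f_def \<rho>_def
    by simp
  have "W \<notin> dom \<sigma>" "W' \<notin> dom \<sigma>" unfolding dom by (auto simp: inputs_def outputs_def)
  then have \<rho>W: "\<rho> a b W = a" "\<rho> a b W' = b" for a b
    by (simp_all add: \<rho>_def domIff)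
  have \<rho>_eq: "\<rho> a b x = \<rho> a' b' x" if x: "x \<in> ?V" "x \<noteq> Out i0" for a b a' b' x
  proof -
    have "x \<in> dom \<sigma>" using x dom by simp
    then show ?thesis by (auto simp: \<rho>_def)
  qed
  have lab_eq: "label_sem c (\<rho> a b) = label_sem c (\<rho> a' b')"
    if "label_vars c \<subseteq> ?V" "c \<noteq> Lit l" "c \<noteq> Lit (negate l)" for c a b a' b'
  proof (cases c)
    case (Lit l')
    have "lit_var l' \<noteq> Out i0"
      using that(2,3) unfolding Lit l_def by (cases l') (auto split: if_splits)
    then have "\<rho> a b (lit_var l') = \<rho> a' b' (lit_var l')"
      using that(1) by (intro \<rho>_eq) (auto simp: Lit)
    then show ?thesis unfolding Lit by (cases l') auto
  qed simp
  \<comment> \<open>Inputs lie in the domain of \<open>\<sigma>\<close>, so \<open>R\<close> and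
    \<open>Y\<close> do not depend on the chosen pair; both are evaluated at two false
    values.\<close>
  define R where "R \<longleftrightarrow> sem (formula_of G) (plug_in m \<Psi> (\<rho> False False))"
  define Y where "Y i \<longleftrightarrow> sem (formula_of (\<Psi> ! i)) (\<rho> False False)" for i
  have main: "ev ?H (f a b) (root ?H) \<longleftrightarrow> ev G (f a b) (root G) \<or>
      R \<and> (\<forall>i<m. if Y i then f a b (L + i) else f a b (L + m + i))" for a b
    unfolding R_def Y_def
  proof (rule ev_H_upto)
    have "?H ! length A = Leaf (Const False)"
      using L_less j by (simp add: nth_relabel length_wrap nth_wrap)
    then show "\<not> f a b (length A)"
      by (simp add: f_def realization_leaf_def leaf_sem_def)
    fix w c assume w: "A ! w = Leaf c" "N \<le> w \<and> w < p \<or> p + 7 * m \<le> w \<and> w < p + 7 * m + N"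
    have c: "label_vars c \<subseteq> inputs n" by (rule leaf_over_inputs[OF w])
    have "w < length A" "w \<notin> {L..<L + j}" using w(2) L_less j by (auto simp: length_array)
    then have "?H ! w = Leaf c" using w(1) nth by simp
    moreover have "c \<noteq> Lit l" "c \<noteq> Lit (negate l)"
      using c by (auto simp: lv inputs_def)
    ultimately show "f a b w = label_sem c (\<rho> False False)"
      using c lab_eq[of c a b False False] by (auto simp: f_def realization_leaf_def leaf_sem_def)
  qed (use j in simp)
  \<comment> \<open>The single leaf carrying \<open>w\<close> lies outside the original copy of
    \<open>G\<close>, whose \<open>l\<close>-leaves are all false.\<close>
  have g: "ev G (f False b) (root G) = ev G (f True b) (root G)" for b
  proof (rule ev_cong)
    fix v c assume v: "v \<le> root G" "G ! v = Leaf c"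
    then have vN: "v < N" using root_less[of G] N by auto
    then have "label_vars c \<subseteq> ?V"
      using G v(2) unfolding circuit_over_def by (metis gate_ok.simps(1))
    moreover have "?H ! v = Leaf c" "v \<noteq> L + j" using nthG[OF vN] v(2) vN L_less by auto
    ultimately show "f False b v = f True b v"
      using lab_eq[of c False b True b] by (auto simp: f_def realization_leaf_def leaf_sem_def \<rho>W)
  qed (simp add: same_gate_def)
  have other: "f a b (L + i) = f False False (L + i) \<and> f a b (L + m + i) = f False False (L + m + i)"
    if i: "i < m" "i \<noteq> i0" for a b i
  proof -
    have *: "f a b w = f False False w" if w: "?H ! w = Leaf c" "label_vars c \<subseteq> {Out i}" for w c
    proof -
      have "c \<noteq> Lit l" "c \<noteq> Lit (negate l)" using w(2) i(2) lv by auto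
      moreover have "label_vars c \<subseteq> ?V" using w(2) i(1) by (auto simp: outputs_def)
      ultimately show ?thesis using w(1) lab_eq[of c a b False False]
        by (simp add: f_def realization_leaf_def leaf_sem_def)
    qed
    show ?thesis using *[of "L + i"] *[of "L + m + i"] pos[OF i(1)] neg[OF i(1)] by (auto split: if_splits)
  qed
  \<comment> \<open>For \<open>j \<ge> m\<close> the positive leaf of \<open>i0\<close> has been
    relabeled true earlier, hence the constant, and the negative leaf is the one carrying
    \<open>w\<close>.\<close>
  have vals: "f a b (L + i0) = (if j < m then a else True)" "f a b (L + m + i0) = (if j < m then b else a)" for a b
    using pos[OF i0] neg[OF i0] j
    by (auto simp: f_def realization_leaf_def leaf_sem_def \<rho>W l_def i0_def)
  define D where "D a b i \<longleftrightarrow> (if Y i then f a b (L + i) else f a b (L + m + i))" for a b i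
  define rest where "rest \<longleftrightarrow> (\<forall>i<m. i \<noteq> i0 \<longrightarrow> D False False i)"
  have "D a b i = D False False i" if "i < m" "i \<noteq> i0" for a b i
    unfolding D_def by (simp only: other[OF that, of a b])
  then have D: "(\<forall>i<m. D a b i) \<longleftrightarrow> rest \<and> D a b i0" for a b
    unfolding rest_def using i0 by blast
  have D_i0: "D a b i0 \<longleftrightarrow> (if Y i0 then (if j < m then a else True) else (if j < m then b else a))" for a b
    unfolding D_def vals ..
  have main': "a \<and> b \<longleftrightarrow> ev G (f a b) (root G) \<or> R \<and> (\<forall>i<m. D a b i)" for a b
    using main[of a b] unfolding F D_def .
  have g': "ev G (f a b) (root G) = ev G (f True b) (root G)" for a b
    by (cases a) (simp_all only: g)
  have "a \<and> b \<longleftrightarrow> ev G (f True b) (root G) \<or>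
      (R \<and> rest) \<and> (if Y i0 then (if j < m then a else True) else (if j < m then b else a))" for a b
    using main'[of a b] unfolding D D_i0 g'[of a b] conj_assoc .
  then show False by (rule and_not_separable)
qed

text \<open>If every \<open>\<psi> i\<close> equals output \<open>i\<close>, then
  \<open>plug_in\<close> changes nothing, so the second disjunct implies \<open>G\<close>. With all
  displayed leaves true the equivalences disappear.\<close>

lemma sem_H:
  "sem (formula_of H) \<tau> \<longleftrightarrow> sem (formula_of G) \<tau>"
  "sem (formula_of (H_upto (2 * m))) \<tau> \<longleftrightarrow>
    sem (formula_of G) \<tau> \<or> sem (formula_of G) (plug_in m \<Psi> \<tau>)"
proof -
  have nth: "H_upto j ! w = A ! w" if "w < length A" "w \<notin> {L..<L + j}" for w j
    using that by (auto simp: nth_relabel length_wrap nth_wrap(1))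
  have *: "sem (formula_of (H_upto j)) \<tau> \<longleftrightarrow> sem (formula_of G) \<tau> \<or>
    sem (formula_of G) (plug_in m \<Psi> \<tau>) \<and> (\<forall>i<m. if sem (formula_of (\<Psi> ! i)) \<tau>
      then leaf_sem (H_upto j) \<tau> (L + i) else leaf_sem (H_upto j) \<tau> (L + m + i))"
    if j: "j \<le> 2 * m" for j
  proof -
    have G: "ev G (leaf_sem (H_upto j) \<tau>) (root G) = sem (formula_of G) \<tau>"
      unfolding sem_formula_of
    proof (rule ev_cong)
      fix v assume "v \<le> root G"
      then have "v < N" using root_less[of G] N by auto
      then show "leaf_sem (H_upto j) \<tau> v = leaf_sem G \<tau> v"
        using L_less by (simp add: leaf_sem_def nth_relabel length_wrap H_G)
    qed (simp add: same_gate_def)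
    show ?thesis
      unfolding sem_formula_of[of "H_upto j"] G[symmetric]
    proof (rule ev_H_upto[OF j])
      have "H_upto j ! length A = Leaf (Const False)"
        using L_less j by (simp add: nth_relabel length_wrap nth_wrap)
      then show "\<not> leaf_sem (H_upto j) \<tau> (length A)" by (simp add: leaf_sem_def)
      fix w b assume w: "A ! w = Leaf b" "N \<le> w \<and> w < p \<or> p + 7 * m \<le> w \<and> w < p + 7 * m + N"
      then have "w < length A" "w \<notin> {L..<L + j}" using L_less j by (auto simp: length_array)
      then show "leaf_sem (H_upto j) \<tau> w = label_sem b \<tau>" using nth w(1) by (simp add: leaf_sem_def)
    qed
  qed
  have "H_upto 0 = H" by (simp add: relabel_empty)
  moreover have "leaf_sem H \<tau> (L + i) = \<tau> (Out i)" "leaf_sem H \<tau> (L + m + i) = (\<not> \<tau> (Out i))" if "i < m" for i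
    using H_leaves[OF that] by (simp_all add: leaf_sem_def)
  ultimately have "sem (formula_of H) \<tau> \<longleftrightarrow> sem (formula_of G) \<tau> \<or>
    sem (formula_of G) (plug_in m \<Psi> \<tau>) \<and> (\<forall>i<m. sem (formula_of (\<Psi> ! i)) \<tau> = \<tau> (Out i))"
    using *[of 0] by auto
  moreover have "plug_in m \<Psi> \<tau> = \<tau>" if "\<forall>i<m. sem (formula_of (\<Psi> ! i)) \<tau> = \<tau> (Out i)"
    using that by (auto simp: plug_in_def fun_eq_iff split: var.split)
  ultimately show "sem (formula_of H) \<tau> \<longleftrightarrow> sem (formula_of G) \<tau>" by auto
  have "leaf_sem (H_upto (2 * m)) \<tau> (L + i)" "leaf_sem (H_upto (2 * m)) \<tau> (L + m + i)" if "i < m" for i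
    using that L_less by (simp_all add: leaf_sem_def nth_relabel length_wrap)
  with *[of "2 * m"] show "sem (formula_of (H_upto (2 * m))) \<tau> \<longleftrightarrow>
    sem (formula_of G) \<tau> \<or> sem (formula_of G) (plug_in m \<Psi> \<tau>)" by simp
qed

abbreviation "S \<equiv> map (\<lambda>i. [L + i]) [0..<2 * m]"

lemma relabel_true_S: "j \<le> 2 * m \<Longrightarrow> relabel_true (take j (map set S)) H = H_upto j"
proof -
  assume "j \<le> 2 * m"
  then have "set (take j (map set S)) = (\<lambda>i. {L + i}) ` {0..<j}"
    by (simp add: take_map take_upt comp_def)
  moreover have "(\<Union>i\<in>{0..<j}. {L + i}) = {L..<L + j}"
    using image_add_atLeastLessThan[of L 0 j] unfolding UNION_singleton_eq_range
    by (simp add: add.commute)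
  ultimately show ?thesis by (simp add: relabel_true_Union)
qed

lemma SAUNF_H: "SAUNF n m H (map set S)"
  unfolding SAUNF_def
proof (intro conjI)
  show "circuit_over (inputs n \<union> outputs m) H"
    using gates_ok_array by (rule circuit_over_wrap) (simp add: length_array)
  show "map set S \<noteq> []" using m by simp
  show "\<forall>i<length (map set S). \<forall>j<length (map set S). i \<noteq> j \<longrightarrow> map set S ! i \<inter> map set S ! j = {}"
    by simp
  show "\<forall>j<length (map set S). \<exists>l. lit_var l \<in> outputs m \<and> labeled_by H (map set S ! j) l"
  proof (intro allI impI)
    fix j assume "j < length (map set S)"
    then have j: "j < 2 * m" by simp
    show "\<exists>l. lit_var l \<in> outputs m \<and> labeled_by H (map set S ! j) l"
    proof (cases "j < m")
      case True
      then show ?thesis using H_leaves(1)[of j] L_less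
        by (intro exI[of _ "Pos (Out j)"]) (simp add: labeled_by_def lit_leaves_def outputs_def length_wrap)
    next
      case False
      then have "L + m + (j - m) = L + j" by simp
      then have "H ! (L + j) = Leaf (Lit (Neg (Out (j - m))))"
        using H_leaves(2)[of "j - m"] False j by (metis less_diff_conv2 linorder_not_less mult_2)
      then show ?thesis using L_less False j
        by (intro exI[of _ "Neg (Out (j - m))"]) (simp add: labeled_by_def lit_leaves_def outputs_def length_wrap)
    qed
  qed
  show "\<forall>j<length (map set S). and_unrealizable_set n m (relabel_true (take j (map set S)) H) (map set S ! j)"
  proof (intro allI impI)
    fix j assume "j < length (map set S)"
    then have j: "j < 2 * m" by simp
    then have nth: "map set S ! j = {L + j}" by simp
    show "and_unrealizable_set n m (relabel_true (take j (map set S)) H) (map set S ! j)"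
      unfolding relabel_true_S[OF less_imp_le[OF j]] nth by (rule unrealizable[OF j])
  qed
  have "relabel_true (map set S) H = H_upto (2 * m)"
    using relabel_true_S[of "2 * m"] by simp
  \<comment> \<open>The Skolem property turns \<open>G \<or> G(\<Psi>)\<close> into
    \<open>\<exists>X. G\<close>, whose value is independent of the outputs.\<close>
  moreover have "sem (formula_of (H_upto (2 * m))) \<sigma> \<longleftrightarrow>
      (\<exists>\<tau>. (\<forall>x. x \<notin> outputs m \<longrightarrow> \<tau> x = \<sigma> x) \<and> sem (formula_of G) \<tau>)" for \<sigma>
    using skolem unfolding sem_H(2) skolem_vector_def by blast
  ultimately show "independent_of (outputs m) (sem (formula_of (relabel_true (map set S) H)))"
    by (simp add: independent_of_def)
qed

end

definition SAUNF_of_skolem :: "nat \<Rightarrow> circuit \<Rightarrow> circuit list \<Rightarrow> circuit" where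
  "SAUNF_of_skolem m G \<Psi> =
     (let \<psi> = nth_default [] \<Psi> in
      wrap (copies_base (length G) \<psi> m + 7 * m + length G - 1 + m + 1) (SAUNF_array m G \<psi>))"

definition SAUNF_sets :: "nat \<Rightarrow> circuit \<Rightarrow> circuit list \<Rightarrow> nat list list" where
  "SAUNF_sets m G \<Psi> =
     map (\<lambda>i. [copies_base (length G) (nth_default [] \<Psi>) m + 2 * m + i]) [0..<2 * m]"

lemma SAUNF_of_skolem:
  assumes "circuit_over (inputs n \<union> outputs m) G" "skolem_vector n m G \<Psi>" "m \<ge> 1"
  shows "SAUNF n m (SAUNF_of_skolem m G \<Psi>) (map set (SAUNF_sets m G \<Psi>))"
    and "equivalent (SAUNF_of_skolem m G \<Psi>) G"
    and "length (SAUNF_of_skolem m G \<Psi>) = 4 * length G + 4 * vector_size \<Psi> + 16 * m + 6"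
proof -
  have len: "length \<Psi> = m" using assms(2) by (simp add: skolem_vector_def)
  interpret SAUNF_construction n m G \<Psi> "nth_default [] \<Psi>"
    by unfold_locales (use assms len in \<open>auto simp: nth_default_def\<close>)
  show "SAUNF n m (SAUNF_of_skolem m G \<Psi>) (map set (SAUNF_sets m G \<Psi>))"
    using SAUNF_H by (simp add: SAUNF_of_skolem_def SAUNF_sets_def Let_def)
  show "equivalent (SAUNF_of_skolem m G \<Psi>) G"
    using sem_H(1) by (auto simp: SAUNF_of_skolem_def Let_def equivalent_def)
  have "map (nth_default [] \<Psi>) [0..<m] = \<Psi>"
    using len by (intro nth_equalityI) (auto simp: nth_default_def)
  then have "p = length G + 1 + 2 * vector_size \<Psi>"
    by (simp add: copies_base_def vector_size_def length_concat)
  \<comment> \<open>The array has \<open>2 * N + 2 * v + 8 * m + 2\<close> gates, \<open>v\<close>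
    being the size of \<open>\<Psi>\<close>; \<open>wrap\<close> doubles this and adds 2.\<close>
  then show "length (SAUNF_of_skolem m G \<Psi>) = 4 * length G + 4 * vector_size \<Psi> + 16 * m + 6"
    using N by (simp add: SAUNF_of_skolem_def Let_def length_wrap length_array)
qed

section \<open>Polynomial-time constructions\<close>

lemma polytime_const: "polytime e (\<lambda>a. t)"
  by (induction t) (auto intro: polytime_Tip polytime_Node)

lemma enc_circuit_eq: "enc_circuit = enc_list enc_gate"
  by (simp add: fun_eq_iff enc_circuit_def)

lemma polytime_And: "polytime e (\<lambda>a. enc_nat (u a)) \<Longrightarrow> polytime e (\<lambda>a. enc_nat (v a)) \<Longrightarrow> polytime e (\<lambda>a. enc_gate (And (u a) (v a)))"
  unfolding enc_gate.simps by (intro polytime_Node polytime_const)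

lemma polytime_Or: "polytime e (\<lambda>a. enc_nat (u a)) \<Longrightarrow> polytime e (\<lambda>a. enc_nat (v a)) \<Longrightarrow> polytime e (\<lambda>a. enc_gate (Or (u a) (v a)))"
  unfolding enc_gate.simps by (intro polytime_Node polytime_const)

lemma polytime_Pos_Out: "polytime e (\<lambda>a. enc_nat (x a)) \<Longrightarrow> polytime e (\<lambda>a. enc_gate (Leaf (Lit (Pos (Out (x a))))))"
  unfolding enc_gate.simps enc_label.simps enc_lit.simps enc_var.simps by (intro polytime_Node polytime_const)

lemma polytime_Neg_Out: "polytime e (\<lambda>a. enc_nat (x a)) \<Longrightarrow> polytime e (\<lambda>a. enc_gate (Leaf (Lit (Neg (Out (x a))))))"
  unfolding enc_gate.simps enc_label.simps enc_lit.simps enc_var.simps by (intro polytime_Node polytime_const)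

lemma polytime_pred_Tip: "polytime e f \<Longrightarrow> polytime_pred e (\<lambda>a. f a = Tip)"
  by (erule polytime_predI) simp

lemmas polytime_tree_intros = polytime_left polytime_right polytime_Node polytime_if_Tip polytime_const

section \<open>Recognizing and decomposing encoded gates\<close>

definition is_leaf :: "gate \<Rightarrow> bool" where "is_leaf g \<longleftrightarrow> (\<exists>b. g = Leaf b)"
definition is_or :: "gate \<Rightarrow> bool" where "is_or g \<longleftrightarrow> (\<exists>u v. g = Or u v)"
definition is_pos_out :: "gate \<Rightarrow> bool" where "is_pos_out g \<longleftrightarrow> (\<exists>x. g = Leaf (Lit (Pos (Out x))))"
definition is_neg_out :: "gate \<Rightarrow> bool" where "is_neg_out g \<longleftrightarrow> (\<exists>x. g = Leaf (Lit (Neg (Out x))))"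

fun gate_fst :: "gate \<Rightarrow> nat" where
  "gate_fst (And u v) = u" | "gate_fst (Or u v) = u" | "gate_fst (Leaf b) = 0"

fun gate_snd :: "gate \<Rightarrow> nat" where
  "gate_snd (And u v) = v" | "gate_snd (Or u v) = v" | "gate_snd (Leaf b) = 0"

fun out_index :: "gate \<Rightarrow> nat" where
  "out_index (Leaf (Lit (Pos (Out x)))) = x"
| "out_index (Leaf (Lit (Neg (Out x)))) = x"
| "out_index _ = 0"

lemma gate_exhaust:
  obtains u v where "g = And u v" | u v where "g = Or u v" | b where "g = Leaf (Const b)"
    | x where "g = Leaf (Lit (Pos (Inp x)))" | x where "g = Leaf (Lit (Pos (Out x)))"
    | "g = Leaf (Lit (Pos W))" | "g = Leaf (Lit (Pos W'))"
    | x where "g = Leaf (Lit (Neg (Inp x)))" | x where "g = Leaf (Lit (Neg (Out x)))"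
    | "g = Leaf (Lit (Neg W))" | "g = Leaf (Lit (Neg W'))"
  by (metis gate.exhaust label.exhaust literal.exhaust var.exhaust)

context
  fixes e :: "'a \<Rightarrow> tree" and g :: "'a \<Rightarrow> gate"
  assumes g: "polytime e (\<lambda>a. enc_gate (g a))"
begin

lemma polytime_is_leaf: "polytime_pred e (\<lambda>a. is_leaf (g a))"
proof (rule polytime_predI)
  show "polytime e (\<lambda>a. left (enc_gate (g a)))" by (intro polytime_left g)
  show "left (enc_gate (g a)) = Tip \<longleftrightarrow> is_leaf (g a)" for a by (cases "g a") (auto simp: is_leaf_def enc_nat_Tip)
qed

text \<open>Gate tags are unary: 0 for leaves, 1 for \<and>, 2 for \<or>. Only the last is nonempty
  after dropping one unit.\<close>

lemma polytime_is_or: "polytime_pred e (\<lambda>a. is_or (g a))"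
proof -
  have "polytime_pred e (\<lambda>a. \<not> is_or (g a))"
  proof (rule polytime_predI)
    show "polytime e (\<lambda>a. right (left (enc_gate (g a))))" by (intro polytime_left polytime_right g)
    show "right (left (enc_gate (g a))) = Tip \<longleftrightarrow> \<not> is_or (g a)" for a
      by (cases "g a") (auto simp: is_or_def numeral_2_eq_2)
  qed
  from polytime_pred_not[OF this] show ?thesis by simp
qed

lemma polytime_is_pos_out: "polytime_pred e (\<lambda>a. is_pos_out (g a))"
proof -
  let ?t = "\<lambda>a. enc_gate (g a)"
  \<comment> \<open>Follow the tags: leaf, literal, sign, and then the variable tag, which must be
    exactly 1; 0 is an input, 2 and 3 are \<open>W\<close> and \<open>W'\<close>.\<close>
  have "is_pos_out (g a) \<longleftrightarrow> left (?t a) = Tip \<and> left (right (?t a)) = Tip \<and> left (right (right (?t a))) = Tip \<and>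
    \<not> left (right (right (right (?t a)))) = Tip \<and> right (left (right (right (right (?t a))))) = Tip" for a
    by (cases "g a" rule: gate_exhaust) (simp_all add: is_pos_out_def numeral_2_eq_2 numeral_3_eq_3)
  then show ?thesis
    by (simp only:) (intro polytime_pred_conj polytime_pred_not polytime_pred_Tip polytime_left polytime_right g)
qed

lemma polytime_is_neg_out: "polytime_pred e (\<lambda>a. is_neg_out (g a))"
proof -
  let ?t = "\<lambda>a. enc_gate (g a)"
  have "is_neg_out (g a) \<longleftrightarrow> left (?t a) = Tip \<and> left (right (?t a)) = Tip \<and> \<not> left (right (right (?t a))) = Tip \<and>
    \<not> left (right (right (right (?t a)))) = Tip \<and> right (left (right (right (right (?t a))))) = Tip" for a
    by (cases "g a" rule: gate_exhaust) (simp_all add: is_neg_out_def numeral_2_eq_2 numeral_3_eq_3)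
  then show ?thesis
    by (simp only:) (intro polytime_pred_conj polytime_pred_not polytime_pred_Tip polytime_left polytime_right g)
qed

lemma polytime_gate_fst: "polytime e (\<lambda>a. enc_nat (gate_fst (g a)))"
proof -
  have "enc_nat (gate_fst (g a)) = (if left (enc_gate (g a)) = Tip then Tip else left (right (enc_gate (g a))))" for a
    by (cases "g a") (auto simp: enc_nat_Tip)
  then show ?thesis by (simp only:) (intro polytime_tree_intros g)
qed

lemma polytime_gate_snd: "polytime e (\<lambda>a. enc_nat (gate_snd (g a)))"
proof -
  have "enc_nat (gate_snd (g a)) = (if left (enc_gate (g a)) = Tip then Tip else right (right (enc_gate (g a))))" for a
    by (cases "g a") (auto simp: enc_nat_Tip)
  then show ?thesis by (simp only:) (intro polytime_tree_intros g)
qed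

lemma polytime_out_index: "polytime e (\<lambda>a. enc_nat (out_index (g a)))"
proof -
  let ?i = "\<lambda>a. right (right (right (right (enc_gate (g a)))))"
  have "enc_nat (out_index (g a)) = (if is_pos_out (g a) then ?i a else if is_neg_out (g a) then ?i a else Tip)" for a
    by (cases "g a" rule: gate_exhaust) (simp_all add: is_pos_out_def is_neg_out_def)
  then show ?thesis
    by (simp only:) (intro polytime_if[where ex = "\<lambda>x. x"] polytime_is_pos_out polytime_is_neg_out polytime_tree_intros g)
qed

lemma polytime_dual_gate: "polytime e (\<lambda>a. enc_gate (dual_gate (g a)))"
proof -
  let ?t = "\<lambda>a. enc_gate (g a)"
  let ?flip = "\<lambda>t. if t = Tip then Node Tip Tip else Tip"
  have "enc_gate (dual_gate (g a)) =
    (if is_leaf (g a) then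
       (if left (right (?t a)) = Tip then Node Tip (Node Tip (Node (?flip (left (right (right (?t a)))))
          (right (right (right (?t a))))))
        else Node Tip (Node (Node Tip Tip) (?flip (right (right (?t a))))))
     else if is_or (g a) then Node (enc_nat 1) (right (?t a)) else Node (enc_nat 2) (right (?t a)))" for a
    by (cases "g a" rule: gate_exhaust) (simp_all add: is_leaf_def is_or_def)
  then show ?thesis
    by (simp only:) (intro polytime_if[where ex = "\<lambda>x. x"] polytime_is_leaf polytime_is_or polytime_tree_intros g)
qed

text \<open>Pattern matching is replaced by decidable tests and total selectors; output leaves are
  tested before leaves in general.\<close>

lemma polytime_subst_gate:
  assumes "polytime e (\<lambda>a. enc_nat (b a))" "polytime e (\<lambda>a. enc_nat (c a))" "polytime e (\<lambda>a. enc_nat (P a))" "polytime e (\<lambda>a. enc_nat (Q a))"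
  shows "polytime e (\<lambda>a. enc_gate (subst_gate (b a) (c a) (P a) (Q a) (g a)))"
proof -
  have "subst_gate (b a) (c a) (P a) (Q a) (g a) =
    (if is_pos_out (g a) then And (P a + out_index (g a)) (c a)
     else if is_neg_out (g a) then And (Q a + out_index (g a)) (c a)
     else if is_leaf (g a) then g a
     else if is_or (g a) then Or (b a + gate_fst (g a)) (b a + gate_snd (g a))
     else And (b a + gate_fst (g a)) (b a + gate_snd (g a)))" for a
    by (cases "g a" rule: gate_exhaust) (simp_all add: is_leaf_def is_or_def is_pos_out_def is_neg_out_def)
  then show ?thesis
    by (simp only:) (intro polytime_if[where ex = enc_gate] polytime_is_pos_out polytime_is_neg_out polytime_is_leaf polytime_is_or polytime_And polytime_Or
        polytime_add polytime_out_index polytime_gate_fst polytime_gate_snd g assms)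
qed

lemma polytime_update_gate:
  assumes "polytime e (\<lambda>a. enc_nat (r a))" "polytime e (\<lambda>a. enc_nat (r' a))" "polytime e (\<lambda>a. enc_nat (P a))" "polytime e (\<lambda>a. enc_nat (x a))"
  shows "polytime e (\<lambda>a. enc_gate (update_gate (g a) (r a) (r' a) (P a) (x a)))"
proof -
  have "g a = Leaf (Lit (Pos (Out (x a)))) \<longleftrightarrow> is_pos_out (g a) \<and> out_index (g a) = x a"
    "g a = Leaf (Lit (Neg (Out (x a)))) \<longleftrightarrow> is_neg_out (g a) \<and> out_index (g a) = x a" for a
    by (auto simp: is_pos_out_def is_neg_out_def)
  then show ?thesis unfolding update_gate_def
    by (simp only:) (intro polytime_if[where ex = enc_gate] polytime_pred_conj polytime_eq_nat polytime_is_pos_out polytime_is_neg_out polytime_And polytime_Or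
        polytime_add polytime_out_index polytime_const assms)
qed

end

lemma polytime_map_upt:
  assumes "polytime e (\<lambda>a. enc_nat (n a))"
    and "polytime (\<lambda>p. Node (e (fst p)) (enc_nat (snd p))) (\<lambda>p. ey (f (fst p) (snd p)))"
  shows "polytime e (\<lambda>a. enc_list ey (map (f a) [0..<n a]))"
  using polytime_map[OF polytime_upt[OF assms(1)], of ey f, OF assms(2)] .

lemmas polytime_intros = polytime_const polytime_add polytime_mult polytime_diff polytime_length[where ex = enc_gate]
  polytime_append polytime_concat polytime_Cons polytime_map_upt polytime_map[where ex = enc_gate] polytime_replicate
  polytime_nth_default[where ex = enc_gate] polytime_nth_default[where ex = enc_nat]
  polytime_nth_default[where ex = "enc_list enc_nat"] polytime_nth_default[where ex = "enc_list enc_gate"]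
  polytime_And polytime_Or polytime_Pos_Out polytime_Neg_Out polytime_subst_gate polytime_dual_gate polytime_update_gate polytime_snd polytime_weaken

section \<open>Polynomial running time of both constructions\<close>

lemma polytime_wrap:
  assumes "polytime e (\<lambda>a. enc_nat (t a))" "polytime e (\<lambda>a. enc_list enc_gate (A a))"
  shows "polytime e (\<lambda>a. enc_list enc_gate (wrap (t a) (A a)))"
  unfolding wrap_def by (intro polytime_intros assms)

lemma polytime_dual_copies:
  assumes "polytime e (\<lambda>a. enc_nat (b a))" "polytime e (\<lambda>a. enc_nat (c a))" "polytime e (\<lambda>a. enc_nat (P a))" "polytime e (\<lambda>a. enc_nat (Q a))"
    "polytime e (\<lambda>a. enc_list enc_gate (G a))"
  shows "polytime e (\<lambda>a. enc_list enc_gate (dual_copies (b a) (c a) (P a) (Q a) (G a)))"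
  unfolding dual_copies_def by (intro polytime_intros assms)

lemma polytime_step_block:
  assumes "polytime e (\<lambda>a. enc_nat (m a))" "polytime e (\<lambda>a. enc_nat (P a))" "polytime e (\<lambda>a. enc_list enc_gate (H a))"
    "polytime e (\<lambda>a. enc_gate (g a))"
  shows "polytime e (\<lambda>a. enc_list enc_gate (step_block (m a) (P a) (H a) (g a)))"
  unfolding step_block_def Let_def by (intro polytime_dual_copies polytime_intros assms)

lemma polytime_relabel:
  assumes "polytime e (\<lambda>a. enc_list enc_nat (l a))" "polytime e (\<lambda>a. enc_list enc_gate (G a))"
  shows "polytime e (\<lambda>a. enc_list enc_gate (relabel (set (l a)) (Const b) (G a)))"
proof -
  have eq: "relabel (set l) (Const b) G = map (\<lambda>v. if v \<in> set l then Leaf (Const b) else nth_default (Leaf (Const b)) G v)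
      [0..<length G]" for l G
    by (auto simp: relabel_def nth_default_def)
  show ?thesis unfolding eq by (intro polytime_if[where ex = enc_gate] polytime_mem polytime_intros assms)
qed

lemma polytime_skolem_of_SAUNF:
  assumes "polytime e (\<lambda>a. enc_nat (m a))" "polytime e (\<lambda>a. enc_list enc_gate (G a))"
    "polytime e (\<lambda>a. enc_list (enc_list enc_nat) (S a))"
  shows "polytime e (\<lambda>a. enc_list (enc_list enc_gate) (skolem_of_SAUNF (m a) (G a) (S a)))"
  unfolding skolem_of_SAUNF_def skolem_array_def
  by (intro polytime_wrap polytime_step_block polytime_relabel polytime_length[where ex = "enc_list enc_nat"] polytime_intros assms)

lemma polytime_copies_base:
  assumes "polytime e (\<lambda>a. enc_nat (N a))" "polytime e (\<lambda>a. enc_list (enc_list enc_gate) (\<Psi> a))" "polytime e (\<lambda>a. enc_nat (i a))"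
  shows "polytime e (\<lambda>a. enc_nat (copies_base (N a) (nth_default [] (\<Psi> a)) (i a)))"
  unfolding copies_base_def by (intro polytime_intros assms)

lemma polytime_SAUNF_of_skolem:
  assumes "polytime e (\<lambda>a. enc_nat (m a))" "polytime e (\<lambda>a. enc_list enc_gate (G a))"
    "polytime e (\<lambda>a. enc_list (enc_list enc_gate) (\<Psi> a))"
  shows "polytime e (\<lambda>a. enc_list enc_gate (SAUNF_of_skolem (m a) (G a) (\<Psi> a)))"
  unfolding SAUNF_of_skolem_def SAUNF_array_def Let_def
  by (intro polytime_wrap polytime_copies_base polytime_dual_copies polytime_intros assms)

lemma polytime_SAUNF_sets:
  assumes "polytime e (\<lambda>a. enc_nat (m a))" "polytime e (\<lambda>a. enc_list enc_gate (G a))"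
    "polytime e (\<lambda>a. enc_list (enc_list enc_gate) (\<Psi> a))"
  shows "polytime e (\<lambda>a. enc_list (enc_list enc_nat) (SAUNF_sets (m a) (G a) (\<Psi> a)))"
  unfolding SAUNF_sets_def
  by (intro polytime_copies_base polytime_intros assms)

text \<open>A given program may destroy its input, which the postprocessing needs. The input is
  saved in a register that the program never mentions; afterwards input and result are paired and
  passed on.\<close>

lemma polytime_after_program:
  assumes f: "polytime (\<lambda>p. Node (ei (fst p)) (ey (snd p))) (\<lambda>p. eo (f (fst p) (snd p)))"
  obtains c' q where "\<And>x y b. computes_within c (ei x) b (ey y) \<Longrightarrow>
    computes_within c' (ei x) (poly q (tree_size (ei x) + b)) (eo (f x y))"
proof -
  obtain p d where "\<And>i j k a s. i < k \<Longrightarrow> j < k \<Longrightarrow> s i = Node (ei (fst a)) (ey (snd a)) \<Longrightarrow>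
     \<exists>s'. runs (d i j k) s (poly p (tree_size (Node (ei (fst a)) (ey (snd a))))) s' \<and> s' j = eo (f (fst a) (snd a)) \<and>
           (\<forall>r<k. r \<noteq> j \<longrightarrow> s' r = s r)"
    using polytimeE[OF f] by metis
  from this[of 0 1 0 _ "(_, _)"]
  have d: "s 0 = Node (ei x) (ey y) \<Longrightarrow>
     \<exists>s'. runs (d 0 0 1) s (poly p (tree_size (Node (ei x) (ey y)))) s' \<and> s' 0 = eo (f x y)" for s x y
    by (metis fst_conv snd_conv zero_less_one)
  \<comment> \<open>\<open>K\<close> lies beyond every register of \<open>c\<close>, and
    \<open>Suc\<close> makes it differ from register 0, which holds input and result.\<close>
  define K where "K = Suc (com_bound c)"
  define E where "E = Cons_Expr (Var K) (Var 0)"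
  define c' where "c' = Seq (Assign K (Var 0)) (Seq c (Seq (Assign 0 E) (d 0 0 1)))"
  define q where "q = [:1, 6:] + pcompose p [:1, 2:]"
  show thesis
  proof (rule that[of c' q])
    fix x y b
    assume "computes_within c (ei x) b (ey y)"
    then obtain t s where t: "t \<le> b" "exec c ((\<lambda>_. Tip)(0 := ei x)) t s" "s 0 = ey y"
      by (auto simp: computes_within_def)
    let ?s0 = "(\<lambda>_. Tip)(0 := ei x)"
    let ?u = "?s0(K := ei x)"
    have start: "runs (Assign K (Var 0)) ?s0 (tree_size (ei x)) ?u"
      using runs_assign[of K "Var 0" ?s0] by simp
    obtain u' where u': "exec c ?u t u'" "\<forall>r<K. s r = u' r" "\<forall>r\<ge>K. u' r = ?u r"
      using exec_frame[OF t(2), of K ?u] by (auto simp: K_def)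
    have run: "runs c ?u b u'" using u'(1) t(1) by (auto simp: runs_def)
    have u0: "u' 0 = ey y" "u' K = ei x" using u'(2,3) t(3) by (auto simp: K_def)
    let ?v = "u'(0 := val E u')"
    have v: "?v 0 = Node (ei x) (ey y)" using u0 by (simp add: E_def)
    obtain w where w: "runs (d 0 0 1) ?v (poly p (tree_size (Node (ei x) (ey y)))) w" "w 0 = eo (f x y)"
      using d[where s = ?v and x = x and y = y, OF v] by blast
    let ?z = "tree_size (ei x) + b"
    \<comment> \<open>Register 0 is either unchanged or holds a value of size at most the running
      time.\<close>
    have y: "tree_size (ey y) \<le> ?z"
      using exec_size[OF t(2), of 0] t(1,3) by auto
    then have "poly p (tree_size (Node (ei x) (ey y))) \<le> poly (pcompose p [:1, 2:]) ?z"
      unfolding poly_pcompose by (intro poly_nat_mono) simp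
    moreover have "cost E u' \<le> 4 * ?z + 1" using y u0 by (simp add: E_def)
    ultimately have "tree_size (ei x) + (b + (cost E u' + poly p (tree_size (Node (ei x) (ey y))))) \<le> poly q ?z"
      by (simp add: q_def)
    then have "runs c' ?s0 (poly q ?z) w"
      unfolding c'_def by (rule runs_mono[OF runs_seq[OF start runs_seq[OF run runs_seq[OF runs_assign w(1)]]]])
    with w(2) show "computes_within c' (ei x) (poly q ?z) (eo (f x y))"
      by (auto simp: runs_def computes_within_def)
  qed
qed

text \<open>Indices are unary: children are below \<open>length G\<close>, variable indices below
  \<open>n\<close> or \<open>m\<close>. The bound on the number of variables turns polynomials in
  the size of the encoding into polynomials in \<open>length G\<close>.\<close>

lemma tree_size_enc_spec:
  assumes wf: "wf_spec (n, m, G)" and vars: "n + m \<le> poly r (length G)"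
  shows "tree_size (enc_spec (n, m, G)) \<le> poly ([:5:] + smult 2 r + [:0, 1:] * ([:30, 4:] + smult 2 r)) (length G)"
proof -
  let ?N = "length G"
  have "tree_size (enc_gate g) \<le> 4 * ?N + 2 * (n + m) + 29" if "g \<in> set G" for g
  proof -
    obtain w where w: "w < ?N" "g = G ! w" using \<open>g \<in> set G\<close> by (auto simp: in_set_conv_nth)
    then have ok: "gate_ok (inputs n \<union> outputs m) w g" using wf by (simp add: circuit_over_def)
    show ?thesis
      using ok w(1)
      by (cases g rule: gate_exhaust) (auto simp: tree_size_enc_nat inputs_def outputs_def)
  qed
  then have "tree_size (enc_circuit G) \<le> ?N * (4 * ?N + 2 * (n + m) + 29 + 1) + 1"
    unfolding enc_circuit_def by (rule tree_size_enc_list_le)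
  also have "\<dots> \<le> ?N * (4 * ?N + 2 * poly r ?N + 29 + 1) + 1"
    using vars by (intro add_le_mono mult_le_mono) auto
  finally have "tree_size (enc_circuit G) \<le> \<dots>" .
  then show ?thesis using vars by (simp add: tree_size_enc_nat algebra_simps)
qed

lemma polytime_spec_components:
  "polytime (\<lambda>p. Node (enc_spec (fst p)) (ey (snd p))) (\<lambda>p. enc_nat (fst (snd (fst p))))"
  "polytime (\<lambda>p. Node (enc_spec (fst p)) (ey (snd p))) (\<lambda>p. enc_list enc_gate (snd (snd (fst p))))"
proof -
  have e: "enc_spec s = Node (enc_nat (fst s)) (Node (enc_nat (fst (snd s))) (enc_list enc_gate (snd (snd s))))" for s
    by (cases s) (simp add: enc_circuit_def)
  show "polytime (\<lambda>p. Node (enc_spec (fst p)) (ey (snd p))) (\<lambda>p. enc_nat (fst (snd (fst p))))"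
    unfolding e by (rule polytime_Node_fst[OF polytime_Node_snd[OF polytime_Node_fst[OF polytime_id]]])
  show "polytime (\<lambda>p. Node (enc_spec (fst p)) (ey (snd p))) (\<lambda>p. enc_list enc_gate (snd (snd (fst p))))"
    unfolding e by (rule polytime_Node_snd[OF polytime_Node_snd[OF polytime_Node_fst[OF polytime_id]]])
qed

lemma computes_within_mono: "computes_within c x b y \<Longrightarrow> b \<le> b' \<Longrightarrow> computes_within c x b' y"
  unfolding computes_within_def using order.trans by blast

text \<open>Postcomposing with a polytime \<open>f\<close> turns a solver for \<open>P\<close> into
  one for \<open>Q\<close>; both directions of the first equivalence are instances, with
  \<open>f\<close> given by one of the two constructions.\<close>

lemma poly_time_transfer:
  assumes wf: "\<forall>s \<in> C. wf_spec s" and vars: "vars_poly_bounded C"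
    and f: "polytime (\<lambda>p. Node (enc_spec (fst p)) (ey (snd p))) (\<lambda>p. eo (f (fst p) (snd p)))"
    and c: "\<forall>(n, m, G) \<in> C. \<exists>y. computes_within c (enc_spec (n, m, G)) (poly p (length G)) (ey y) \<and> P n m G y"
    and P: "\<And>n m G y. wf_spec (n, m, G) \<Longrightarrow> P n m G y \<Longrightarrow> Q n m G (f (n, m, G) y)"
  shows "\<exists>c (q :: nat poly). \<forall>(n, m, G) \<in> C. \<exists>z. computes_within c (enc_spec (n, m, G)) (poly q (length G)) (eo z) \<and> Q n m G z"
proof -
  obtain r where r: "\<forall>(n, m, G) \<in> C. n + m \<le> poly r (length G)"
    using vars by (auto simp: vars_poly_bounded_def)
  obtain c' q where c': "\<And>x y b. computes_within c (enc_spec x) b (ey y) \<Longrightarrow>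
    computes_within c' (enc_spec x) (poly q (tree_size (enc_spec x) + b)) (eo (f x y))"
    using polytime_after_program[where f = f and ei = enc_spec and ey = ey and eo = eo, OF f] by metis
  define R where "R = [:5:] + smult 2 r + [:0, 1:] * ([:30, 4:] + smult 2 r)"
  have "\<exists>z. computes_within c' (enc_spec (n, m, G)) (poly (pcompose q (R + p)) (length G)) (eo z) \<and> Q n m G z"
    if C: "(n, m, G) \<in> C" for n m G
  proof -
    obtain y where y: "computes_within c (enc_spec (n, m, G)) (poly p (length G)) (ey y)" "P n m G y"
      using c C by blast
    have w: "wf_spec (n, m, G)" using wf C by blast
    have "n + m \<le> poly r (length G)" using r C by blast
    then have "tree_size (enc_spec (n, m, G)) \<le> poly R (length G)"
      unfolding R_def by (rule tree_size_enc_spec[OF w])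
    then have "poly q (tree_size (enc_spec (n, m, G)) + poly p (length G)) \<le> poly (pcompose q (R + p)) (length G)"
      unfolding poly_pcompose poly_add by (intro poly_nat_mono add_right_mono)
    then have "computes_within c' (enc_spec (n, m, G)) (poly (pcompose q (R + p)) (length G)) (eo (f (n, m, G) y))"
      by (rule computes_within_mono[OF c'[OF y(1)]])
    with P[OF w y(2)] show ?thesis by blast
  qed
  then show ?thesis by blast
qed

text \<open>The sets are nonempty and disjoint, so distinct representatives can be chosen. The
  Skolem array has one block per set, whereas \<open>poly_size_SAUNF\<close> bounds only the size of
  \<open>H\<close>.\<close>

lemma SAUNF_length_le:
  assumes "SAUNF n m H S"
  shows "length S \<le> length H"
proof -
  have disj: "i < length S \<Longrightarrow> j < length S \<Longrightarrow> i \<noteq> j \<Longrightarrow> S ! i \<inter> S ! j = {}" for i j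
    using assms by (auto simp: SAUNF_def)
  have "\<forall>j<length S. \<exists>v. v \<in> S ! j \<and> v < length H"
    using assms by (fastforce simp: SAUNF_def labeled_by_def lit_leaves_def)
  then obtain v where v: "\<And>j. j < length S \<Longrightarrow> v j \<in> S ! j \<and> v j < length H" by metis
  have "inj_on v {..<length S}"
    using v disj by (intro inj_onI) (metis IntI empty_iff lessThan_iff)
  then have "card {..<length S} \<le> card {..<length H}"
    using v by (intro card_inj_on_le) auto
  then show ?thesis by simp
qed

text \<open>Sets of nodes are finite. The construction takes lists of nodes, while the size
  statement supplies sets.\<close>

lemma SAUNF_lists:
  assumes "SAUNF n m H S"
  obtains S' where "S = map set S'"
proof
  have "finite L" if "L \<in> set S" for L
  proof -
    obtain j where "j < length S" "L = S ! j" using \<open>L \<in> set S\<close> by (auto simp: in_set_conv_nth)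
    then have "L \<subseteq> {..<length H}" using assms by (fastforce simp: SAUNF_def labeled_by_def lit_leaves_def)
    then show ?thesis by (rule finite_subset) simp
  qed
  then show "S = map set (map sorted_list_of_set S)" by (simp add: map_idI)
qed

theorem theorem4:
  fixes C :: "spec set"
  assumes "\<forall>s \<in> C. wf_spec s"
    and "vars_poly_bounded C"
  shows "(poly_time_synthesis C \<longleftrightarrow> poly_time_SAUNF_compilation C) \<and>
         (poly_size_skolem C \<longleftrightarrow> poly_size_SAUNF C)"
proof (intro conjI iffI)
  obtain r where r: "\<forall>(n, m, G) \<in> C. n + m \<le> poly r (length G)"
    using assms(2) by (auto simp: vars_poly_bounded_def)
  \<comment> \<open>Circuit and sets form one value, so that \<open>poly_time_transfer\<close>
    applies to the pair.\<close>
  let ?enc = "\<lambda>y. Node (enc_circuit (fst y)) (enc_list (enc_list enc_nat) (snd y))"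
  {
    assume "poly_time_synthesis C"
    then obtain c p where c: "\<forall>(n, m, G) \<in> C. \<exists>\<Psi>. computes_within c (enc_spec (n, m, G)) (poly p (length G))
        (enc_list enc_circuit \<Psi>) \<and> skolem_vector n m G \<Psi>"
      by (auto simp: poly_time_synthesis_def)
    let ?f = "\<lambda>s \<Psi>. (SAUNF_of_skolem (fst (snd s)) (snd (snd s)) \<Psi>, SAUNF_sets (fst (snd s)) (snd (snd s)) \<Psi>)"
    have "polytime (\<lambda>p. Node (enc_spec (fst p)) (enc_list enc_circuit (snd p))) (\<lambda>p. ?enc (?f (fst p) (snd p)))"
      unfolding fst_conv snd_conv enc_circuit_eq
      by (intro polytime_Node polytime_SAUNF_of_skolem polytime_SAUNF_sets polytime_spec_components polytime_snd)
    from poly_time_transfer[where f = ?f and eo = ?enc and ey = "enc_list enc_circuit", OF assms this c, of "\<lambda>n m G y. equivalent (fst y) G \<and> SAUNF n m (fst y) (map set (snd y))"]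
    show "poly_time_SAUNF_compilation C"
      unfolding poly_time_SAUNF_compilation_def using SAUNF_of_skolem by (fastforce simp: split_beta)
  next
    assume "poly_time_SAUNF_compilation C"
    then obtain c p where "\<forall>(n, m, G) \<in> C. \<exists>H S. computes_within c (enc_spec (n, m, G)) (poly p (length G))
        (Node (enc_circuit H) (enc_list (enc_list enc_nat) S)) \<and> equivalent H G \<and> SAUNF n m H (map set S)"
      by (auto simp: poly_time_SAUNF_compilation_def)
    then have c: "\<forall>(n, m, G) \<in> C. \<exists>y. computes_within c (enc_spec (n, m, G)) (poly p (length G)) (?enc y) \<and>
        equivalent (fst y) G \<and> SAUNF n m (fst y) (map set (snd y))"
      by fastforce
    let ?f = "\<lambda>s y. skolem_of_SAUNF (fst (snd s)) (fst y) (snd y)"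
    have "polytime (\<lambda>p. Node (enc_spec (fst p)) (?enc (snd p))) (\<lambda>p. enc_list enc_circuit (?f (fst p) (snd p)))"
      unfolding enc_circuit_eq
      by (intro polytime_skolem_of_SAUNF polytime_spec_components[of "\<lambda>y. Node (enc_list enc_gate (fst y)) (enc_list (enc_list enc_nat) (snd y))"]
          polytime_Node_fst[OF polytime_Node_snd[OF polytime_id]] polytime_Node_snd[OF polytime_Node_snd[OF polytime_id]])
    from poly_time_transfer[where f = ?f and eo = "enc_list enc_circuit" and ey = ?enc, OF assms this c, of skolem_vector]
    show "poly_time_synthesis C"
      unfolding poly_time_synthesis_def using skolem_vector_of_SAUNF(1) by (fastforce simp: split_beta)
  next
    assume "poly_size_skolem C"
    then obtain p where p: "\<forall>(n, m, G) \<in> C. \<exists>\<Psi>. skolem_vector n m G \<Psi> \<and> vector_size \<Psi> \<le> poly p (length G)"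
      by (auto simp: poly_size_skolem_def)
    \<comment> \<open>The polynomial is the exact length of \<open>SAUNF_of_skolem\<close> with the
      bounds for \<open>\<Psi>\<close> and \<open>m\<close> inserted.\<close>
    have "\<exists>H S. equivalent H G \<and> length H \<le> poly ([:6, 4:] + smult 4 p + smult 16 r) (length G) \<and> SAUNF n m H S"
      if C: "(n, m, G) \<in> C" for n m G
    proof -
      obtain \<Psi> where \<Psi>: "skolem_vector n m G \<Psi>" "vector_size \<Psi> \<le> poly p (length G)" using p C by blast
      have "wf_spec (n, m, G)" using assms(1) C by blast
      then have G: "circuit_over (inputs n \<union> outputs m) G" "m \<ge> 1" by simp_all
      have "m \<le> poly r (length G)" using r C by fastforce
      then show ?thesis
        using SAUNF_of_skolem[OF G(1) \<Psi>(1) G(2)] \<Psi>(2)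
        by (intro exI[of _ "SAUNF_of_skolem m G \<Psi>"] exI[of _ "map set (SAUNF_sets m G \<Psi>)"]) simp
    qed
    then show "poly_size_SAUNF C" unfolding poly_size_SAUNF_def by blast
  next
    assume "poly_size_SAUNF C"
    then obtain p where p: "\<forall>(n, m, G) \<in> C. \<exists>H S. equivalent H G \<and> length H \<le> poly p (length G) \<and> SAUNF n m H S"
      by (auto simp: poly_size_SAUNF_def)
    \<comment> \<open>The exact size of \<open>skolem_of_SAUNF\<close>, with \<open>m\<close>
      bounded by \<open>r\<close>, and both the length of \<open>H\<close> and the number of sets
      bounded by \<open>p\<close>.\<close>
    define q where "q = r * (smult 2 (1 + smult 2 r + p * (smult 2 p + smult 2 r)) + [:2:])"
    have "\<exists>\<Psi>. skolem_vector n m G \<Psi> \<and> vector_size \<Psi> \<le> poly q (length G)"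
      if C: "(n, m, G) \<in> C" for n m G
    proof -
      obtain H S where H: "equivalent H G" "length H \<le> poly p (length G)" "SAUNF n m H S" using p C by blast
      obtain S' where S': "S = map set S'" using SAUNF_lists[OF H(3)] .
      have m: "m \<le> poly r (length G)" using r C by fastforce
      have "length S' \<le> poly p (length G)" using SAUNF_length_le[OF H(3)] H(2) S' by simp
      then have "m * (2 * (1 + 2 * m + length S' * (2 * length H + 2 * m)) + 2) \<le>
        poly r (length G) * (2 * (1 + 2 * poly r (length G) + poly p (length G) *
          (2 * poly p (length G) + 2 * poly r (length G))) + 2)"
        using m H(2) by (intro mult_le_mono add_le_mono) simp_all
      then have "vector_size (skolem_of_SAUNF m H S') \<le> poly q (length G)"
        using skolem_vector_of_SAUNF(2)[OF H(3)[unfolded S'] H(1)] by (simp add: q_def)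
      with skolem_vector_of_SAUNF(1)[OF H(3)[unfolded S'] H(1)] show ?thesis by blast
    qed
    then show "poly_size_skolem C" unfolding poly_size_skolem_def by blast
  }
qed

end
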